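(* Let $\delta\in(0,1)$, let $\mathrm{BM}$ be the Brownian mechanism associated with a function $f:\mathcal X\to\mathbb R^d$ and (decreasing) time functions $(T_n)_{n\ge1}$, and let $\psi$ be a $\delta$-privacy boundary for $\mathrm{BM}$. Let ReducedAboveThreshold be run with the algorithm $\mathrm{Alg}=\mathrm{BM}$, a threshold $\tau\in\mathbb R$, a utility $u:\mathbb R^d\times\mathcal X\to\mathbb R$ with $u(\beta,\cdot)$ $\Delta$-sensitive for every $\beta$ ($\Delta>0$), and privacy functions $\mathcal E_n:=\psi\circ T_n$, $n\ge1$, where $(\psi\circ T_n)_{n\ge1}$ is assumed to be an admissible sequence of privacy functions (positive, nondecreasing in $n$, and bounded by $\epsilon_{\max}$). Let $N(x)$ be the round at which ReducedAboveThreshold halts on input $x$. Then ReducedAboveThreshold is $(2\psi(T_{N(\cdot)}(\cdot)),\delta)$-ex-post private: for all neighbors $x\sim x'$, $$\mathbb P\left(N(x)<\infty\ \text{ and }\ \mathcal L^{\mathrm{RAT}}(x,x')>2\psi(T_{N(x)}(x))\right)\le\delta,$$ where $\mathcal L^{\mathrm{RAT}}(x,x')$ is the privacy loss between $\mathrm{ReducedAboveThreshold}(x)$ and $\mathrm{ReducedAboveThreshold}(x')$.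
   Context: $\mathcal X$ is a set of databases with an arbitrary neighboring relation $\sim$. $u(\beta,\cdot)$ is $\Delta$-sensitive if $|u(\beta,x)-u(\beta,x')|\le\Delta$ for all $x\sim x'$. Privacy loss: for a randomized algorithm $A$ on $\mathcal X$ with values in a measurable space and $x\sim x'$, let $p^x,p^{x'}$ be the densities of the laws of $A(x),A(x')$ with respect to a common reference measure (e.g. the sum of the two laws). The privacy loss between $A(x)$ and $A(x')$ is the random variable $\mathcal L(x,x')=\log\frac{p^x(A(x))}{p^{x'}(A(x))}$ (defined up to almost sure equality). $A$ is $(\mathcal E,\delta)$-ex-post private if $\mathbb P(\mathcal L(x,x')>\mathcal E(A(x)))\le\delta$ for all $x\sim x'$. Time functions: a sequence of (measurable) functions $T_n:(\mathbb R^d)^{n-1}\to\mathbb R_{>0}$, $n\ge1$ (so $T_1$ is a constant), with $T_{n+1}(\beta_{1:n})\le T_n(\beta_{1:n-1})$ for all $n\ge1$ and all $\beta_{1:n}\in(\mathbb R^d)^n$. Brownian mechanism: let $(B_t)_{t\ge0}$ be a standard $d$-dimensional Brownian motion started at $0$. $\mathrm{BM}(x)=(\mathrm{BM}_n(x))_{n\ge1}$ with $\mathrm{BM}_n(x)=f(x)+B_{T_n(x)}$, where recursively $T_n(x):=T_n(\mathrm{BM}_1(x),\dots,\mathrm{BM}_{n-1}(x))$; $\mathrm{BM}_{1:n}(x)$ denotes the first $n$ elements and $\mathcal L^{\mathrm{BM}}_{1:n}(x,x')$ the privacy loss between $\mathrm{BM}_{1:n}(x)$ and $\mathrm{BM}_{1:n}(x')$.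 $\delta$-privacy boundary: a function $\psi:\mathbb R_{>0}\to\mathbb R_{\ge0}$ with $\mathbb P(\exists n\ge1:\mathcal L^{\mathrm{BM}}_{1:n}(x,x')\ge\psi(T_n(x)))\le\delta$ for all $x\sim x'$. Privacy functions (for ReducedAboveThreshold): measurable functions $\mathcal E_n:(\mathbb R^d)^{n-1}\to\mathbb R_{>0}$, $n\ge1$, with $\mathcal E_{n+1}(\beta_{1:n})\ge\mathcal E_n(\beta_{1:n-1})$ and $\mathcal E_n\le\epsilon_{\max}$, for a fixed constant $\epsilon_{\max}>0$. Laplace process: $\mathrm{Lap}(s)$ is the centered Laplace distribution on $\mathbb R$ with density $\frac1{2s}e^{-|y|/s}$. Given $\eta>0$, $(P_t)_{t\ge\eta}$ is an inhomogeneous Poisson process with intensity $2/t$ and $P_\eta=0$; $\mathcal T_0:=\eta$, $\mathcal T_n:=\inf\{t\ge\eta:P_t\ge n\}$ for $n\ge1$; $Z_t:=\sum_{n=0}^{P_t}Y_n$ where, conditionally on the jump times, the $Y_n\sim\mathrm{Lap}(\mathcal T_n)$ are independent. ReducedAboveThreshold with algorithm $\mathrm{Alg}$ on input $x$: set $\eta:=2\Delta/\epsilon_{\max}$ and draw one path of $(Z_t)_{t\ge\eta}$, independent of $\mathrm{Alg}(x)$. For $n=1,2,\dots$: let $\epsilon_n:=\mathcal E_n(\mathrm{Alg}_{1:n-1}(x))$, $\zeta_n:=Z_{2\Delta/\epsilon_n}$, and draw $\xi_n\sim\mathrm{Lap}(4\Delta/\epsilon_n)$, independently of everything else given $\epsilon_n$.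 If $u(\mathrm{Alg}_n(x),x)+\xi_n\ge\tau+\zeta_n$, output $1$ and halt (then $N(x)=n$); otherwise output $0$ and continue. If it never halts, $N(x)=\infty$. The iterates examined are also revealed, so the full output on $\{N(x)=n\}$ is $\mathrm{Alg}_{1:n}(x)$ together with the bit string $0^{n-1}1$; $\mathcal L^{\mathrm{RAT}}$ refers to this full output. *)

theory Defs
  imports "HOL-Probability.Probability"
begin

section \<open>Privacy loss\<close>

text \<open>The reference measure with respect to which both laws are given densities.\<close>

definition sum_law :: "'a measure \<Rightarrow> 'a measure \<Rightarrow> 'a measure" where
  "sum_law \<mu> \<nu> = measure_of (space \<mu>) (sets \<mu>) (\<lambda>A. emeasure \<mu> A + emeasure \<nu> A)"

lemma sets_sum_law [simp]: "sets (sum_law \<mu> \<nu>) = sets \<mu>"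
  by (simp add: sum_law_def)

lemma emeasure_sum_law:
  assumes "sets \<nu> = sets \<mu>" and "A \<in> sets \<mu>"
  shows "emeasure (sum_law \<mu> \<nu>) A = emeasure \<mu> A + emeasure \<nu> A"
  unfolding sum_law_def
proof (rule emeasure_measure_of_sigma)
  show "sigma_algebra (space \<mu>) (sets \<mu>)" ..
  show "positive (sets \<mu>) (\<lambda>A. emeasure \<mu> A + emeasure \<nu> A)"
    by (simp add: positive_def)
  show "countably_additive (sets \<mu>) (\<lambda>A. emeasure \<mu> A + emeasure \<nu> A)"
    using assms(1) by (intro countably_additiveI) (simp add: suminf_add [symmetric] suminf_emeasure)
qed (rule assms(2))

text \<open>
  The privacy loss between outputs with laws \<open>\<mu>\<close> and \<open>\<nu>\<close>, as a function of the output \<open>y\<close> drawn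
  from \<open>\<mu>\<close>. It is extended-real valued because \<open>\<mu>\<close> need not be absolutely continuous with respect
  to \<open>\<nu>\<close>. The value at points where \<open>p = 0\<close> is immaterial, as these form a \<open>\<mu>\<close>-null set.
\<close>

definition privacy_loss :: "'a measure \<Rightarrow> 'a measure \<Rightarrow> 'a \<Rightarrow> ereal" where
  "privacy_loss \<mu> \<nu> y =
    (let p = RN_deriv (sum_law \<mu> \<nu>) \<mu> y; q = RN_deriv (sum_law \<mu> \<nu>) \<nu> y
     in if p = 0 then -\<infinity> else if q = 0 then \<infinity> else ereal (ln (enn2real p / enn2real q)))"


section \<open>The Brownian mechanism\<close>

definition brownian_motion :: "'w measure \<Rightarrow> (real \<Rightarrow> 'w \<Rightarrow> real ^ 'd) \<Rightarrow> bool" where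
  "brownian_motion M B \<longleftrightarrow>
    prob_space M \<and>
    (\<forall>t\<ge>0. B t \<in> borel_measurable M) \<and>
    (\<forall>\<omega>\<in>space M. B 0 \<omega> = 0) \<and>
    (\<forall>\<omega>\<in>space M. continuous_on {0..} (\<lambda>t. B t \<omega>)) \<and>
    (\<forall>s t. 0 \<le> s \<and> s < t \<longrightarrow>
       distributed M lborel (\<lambda>\<omega>. B t \<omega> - B s \<omega>)
         (\<lambda>y. ennreal (\<Prod>i\<in>UNIV. normal_density 0 (sqrt (t - s)) (y $ i)))) \<and>
    (\<forall>k t. 0 \<le> t 0 \<and> (\<forall>i<k. t i \<le> t (Suc i)) \<longrightarrow>
       prob_space.indep_vars M (\<lambda>_. borel) (\<lambda>i \<omega>. B (t (Suc i)) \<omega> - B (t i) \<omega>) {..<k::nat})"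

text \<open>
  A tuple \<open>\<beta>\<^sub>1, \<dots>, \<beta>\<^sub>n\<close> is an extensional function on \<open>{1..n}\<close>, so that the \<open>n\<close>-th time or
  privacy function, which takes \<open>n - 1\<close> arguments, is defined on \<open>hist_space n\<close>.
\<close>

abbreviation hist_space :: "nat \<Rightarrow> (nat \<Rightarrow> real ^ 'd) measure" where
  "hist_space n \<equiv> PiM {1..<n} (\<lambda>_. borel)"

definition time_functions :: "(nat \<Rightarrow> (nat \<Rightarrow> real ^ 'd) \<Rightarrow> real) \<Rightarrow> bool" where
  "time_functions T \<longleftrightarrow>
    (\<forall>n\<ge>1. T n \<in> borel_measurable (hist_space n)) \<and>
    (\<forall>n\<ge>1. \<forall>\<beta>\<in>space (hist_space n). 0 < T n \<beta>) \<and>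
    (\<forall>n\<ge>1. \<forall>\<beta>\<in>space (hist_space (Suc n)). T (Suc n) \<beta> \<le> T n (restrict \<beta> {1..<n}))"

lemma restrict_fundef_cong [fundef_cong]:
  "I = J \<Longrightarrow> (\<And>i. i \<in> J \<Longrightarrow> g i = h i) \<Longrightarrow> restrict g I = restrict h J"
  by (auto simp: restrict_def)

text \<open>Only the values at \<open>n \<ge> 1\<close> are meaningful.\<close>

fun brownian_mech ::
  "('x \<Rightarrow> real ^ 'd) \<Rightarrow> (nat \<Rightarrow> (nat \<Rightarrow> real ^ 'd) \<Rightarrow> real) \<Rightarrow> (real \<Rightarrow> 'w \<Rightarrow> real ^ 'd)
    \<Rightarrow> 'x \<Rightarrow> nat \<Rightarrow> 'w \<Rightarrow> real ^ 'd" where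
  "brownian_mech f T B x n \<omega> = f x + B (T n (\<lambda>i\<in>{1..<n}. brownian_mech f T B x i \<omega>)) \<omega>"

declare brownian_mech.simps [simp del]

definition brownian_mech_time ::
  "('x \<Rightarrow> real ^ 'd) \<Rightarrow> (nat \<Rightarrow> (nat \<Rightarrow> real ^ 'd) \<Rightarrow> real) \<Rightarrow> (real \<Rightarrow> 'w \<Rightarrow> real ^ 'd)
    \<Rightarrow> 'x \<Rightarrow> nat \<Rightarrow> 'w \<Rightarrow> real" where
  "brownian_mech_time f T B x n \<omega> = T n (\<lambda>i\<in>{1..<n}. brownian_mech f T B x i \<omega>)"

definition prefix_law :: "'w measure \<Rightarrow> (nat \<Rightarrow> 'w \<Rightarrow> real ^ 'd) \<Rightarrow> nat \<Rightarrow> (nat \<Rightarrow> real ^ 'd) measure" where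
  "prefix_law M Alg n = distr M (PiM {1..n} (\<lambda>_. borel)) (\<lambda>\<omega>. \<lambda>i\<in>{1..n}. Alg i \<omega>)"

definition brownian_loss ::
  "'w measure \<Rightarrow> ('x \<Rightarrow> real ^ 'd) \<Rightarrow> (nat \<Rightarrow> (nat \<Rightarrow> real ^ 'd) \<Rightarrow> real)
    \<Rightarrow> (real \<Rightarrow> 'w \<Rightarrow> real ^ 'd) \<Rightarrow> nat \<Rightarrow> 'x \<Rightarrow> 'x \<Rightarrow> 'w \<Rightarrow> ereal" where
  "brownian_loss M f T B n x x' \<omega> =
    privacy_loss (prefix_law M (brownian_mech f T B x) n) (prefix_law M (brownian_mech f T B x') n)
      (\<lambda>i\<in>{1..n}. brownian_mech f T B x i \<omega>)"

text \<open>
  The measurability conjunct keeps the bound from holding vacuously, as \<open>measure\<close> is \<open>0\<close> outside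
  the \<open>\<sigma>\<close>-algebra.
\<close>

definition privacy_boundary ::
  "'w measure \<Rightarrow> ('x \<Rightarrow> 'x \<Rightarrow> bool) \<Rightarrow> ('x \<Rightarrow> real ^ 'd) \<Rightarrow> (nat \<Rightarrow> (nat \<Rightarrow> real ^ 'd) \<Rightarrow> real)
    \<Rightarrow> (real \<Rightarrow> 'w \<Rightarrow> real ^ 'd) \<Rightarrow> real \<Rightarrow> (real \<Rightarrow> real) \<Rightarrow> bool" where
  "privacy_boundary M nb f T B \<delta> \<psi> \<longleftrightarrow>
    (\<forall>t>0. 0 \<le> \<psi> t) \<and>
    (\<forall>x x'. nb x x' \<longrightarrow>
      (let E = {\<omega> \<in> space M. \<exists>n\<ge>1. brownian_loss M f T B n x x' \<omega>
                                  \<ge> ereal (\<psi> (brownian_mech_time f T B x n \<omega>))}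
       in E \<in> sets M \<and> measure M E \<le> \<delta>))"


section \<open>The Laplace process\<close>

definition laplace :: "real \<Rightarrow> real measure" where
  "laplace s = density lborel (\<lambda>y. ennreal (1 / (2 * s) * exp (- \<bar>y\<bar> / s)))"

text \<open>
  Conditionally on the sub-\<open>\<sigma>\<close>-algebra \<open>F\<close>, the variables \<open>Y i\<close> with \<open>i \<in> I\<close> are independent with
  laws \<open>Lap (s i)\<close>. The scales are random, but \<open>F\<close>-measurable in all uses below.
\<close>

definition cond_indep_laplace ::
  "'w measure \<Rightarrow> 'w measure \<Rightarrow> 'i set \<Rightarrow> ('i \<Rightarrow> 'w \<Rightarrow> real) \<Rightarrow> ('i \<Rightarrow> 'w \<Rightarrow> real) \<Rightarrow> bool" where
  "cond_indep_laplace M F I s Y \<longleftrightarrow>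
    (\<forall>i\<in>I. Y i \<in> borel_measurable M) \<and>
    (\<forall>J A. J \<subseteq> I \<and> finite J \<and> (\<forall>j\<in>J. A j \<in> sets borel) \<longrightarrow>
      (AE \<omega> in M. real_cond_exp M F (indicator {\<omega> \<in> space M. \<forall>j\<in>J. Y j \<omega> \<in> A j}) \<omega>
                  = (\<Prod>j\<in>J. measure (laplace (s j \<omega>)) (A j))))"

definition poisson_process ::
  "'w measure \<Rightarrow> real \<Rightarrow> (real \<Rightarrow> real) \<Rightarrow> (real \<Rightarrow> 'w \<Rightarrow> nat) \<Rightarrow> bool" where
  "poisson_process M \<eta> r P \<longleftrightarrow>
    (\<forall>t\<ge>\<eta>. P t \<in> measurable M (count_space UNIV)) \<and>
    (\<forall>\<omega>\<in>space M. P \<eta> \<omega> = 0) \<and>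
    (\<forall>\<omega>\<in>space M. mono_on {\<eta>..} (\<lambda>t. P t \<omega>)) \<and>
    (\<forall>\<omega>\<in>space M. \<forall>t\<ge>\<eta>. eventually (\<lambda>s. P s \<omega> = P t \<omega>) (at_right t)) \<and>
    (\<forall>s t. \<eta> \<le> s \<and> s < t \<longrightarrow>
       distr M (count_space UNIV) (\<lambda>\<omega>. P t \<omega> - P s \<omega>)
         = measure_pmf (poisson_pmf (LBINT v:{s..t}. r v))) \<and>
    (\<forall>k t. \<eta> \<le> t 0 \<and> (\<forall>i<k. t i \<le> t (Suc i)) \<longrightarrow>
       prob_space.indep_vars M (\<lambda>_. count_space UNIV)
         (\<lambda>i \<omega>. P (t (Suc i)) \<omega> - P (t i) \<omega>) {..<k::nat})"

text \<open>
  For the intensity \<open>2 / t\<close> the infimum is over a nonempty set almost surely; on the remaining null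
  event its value is arbitrary.
\<close>

definition jump_time :: "real \<Rightarrow> (real \<Rightarrow> 'w \<Rightarrow> nat) \<Rightarrow> nat \<Rightarrow> 'w \<Rightarrow> real" where
  "jump_time \<eta> P n \<omega> = (if n = 0 then \<eta> else Inf {t. \<eta> \<le> t \<and> n \<le> P t \<omega>})"

definition laplace_process :: "'w measure \<Rightarrow> real \<Rightarrow> (real \<Rightarrow> 'w \<Rightarrow> real) \<Rightarrow> bool" where
  "laplace_process M \<eta> Z \<longleftrightarrow>
    (\<exists>P Y. poisson_process M \<eta> (\<lambda>t. 2 / t) P \<and>
      cond_indep_laplace M
        (vimage_algebra (space M) (\<lambda>\<omega> n. jump_time \<eta> P n \<omega>) (PiM UNIV (\<lambda>_. borel)))
        UNIV (jump_time \<eta> P) Y \<and>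
      (\<forall>\<omega>\<in>space M. \<forall>t\<ge>\<eta>. Z t \<omega> = (\<Sum>n=0..P t \<omega>. Y n \<omega>)))"


section \<open>ReducedAboveThreshold\<close>

definition sensitive :: "('x \<Rightarrow> 'x \<Rightarrow> bool) \<Rightarrow> real \<Rightarrow> ('x \<Rightarrow> real) \<Rightarrow> bool" where
  "sensitive nb \<Delta> v \<longleftrightarrow> (\<forall>x x'. nb x x' \<longrightarrow> \<bar>v x - v x'\<bar> \<le> \<Delta>)"

definition privacy_functions :: "real \<Rightarrow> (nat \<Rightarrow> (nat \<Rightarrow> real ^ 'd) \<Rightarrow> real) \<Rightarrow> bool" where
  "privacy_functions \<epsilon>max E \<longleftrightarrow>
    (\<forall>n\<ge>1. E n \<in> borel_measurable (hist_space n)) \<and>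
    (\<forall>n\<ge>1. \<forall>\<beta>\<in>space (hist_space n). 0 < E n \<beta> \<and> E n \<beta> \<le> \<epsilon>max) \<and>
    (\<forall>n\<ge>1. \<forall>\<beta>\<in>space (hist_space (Suc n)). E n (restrict \<beta> {1..<n}) \<le> E (Suc n) \<beta>)"

text \<open>
  From here on \<open>Alg\<close> is the sequence of iterates of the underlying algorithm on one fixed input,
  and \<open>v\<close> is the utility at that input.
\<close>

definition rat_eps ::
  "(nat \<Rightarrow> (nat \<Rightarrow> real ^ 'd) \<Rightarrow> real) \<Rightarrow> (nat \<Rightarrow> 'w \<Rightarrow> real ^ 'd) \<Rightarrow> nat \<Rightarrow> 'w \<Rightarrow> real" where
  "rat_eps E Alg n \<omega> = E n (\<lambda>i\<in>{1..<n}. Alg i \<omega>)"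

text \<open>
  \<open>Z\<close> and \<open>\<xi>\<close> are the randomness of one run: \<open>Z\<close> is a Laplace process independent of \<open>Alg\<close>, and
  the \<open>\<xi> n\<close> are conditionally independent given the pair \<open>(Alg, Z)\<close>.
\<close>

definition rat_noise ::
  "'w measure \<Rightarrow> real \<Rightarrow> real \<Rightarrow> (nat \<Rightarrow> (nat \<Rightarrow> real ^ 'd) \<Rightarrow> real) \<Rightarrow> (nat \<Rightarrow> 'w \<Rightarrow> real ^ 'd)
    \<Rightarrow> (real \<Rightarrow> 'w \<Rightarrow> real) \<Rightarrow> (nat \<Rightarrow> 'w \<Rightarrow> real) \<Rightarrow> bool" where
  "rat_noise M \<Delta> \<epsilon>max E Alg Z \<xi> \<longleftrightarrow>
    (let \<eta> = 2 * \<Delta> / \<epsilon>max;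
         algM = PiM {1..} (\<lambda>_. borel); algX = (\<lambda>\<omega>. \<lambda>i\<in>{1..}. Alg i \<omega>);
         pathM = PiM {\<eta>..} (\<lambda>_. borel); pathX = (\<lambda>\<omega>. \<lambda>t\<in>{\<eta>..}. Z t \<omega>)
     in laplace_process M \<eta> Z \<and>
        prob_space.indep_set M (sets (vimage_algebra (space M) algX algM))
          (sets (vimage_algebra (space M) pathX pathM)) \<and>
        cond_indep_laplace M
          (vimage_algebra (space M) (\<lambda>\<omega>. (algX \<omega>, pathX \<omega>)) (algM \<Otimes>\<^sub>M pathM))
          {1..} (\<lambda>n \<omega>. 4 * \<Delta> / rat_eps E Alg n \<omega>) \<xi>)"

definition rat_above ::
  "real \<Rightarrow> real \<Rightarrow> (real ^ 'd \<Rightarrow> real) \<Rightarrow> (nat \<Rightarrow> (nat \<Rightarrow> real ^ 'd) \<Rightarrow> real)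
    \<Rightarrow> (nat \<Rightarrow> 'w \<Rightarrow> real ^ 'd) \<Rightarrow> (real \<Rightarrow> 'w \<Rightarrow> real) \<Rightarrow> (nat \<Rightarrow> 'w \<Rightarrow> real)
    \<Rightarrow> nat \<Rightarrow> 'w \<Rightarrow> bool" where
  "rat_above \<Delta> \<tau> v E Alg Z \<xi> n \<omega> \<longleftrightarrow>
    v (Alg n \<omega>) + \<xi> n \<omega> \<ge> \<tau> + Z (2 * \<Delta> / rat_eps E Alg n \<omega>) \<omega>"

definition rat_halt ::
  "real \<Rightarrow> real \<Rightarrow> (real ^ 'd \<Rightarrow> real) \<Rightarrow> (nat \<Rightarrow> (nat \<Rightarrow> real ^ 'd) \<Rightarrow> real)
    \<Rightarrow> (nat \<Rightarrow> 'w \<Rightarrow> real ^ 'd) \<Rightarrow> (real \<Rightarrow> 'w \<Rightarrow> real) \<Rightarrow> (nat \<Rightarrow> 'w \<Rightarrow> real)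
    \<Rightarrow> 'w \<Rightarrow> enat" where
  "rat_halt \<Delta> \<tau> v E Alg Z \<xi> \<omega> = (INF n \<in> {n. 1 \<le> n \<and> rat_above \<Delta> \<tau> v E Alg Z \<xi> n \<omega>}. enat n)"

text \<open>
  The full output: round \<open>n\<close> reveals the iterate and the output bit. Finite outputs are padded with
  \<open>(0, False)\<close>; as the halting round is the position of the only \<open>True\<close>, the padding carries no
  information and the infinite runs are kept apart from the finite ones.
\<close>

definition rat_output ::
  "real \<Rightarrow> real \<Rightarrow> (real ^ 'd \<Rightarrow> real) \<Rightarrow> (nat \<Rightarrow> (nat \<Rightarrow> real ^ 'd) \<Rightarrow> real)
    \<Rightarrow> (nat \<Rightarrow> 'w \<Rightarrow> real ^ 'd) \<Rightarrow> (real \<Rightarrow> 'w \<Rightarrow> real) \<Rightarrow> (nat \<Rightarrow> 'w \<Rightarrow> real)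
    \<Rightarrow> 'w \<Rightarrow> nat \<Rightarrow> (real ^ 'd) \<times> bool" where
  "rat_output \<Delta> \<tau> v E Alg Z \<xi> \<omega> =
    (\<lambda>n\<in>{1..}. if enat n \<le> rat_halt \<Delta> \<tau> v E Alg Z \<xi> \<omega>
               then (Alg n \<omega>, enat n = rat_halt \<Delta> \<tau> v E Alg Z \<xi> \<omega>)
               else (0, False))"

definition rat_law ::
  "'w measure \<Rightarrow> real \<Rightarrow> real \<Rightarrow> (real ^ 'd \<Rightarrow> real) \<Rightarrow> (nat \<Rightarrow> (nat \<Rightarrow> real ^ 'd) \<Rightarrow> real)
    \<Rightarrow> (nat \<Rightarrow> 'w \<Rightarrow> real ^ 'd) \<Rightarrow> (real \<Rightarrow> 'w \<Rightarrow> real) \<Rightarrow> (nat \<Rightarrow> 'w \<Rightarrow> real)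
    \<Rightarrow> (nat \<Rightarrow> (real ^ 'd) \<times> bool) measure" where
  "rat_law M \<Delta> \<tau> v E Alg Z \<xi> =
    distr M (PiM {1..} (\<lambda>_. borel \<Otimes>\<^sub>M count_space UNIV)) (rat_output \<Delta> \<tau> v E Alg Z \<xi>)"

end

theory Submission
  imports Defs "HOL-Real_Asymp.Real_Asymp"
begin

text \<open>
  Given the iterates \<open>\<beta>\<^sub>1, \<dots>, \<beta>\<^sub>n\<close>, the probability of halting in round \<open>n\<close> changes by a factor of at
  most \<open>exp \<epsilon>\<^sub>n\<close> between neighbours: moving the whole path \<open>Z\<close> up by \<open>\<Delta>\<close> and \<open>\<xi>\<^sub>n\<close> up by \<open>2\<Delta>\<close> maps
  halting runs on \<open>x\<close> to halting runs on \<open>x'\<close>, and each of the two shifts costs \<open>exp (\<epsilon>\<^sub>n / 2)\<close>. Hence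
  the loss of the full output is at most the loss of the iterates plus \<open>\<epsilon>\<^sub>n = \<psi> (T\<^sub>n)\<close>, and outside the
  event controlled by the privacy boundary this is at most \<open>2 \<psi> (T\<^sub>n)\<close>.

  The cost of shifting \<open>Z\<close> rests on the fact that \<open>Z\<^sub>t\<close> has law \<open>Lap t\<close> and is independent of the later
  increments. The finite-dimensional laws of \<open>Z\<close> are compared, along the geometric grid
  \<open>\<eta> exp (h j)\<close>, with a Markov chain for which this holds exactly: in each step the chain stays with
  probability \<open>exp (-2h)\<close>, which is also the probability that the Poisson process does not jump, and
  otherwise adds a Laplace variable with the next scale. The error vanishes as \<open>h \<rightarrow> 0\<close>.
\<close>

section \<open>The Laplace density\<close>

text \<open>Why the cost involves \<open>eps n\<close> alone: the privacy functions are
  nondecreasing, so the query times 2 \<Delta> / eps_i decrease in i and are all at least t = 2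
  \<Delta> / eps_n. Moving \<open>Z\<close> from t on by \<Delta> costs exp (\<Delta> / t) = exp
  (eps_n / 2). Before round n the raised threshold absorbs the change of the utility at no cost; in
  round n it can rise by 2 \<Delta> in total, which \<open>\<xi>\<close> with scale 4 \<Delta> /
  eps_n pays for with exp (eps_n / 2). The obstacle is that \<open>Z\<close> is given by jump times
  and summands whose scales are these jump times, so neither the law of \<open>Z t\<close> nor the
  independence of increments is at hand. Recording for each grid step whether it has no jump or
  exactly one confines each random scale to a step, where its density is compared with those at the
  two end points at the price of a factor exp h. The error per step is of order h^2, the number of
  steps of order 1 / h. The two runs use different processes, so the chain is a common intermediary
  and has to be compared with \<open>Z\<close> from both sides.\<close>

definition lapd :: "real \<Rightarrow> real \<Rightarrow> ennreal" where
  "lapd s y = ennreal (1 / (2 * s) * exp (- \<bar>y\<bar> / s))"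

lemma borel_measurable_lapd [measurable (raw)]:
  assumes "f \<in> borel_measurable M" "g \<in> borel_measurable M"
  shows "(\<lambda>x. lapd (f x) (g x)) \<in> borel_measurable M"
  using assms unfolding lapd_def by measurable

lemma laplace_eq_density: "laplace s = density lborel (lapd s)"
  unfolding laplace_def lapd_def ..

lemma nn_integral_exp_tail:
  fixes a b :: real assumes "b > 0"
  shows "(\<integral>\<^sup>+x\<in>{a..}. ennreal (exp (- b * x)) \<partial>lborel) = ennreal (exp (- b * a) / b)"
proof -
  have "((\<lambda>x. - exp (- b * x) / b) \<longlongrightarrow> 0) at_top"
    using assms by real_asymp
  then have "(\<integral>\<^sup>+x. ennreal (exp (- b * x)) * indicator {a..} x \<partial>lborel) = ennreal (0 - (- exp (- b * a) / b))"
    using assms by (intro nn_integral_FTC_atLeast) (auto intro!: derivative_eq_intros)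
  then show ?thesis by simp
qed

lemma nn_integral_split_at:
  fixes f :: "real \<Rightarrow> ennreal" assumes [measurable]: "f \<in> borel_measurable borel"
  shows "(\<integral>\<^sup>+x. f x \<partial>lborel) = (\<integral>\<^sup>+x\<in>{a..}. f x \<partial>lborel) + (\<integral>\<^sup>+x\<in>{-a..}. f (- x) \<partial>lborel)"
proof -
  have "(\<integral>\<^sup>+x. f x \<partial>lborel) = (\<integral>\<^sup>+x. f x * indicator {a..} x + f x * indicator {..<a} x \<partial>lborel)"
    by (intro nn_integral_cong) (auto split: split_indicator)
  also have "\<dots> = (\<integral>\<^sup>+x\<in>{a..}. f x \<partial>lborel) + (\<integral>\<^sup>+x\<in>{..<a}. f x \<partial>lborel)"
    by (rule nn_integral_add) auto
  also have "(\<integral>\<^sup>+x\<in>{..<a}. f x \<partial>lborel) = (\<integral>\<^sup>+x\<in>{..a}. f x \<partial>lborel)"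
  proof (rule nn_integral_cong_AE)
    have "AE x in lborel. x \<noteq> a" by (rule AE_lborel_singleton)
    then show "AE x in lborel. f x * indicator {..<a} x = f x * indicator {..a} x"
      by eventually_elim (auto split: split_indicator)
  qed
  also have "\<dots> = (\<integral>\<^sup>+x\<in>{-a..}. f (- x) \<partial>lborel)"
    by (subst nn_integral_real_affine[where c="-1" and t=0])
       (auto intro!: nn_integral_cong split: split_indicator)
  finally show ?thesis .
qed

lemma nn_integral_lapd:
  assumes "0 < s" shows "(\<integral>\<^sup>+y. lapd s y \<partial>lborel) = 1"
proof -
  have *: "(\<integral>\<^sup>+y\<in>{0..}. lapd s y \<partial>lborel) = ennreal (1/2)"
  proof -
    have "(\<integral>\<^sup>+y\<in>{0..}. lapd s y \<partial>lborel) =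
       (\<integral>\<^sup>+y. ennreal (1 / (2 * s)) * (ennreal (exp (- (1/s) * y)) * indicator {0..} y) \<partial>lborel)"
      using assms by (intro nn_integral_cong)
        (auto simp: lapd_def simp flip: ennreal_mult split: split_indicator)
    also have "\<dots> = ennreal (1 / (2 * s)) * ennreal (exp (- (1/s) * 0) / (1/s))"
      using assms by (subst nn_integral_cmult) (measurable, simp only: nn_integral_exp_tail[of "1/s" 0] zero_less_divide_1_iff)
    also have "\<dots> = ennreal (1/2)" using assms by (simp flip: ennreal_mult)
    finally show ?thesis .
  qed
  have "(\<integral>\<^sup>+y. lapd s y \<partial>lborel) = ennreal (1/2) + ennreal (1/2)"
    using * by (subst nn_integral_split_at[where a=0]) (auto simp: lapd_def)
  also have "\<dots> = ennreal 1" by (subst ennreal_plus[symmetric]) auto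
  finally show ?thesis by simp
qed

text \<open>The triangle inequality in the exponent. Both exponential factors of the privacy bound
  for the halting round, the one for moving \<open>Z\<close> and the one for moving
  \<open>\<xi>\<close>, come from this estimate.\<close>

lemma lapd_shift:
  assumes "0 < s" shows "lapd s (y - c) \<le> ennreal (exp (\<bar>c\<bar> / s)) * lapd s y"
proof -
  have "exp (- \<bar>y - c\<bar> / s) \<le> exp (\<bar>c\<bar> / s + - \<bar>y\<bar> / s)"
    using assms by (simp add: field_simps)
  then have "1 / (2 * s) * exp (- \<bar>y - c\<bar> / s) \<le> exp (\<bar>c\<bar> / s) * (1 / (2 * s) * exp (- \<bar>y\<bar> / s))"
    using assms unfolding exp_add by (simp add: field_simps)
  then show ?thesis unfolding lapd_def by (subst ennreal_mult[symmetric]) (use assms in \<open>auto intro!: ennreal_leI\<close>)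
qed

text \<open>The exponential factor grows with the scale, and the normalisation loses at most s / s'.
  Together with \<open>lapd_upper\<close> this replaces the random scale of a jump by an end point
  of the grid step that contains it.\<close>

lemma lapd_lower:
  assumes "0 < s" "s \<le> t" "t \<le> s'"
  shows "ennreal (s / s') * lapd s y \<le> lapd t y"
proof -
  have "s / s' * (1 / (2 * s)) \<le> 1 / (2 * t)" using assms by (simp add: field_simps)
  moreover have "exp (- \<bar>y\<bar> / s) \<le> exp (- \<bar>y\<bar> / t)"
    using assms by (simp add: divide_left_mono)
  ultimately have "(s / s' * (1 / (2 * s))) * exp (- \<bar>y\<bar> / s) \<le> 1 / (2 * t) * exp (- \<bar>y\<bar> / t)"
    using assms by (intro mult_mono) auto
  then show ?thesis unfolding lapd_def using assms
    by (subst ennreal_mult[symmetric]) (auto intro!: ennreal_leI simp: mult.assoc)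
qed

lemma lapd_upper:
  assumes "0 < s" "s \<le> t" "t \<le> s'"
  shows "lapd t y \<le> ennreal (s' / s) * lapd s' y"
proof -
  have "1 / (2 * t) \<le> s' / s * (1 / (2 * s'))" using assms by (simp add: field_simps)
  moreover have "exp (- \<bar>y\<bar> / t) \<le> exp (- \<bar>y\<bar> / s')"
    using assms by (simp add: divide_left_mono)
  ultimately have "1 / (2 * t) * exp (- \<bar>y\<bar> / t) \<le> (s' / s * (1 / (2 * s'))) * exp (- \<bar>y\<bar> / s')"
    using assms by (intro mult_mono) auto
  then show ?thesis unfolding lapd_def using assms
    by (subst ennreal_mult[symmetric]) (auto intro!: ennreal_leI simp: mult.assoc)
qed

text \<open>It suffices to treat \<open>z \<ge> 0\<close>; the integrand is then a pure exponential on each of the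
  three intervals cut out by \<open>0\<close> and \<open>z\<close>.\<close>

lemma lapd_convolution_nonneg:
  assumes "0 < s" "s < s'" "0 \<le> z"
  shows "(\<integral>\<^sup>+y. lapd s (z - y) * lapd s' y \<partial>lborel)
    = ennreal ((s' * exp (- z / s') - s * exp (- z / s)) / (2 * (s'\<^sup>2 - s\<^sup>2)))"
proof -
  define p where "p = 1 / s"
  define q where "q = 1 / s'"
  have pq: "0 < q" "q < p" using assms by (auto simp: p_def q_def field_simps)
  \<comment> \<open>The product of the normalising constants p / 2 and q / 2, written with the rates
    p = 1 / s and q = 1 / s'.\<close>
  define K where "K = p * q / 4"
  have K: "0 < K" using pq by (simp add: K_def)
  have lapd_mult: "lapd s (z - y) * lapd s' y = ennreal (K * (exp (- p * \<bar>z - y\<bar>) * exp (- q * \<bar>y\<bar>)))" for y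
    using assms unfolding lapd_def by (subst ennreal_mult[symmetric]) (auto simp: K_def p_def q_def)
  let ?F = "\<lambda>y. lapd s (z - y) * lapd s' y"
  have 1: "(\<integral>\<^sup>+y\<in>{z..}. ?F y \<partial>lborel) = ennreal (K * (exp (- q * z) / (p + q)))"
  proof -
    have "(\<integral>\<^sup>+y\<in>{z..}. ?F y \<partial>lborel) =
        (\<integral>\<^sup>+y. ennreal (K * exp (p * z)) * (ennreal (exp (- (p + q) * y)) * indicator {z..} y) \<partial>lborel)"
      unfolding lapd_mult
    proof (intro nn_integral_cong)
      fix y show "ennreal (K * (exp (- p * \<bar>z - y\<bar>) * exp (- q * \<bar>y\<bar>))) * indicator {z..} y
        = ennreal (K * exp (p * z)) * (ennreal (exp (- (p + q) * y)) * indicator {z..} y)"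
        using assms(3) K by (cases "z \<le> y")
          (auto simp flip: exp_add ennreal_mult simp: algebra_simps)
    qed
    also have "\<dots> = ennreal (K * exp (p * z)) * ennreal (exp (- (p + q) * z) / (p + q))"
      using pq by (subst nn_integral_cmult) (auto simp only: nn_integral_exp_tail[of "p+q" z], auto)
    also have "\<dots> = ennreal (K * (exp (- q * z) / (p + q)))"
      using pq K by (auto simp flip: exp_add ennreal_mult simp: algebra_simps)
    finally show ?thesis .
  qed
  have 2: "(\<integral>\<^sup>+y\<in>{0..}. ?F (- y) \<partial>lborel) = ennreal (K * (exp (- p * z) / (p + q)))"
  proof -
    have "(\<integral>\<^sup>+y\<in>{0..}. ?F (- y) \<partial>lborel) =
        (\<integral>\<^sup>+y. ennreal (K * exp (- p * z)) * (ennreal (exp (- (p + q) * y)) * indicator {0..} y) \<partial>lborel)"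
      unfolding lapd_mult
    proof (intro nn_integral_cong)
      fix y show "ennreal (K * (exp (- p * \<bar>z - - y\<bar>) * exp (- q * \<bar>- y\<bar>))) * indicator {0..} y
        = ennreal (K * exp (- p * z)) * (ennreal (exp (- (p + q) * y)) * indicator {0..} y)"
        using assms(3) K by (cases "0 \<le> y")
          (auto simp flip: exp_add ennreal_mult simp: algebra_simps)
    qed
    also have "\<dots> = ennreal (K * exp (- p * z)) * ennreal (exp (- (p + q) * 0) / (p + q))"
      using pq by (subst nn_integral_cmult) (auto simp only: nn_integral_exp_tail[of "p+q" 0], auto)
    also have "\<dots> = ennreal (K * (exp (- p * z) / (p + q)))"
      using pq K by (auto simp flip: ennreal_mult)
    finally show ?thesis .
  qed
  \<comment> \<open>Between 0 and z the exponent is - p z + (p - q) y; the antiderivative divides by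
    p - q, which is positive because s < s'.\<close>
  have 3: "(\<integral>\<^sup>+y\<in>{0..z}. ?F y \<partial>lborel) = ennreal (K * (exp (- q * z) - exp (- p * z)) / (p - q))"
  proof -
    have "(\<integral>\<^sup>+y. ennreal (K * exp (- p * z) * exp ((p - q) * y)) * indicator {0..z} y \<partial>lborel)
      = ennreal (K * exp (- p * z) * exp ((p - q) * z) / (p - q) - K * exp (- p * z) * exp ((p - q) * 0) / (p - q))"
      using pq K assms(3) by (intro nn_integral_FTC_Icc) (auto intro!: derivative_eq_intros)
    also have "K * exp (- p * z) * exp ((p - q) * z) / (p - q) - K * exp (- p * z) * exp ((p - q) * 0) / (p - q)
        = K * (exp (- p * z + (p - q) * z) - exp (- p * z)) / (p - q)"
      unfolding exp_add by (simp add: right_diff_distrib diff_divide_distrib)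
    also have "- p * z + (p - q) * z = - q * z" by (simp add: algebra_simps)
    also have "(\<integral>\<^sup>+y. ennreal (K * exp (- p * z) * exp ((p - q) * y)) * indicator {0..z} y \<partial>lborel)
        = (\<integral>\<^sup>+y\<in>{0..z}. ?F y \<partial>lborel)"
      unfolding lapd_mult
      by (intro nn_integral_cong)
        (auto split: split_indicator simp: algebra_simps simp flip: exp_add)
    finally show ?thesis .
  qed
  have "(\<integral>\<^sup>+y. ?F y \<partial>lborel) = (\<integral>\<^sup>+y\<in>{0..}. ?F y \<partial>lborel) + (\<integral>\<^sup>+y\<in>{0..}. ?F (- y) \<partial>lborel)"
    by (subst nn_integral_split_at[where a=0]) simp_all
  also have "(\<integral>\<^sup>+y\<in>{0..}. ?F y \<partial>lborel) = (\<integral>\<^sup>+y\<in>{0..z}. ?F y \<partial>lborel) + (\<integral>\<^sup>+y\<in>{z..}. ?F y \<partial>lborel)"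
  proof -
    have "AE y in lborel. y \<noteq> z" by (rule AE_lborel_singleton)
    then have "AE y in lborel. ?F y * indicator {0..} y = ?F y * indicator {0..z} y + ?F y * indicator {z..} y"
      by eventually_elim (use assms(3) in \<open>auto split: split_indicator\<close>)
    then show ?thesis by (subst nn_integral_add[symmetric]) (auto intro!: nn_integral_cong_AE)
  qed
  also have "\<dots> + (\<integral>\<^sup>+y\<in>{0..}. ?F (- y) \<partial>lborel)
      = ennreal (K * (exp (- q * z) - exp (- p * z)) / (p - q) + K * (exp (- q * z) / (p + q))
          + K * (exp (- p * z) / (p + q)))"
    unfolding 1 2 3 using pq K assms(3) by (auto simp flip: ennreal_plus simp: mult_right_mono)
  also have "K * (exp (- q * z) - exp (- p * z)) / (p - q) + K * (exp (- q * z) / (p + q))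
          + K * (exp (- p * z) / (p + q)) = K / (p\<^sup>2 - q\<^sup>2) * (2 * p * exp (- q * z) - 2 * q * exp (- p * z))"
  proof -
    have "p\<^sup>2 - q\<^sup>2 = (p - q) * (p + q)" by (simp add: power2_eq_square algebra_simps)
    moreover have "p - q \<noteq> 0" "p + q \<noteq> 0" using pq by auto
    ultimately show ?thesis by (simp add: divide_simps) (simp add: algebra_simps)
  qed
  also have "\<dots> = (s' * exp (- z / s') - s * exp (- z / s)) / (2 * (s'\<^sup>2 - s\<^sup>2))"
  proof -
    have "p\<^sup>2 - q\<^sup>2 = (s'\<^sup>2 - s\<^sup>2) * (p * q)\<^sup>2"
      using assms by (simp add: p_def q_def field_simps power2_eq_square)
    moreover have "s'\<^sup>2 - s\<^sup>2 \<noteq> 0" using assms by (auto simp: power2_eq_iff)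
    moreover have "2 * p * exp (- q * z) - 2 * q * exp (- p * z) = 2 * (p * q) * (s' * exp (- z / s') - s * exp (- z / s))"
      using assms by (simp add: p_def q_def field_simps)
    ultimately show ?thesis using pq by (simp add: K_def power2_eq_square divide_simps) (simp add: algebra_simps)
  qed
  finally show ?thesis .
qed

lemma lapd_convolution:
  assumes "0 < s" "s < s'"
  shows "(\<integral>\<^sup>+y. lapd s (z - y) * lapd s' y \<partial>lborel)
    = ennreal ((s' * exp (- \<bar>z\<bar> / s') - s * exp (- \<bar>z\<bar> / s)) / (2 * (s'\<^sup>2 - s\<^sup>2)))"
proof (cases "0 \<le> z")
  case True then show ?thesis using lapd_convolution_nonneg[OF assms True] by simp
next
  case False
  have "(\<integral>\<^sup>+y. lapd s (z - y) * lapd s' y \<partial>lborel) = (\<integral>\<^sup>+y. lapd s (- z - y) * lapd s' y \<partial>lborel)"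
  proof (subst nn_integral_real_affine[where c="-1" and t=0])
    have "\<bar>- z - y\<bar> = \<bar>z + y\<bar>" for y by arith
    then show "ennreal \<bar>-1\<bar> * (\<integral>\<^sup>+y. lapd s (z - (0 + -1 * y)) * lapd s' (0 + -1 * y) \<partial>lborel)
        = (\<integral>\<^sup>+y. lapd s (- z - y) * lapd s' y \<partial>lborel)"
      by (auto intro!: nn_integral_cong simp: lapd_def)
  qed auto
  then show ?thesis using lapd_convolution_nonneg[OF assms, of "- z"] False by simp
qed

text \<open>\<open>Lap s'\<close> is the law of a sum of \<open>Lap s\<close> and an independent variable that is \<open>0\<close> with probability
  \<open>(s / s')\<^sup>2\<close> and \<open>Lap s'\<close> otherwise.\<close>

lemma lapd_decompose:
  assumes "0 < s" "s < s'"
  shows "ennreal ((s / s')\<^sup>2) * lapd s z + ennreal (1 - (s / s')\<^sup>2) * (\<integral>\<^sup>+y. lapd s (z - y) * lapd s' y \<partial>lborel)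
    = lapd s' z"
proof -
  let ?C = "(s' * exp (- \<bar>z\<bar> / s') - s * exp (- \<bar>z\<bar> / s)) / (2 * (s'\<^sup>2 - s\<^sup>2))"
  have sq: "s\<^sup>2 < s'\<^sup>2" using assms by (simp add: power_strict_mono)
  have le1: "(s / s')\<^sup>2 \<le> 1" using assms by (simp add: power_le_one)
  have "s * exp (- \<bar>z\<bar> / s) \<le> s' * exp (- \<bar>z\<bar> / s')"
    using assms by (intro mult_mono) (auto simp: divide_left_mono)
  then have C: "0 \<le> ?C" using sq by auto
  \<comment> \<open>The terms with exp (- |z| / s) cancel, since their coefficients are s / (2 s'^2)
    and its negative. This cancellation is what determines the weight (s / s')^2.\<close>
  have "(s / s')\<^sup>2 * (1 / (2 * s) * exp (- \<bar>z\<bar> / s)) + (1 - (s / s')\<^sup>2) * ?C = 1 / (2 * s') * exp (- \<bar>z\<bar> / s')"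
  proof -
    have "1 - (s / s')\<^sup>2 = (s'\<^sup>2 - s\<^sup>2) / s'\<^sup>2" using assms by (simp add: field_simps)
    then have "(1 - (s / s')\<^sup>2) * ?C = (s' * exp (- \<bar>z\<bar> / s') - s * exp (- \<bar>z\<bar> / s)) / (2 * s'\<^sup>2)"
      using sq assms by (simp add: divide_simps) (simp add: algebra_simps)
    then show ?thesis using assms by (simp add: field_simps power2_eq_square)
  qed
  then have "ennreal ((s / s')\<^sup>2 * (1 / (2 * s) * exp (- \<bar>z\<bar> / s))) + ennreal ((1 - (s / s')\<^sup>2) * ?C) = lapd s' z"
    unfolding lapd_def using mult_nonneg_nonneg[OF _ C, of "1 - (s / s')\<^sup>2"] assms le1
    by (subst ennreal_plus[symmetric]) (simp_all only: diff_ge_0_iff_ge, simp)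
  then show ?thesis
    unfolding lapd_convolution[OF assms] unfolding lapd_def
    using assms C le1 by (subst (asm) (1 2) ennreal_mult) auto
qed

text \<open>The real expression is then nonpositive and \<open>ennreal\<close> truncates it, so
  \<open>laplace s\<close> is the zero measure. Random scales are thus covered without a positivity
  condition: \<open>laplace s\<close> is a subprobability for every real s.\<close>

lemma lapd_nonpos: "s \<le> 0 \<Longrightarrow> lapd s y = 0"
  unfolding lapd_def by (intro ennreal_neg mult_nonpos_nonneg) (auto simp: divide_nonneg_nonpos)

lemma nn_integral_lapd_le: "(\<integral>\<^sup>+y. lapd s y \<partial>lborel) \<le> 1"
  by (cases "0 < s") (auto simp: nn_integral_lapd lapd_nonpos)

lemma emeasure_laplace:
  "A \<in> sets borel \<Longrightarrow> emeasure (laplace s) A = (\<integral>\<^sup>+y. lapd s y * indicator A y \<partial>lborel)"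
  unfolding laplace_eq_density by (subst emeasure_density) auto

lemma subprob_space_laplace: "subprob_space (laplace s)"
proof (rule subprob_spaceI)
  show "emeasure (laplace s) (space (laplace s)) \<le> 1"
    using nn_integral_lapd_le[of s] by (subst emeasure_laplace) (auto simp: laplace_def)
qed (simp add: laplace_def)

lemma ennreal_measure_laplace: "ennreal (measure (laplace s) A) = emeasure (laplace s) A"
proof -
  interpret subprob_space "laplace s" by (rule subprob_space_laplace)
  show ?thesis by (rule emeasure_eq_measure[symmetric])
qed

section \<open>Conditionally independent Laplace variables\<close>

abbreviation "borelP J \<equiv> PiM J (\<lambda>_. borel :: real measure)"
abbreviation "lborelP J \<equiv> PiM J (\<lambda>_. lborel :: real measure)"

text \<open>The defining property of conditional expectation on an event D of \<open>F\<close>. It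
  turns the almost sure identity in \<open>cond_indep_laplace\<close> into an identity of measures
  on rectangles, which generate the product \<sigma>-algebra.\<close>

lemma (in prob_space) cond_indep_laplace_rectangle:
  assumes sub: "subalgebra M F" and Y: "cond_indep_laplace M F I s Y"
    and J: "finite J" "J \<subseteq> I" and s: "\<And>j. j \<in> J \<Longrightarrow> s j \<in> borel_measurable M"
    and D: "D \<in> sets F" and A: "\<And>j. j \<in> J \<Longrightarrow> A j \<in> sets borel"
  shows "emeasure M (D \<inter> {\<omega>\<in>space M. \<forall>j\<in>J. Y j \<omega> \<in> A j})
    = (\<integral>\<^sup>+\<omega>\<in>D. (\<Prod>j\<in>J. emeasure (laplace (s j \<omega>)) (A j)) \<partial>M)"
proof -
  interpret finite_measure_subalgebra M F by unfold_locales (rule sub)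
  have [measurable]: "D \<in> sets M" using D sub by (auto simp: subalgebra_def)
  have Ym [measurable]: "Y j \<in> borel_measurable M" if "j \<in> J" for j
    using Y J(2) that by (auto simp: cond_indep_laplace_def)
  define R where "R = {\<omega>\<in>space M. \<forall>j\<in>J. Y j \<omega> \<in> A j}"
  have R [measurable]: "R \<in> sets M"
    unfolding R_def using J(1) A by (intro sets.sets_Collect_finite_All) (auto intro: measurable_sets_Collect)
  define h where "h \<omega> = (\<Prod>j\<in>J. measure (laplace (s j \<omega>)) (A j))" for \<omega>
  have ce: "AE \<omega> in M. real_cond_exp M F (indicator R) \<omega> = h \<omega>"
    using Y J A unfolding cond_indep_laplace_def R_def h_def by blast
  have hnn: "0 \<le> h \<omega>" for \<omega> unfolding h_def by (intro prod_nonneg) auto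
  have "ennreal (measure M (D \<inter> R)) = ennreal (\<integral>\<omega>\<in>D. indicator R \<omega> \<partial>M)"
    by (simp add: set_lebesgue_integral_def indicator_inter_arith[symmetric])
  also have "(\<integral>\<omega>\<in>D. indicator R \<omega> \<partial>M) = (\<integral>\<omega>\<in>D. real_cond_exp M F (indicator R) \<omega> \<partial>M)"
    using D by (intro real_cond_exp_intA) (auto intro!: integrable_real_indicator simp: less_top[symmetric])
  also have "ennreal \<dots> = (\<integral>\<^sup>+\<omega>. ennreal (indicator D \<omega> * real_cond_exp M F (indicator R) \<omega>) \<partial>M)"
    unfolding set_lebesgue_integral_def real_scaleR_def
  proof (rule nn_integral_eq_integral[symmetric])
    show "integrable M (\<lambda>\<omega>. indicator D \<omega> * real_cond_exp M F (indicator R) \<omega>)"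
      by (intro integrable_mult_indicator[where 'b=real, unfolded real_scaleR_def] real_cond_exp_int)
         (auto intro!: integrable_real_indicator simp: less_top[symmetric])
    show "AE \<omega> in M. 0 \<le> indicator D \<omega> * real_cond_exp M F (indicator R) \<omega>"
      using ce by eventually_elim (simp add: hnn)
  qed
  also have "\<dots> = (\<integral>\<^sup>+\<omega>\<in>D. ennreal (h \<omega>) \<partial>M)"
    using ce by (intro nn_integral_cong_AE, eventually_elim) (auto split: split_indicator)
  also have "\<dots> = (\<integral>\<^sup>+\<omega>\<in>D. (\<Prod>j\<in>J. emeasure (laplace (s j \<omega>)) (A j)) \<partial>M)"
    unfolding h_def by (simp add: prod_ennreal[symmetric] ennreal_measure_laplace)
  finally show ?thesis unfolding R_def[symmetric] by (simp add: emeasure_eq_measure)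
qed

text \<open>The two sides are integrals of \<open>G\<close> against two finite measures that agree
  on the rectangles, an intersection-stable generator. The lemma makes it possible to freeze
  \<omega> and integrate out the variables \<open>Y j\<close> with their Laplace densities.\<close>

lemma (in prob_space) nn_integral_cond_indep_laplace:
  assumes sub: "subalgebra M F" and Y: "cond_indep_laplace M F I s Y"
    and J: "finite J" "J \<subseteq> I" and s: "\<And>j. j \<in> J \<Longrightarrow> s j \<in> borel_measurable M"
    and G: "G \<in> borel_measurable (F \<Otimes>\<^sub>M PiM J (\<lambda>_. borel))"
  shows "(\<integral>\<^sup>+\<omega>. G (\<omega>, \<lambda>j\<in>J. Y j \<omega>) \<partial>M)
    = (\<integral>\<^sup>+\<omega>. \<integral>\<^sup>+y. G (\<omega>, y) * (\<Prod>j\<in>J. lapd (s j \<omega>) (y j)) \<partial>lborelP J \<partial>M)"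
proof -
  interpret P: product_sigma_finite "\<lambda>_::'b. lborel :: real measure" by standard
  interpret PJ: sigma_finite_measure "lborelP J :: ('b \<Rightarrow> real) measure"
    using J(1) by (rule P.sigma_finite)
  have Ym: "Y j \<in> borel_measurable M" if "j \<in> J" for j
    using Y J(2) that by (auto simp: cond_indep_laplace_def)
  have spF: "space F = space M" and setsF: "sets F \<subseteq> sets M" using sub by (auto simp: subalgebra_def)
  have id1 [measurable]: "(\<lambda>\<omega>. \<omega>) \<in> measurable M F"
    using spF setsF by (auto intro!: measurableI)
  let ?PJ = "lborelP J :: ('b \<Rightarrow> real) measure"
  let ?PB = "PiM J (\<lambda>_. borel) :: ('b \<Rightarrow> real) measure"
  have setsPJ [measurable_cong]: "sets ?PJ = sets ?PB" by (rule sets_PiM_cong) auto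
  define Ym' where "Ym' \<omega> = (\<lambda>j\<in>J. Y j \<omega>)" for \<omega>
  have YM [measurable]: "Ym' \<in> measurable M ?PB"
    unfolding Ym'_def using Ym by (intro measurable_restrict)
  define w where "w p = (\<Prod>j\<in>J. lapd (s j (fst p)) (snd p j))" for p
  have wm [measurable]: "w \<in> borel_measurable (M \<Otimes>\<^sub>M ?PJ)"
    unfolding w_def
  proof (intro borel_measurable_prod_ennreal borel_measurable_lapd)
    fix j assume j: "j \<in> J"
    then show "(\<lambda>p. s j (fst p)) \<in> borel_measurable (M \<Otimes>\<^sub>M ?PJ)"
      using s[OF j] by measurable
    show "(\<lambda>p. snd p j) \<in> borel_measurable (M \<Otimes>\<^sub>M ?PJ)"
      using j by measurable
  qed
  \<comment> \<open>The first coordinate carries \<open>F\<close> and not \<open>M\<close>, because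
    conditioning gives the identity of the two measures only for rectangles D \<times> A with D in
    \<open>F\<close>.\<close>
  define N1 where "N1 = distr M (F \<Otimes>\<^sub>M ?PB) (\<lambda>\<omega>. (\<omega>, Ym' \<omega>))"
  define N2 where "N2 = distr (density (M \<Otimes>\<^sub>M ?PJ) w) (F \<Otimes>\<^sub>M ?PB) (\<lambda>p. p)"
  have idm [measurable]: "(\<lambda>p. p) \<in> measurable (M \<Otimes>\<^sub>M ?PJ) (F \<Otimes>\<^sub>M ?PB)"
  proof -
    have "(\<lambda>p. (fst p, snd p)) \<in> measurable (M \<Otimes>\<^sub>M ?PJ) (F \<Otimes>\<^sub>M ?PB)"
      by (intro measurable_Pair measurable_compose[OF measurable_fst id1]) measurable
    then show ?thesis by simp
  qed
  have pairm [measurable]: "(\<lambda>\<omega>. (\<omega>, Ym' \<omega>)) \<in> measurable M (F \<Otimes>\<^sub>M ?PB)"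
    by (intro measurable_Pair id1 YM)
  have N12: "N1 = N2"
  proof (rule measure_eqI_generator_eq)
    let ?E = "{a \<times> b |a b. a \<in> sets F \<and> b \<in> prod_algebra J (\<lambda>_. borel :: real measure)}"
    let ?\<Omega> = "space F \<times> space ?PB"
    have pa: "prod_algebra J (\<lambda>_. borel :: real measure) = {\<Pi>\<^sub>E i\<in>J. X i |X. X \<in> (\<Pi> j\<in>J. sets borel)}"
      by (rule prod_algebra_eq_finite[OF J(1)])
    show "Int_stable ?E"
    proof (rule Int_stableI)
      fix x y assume "x \<in> ?E" "y \<in> ?E"
      then obtain a b a' b' where *: "x = a \<times> b" "y = a' \<times> b'" "a \<in> sets F" "a' \<in> sets F"
        "b \<in> prod_algebra J (\<lambda>_. borel :: real measure)" "b' \<in> prod_algebra J (\<lambda>_. borel :: real measure)"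
        by blast
      have "b \<inter> b' \<in> prod_algebra J (\<lambda>_. borel :: real measure)"
        using Int_stable_prod_algebra *(5,6) by (auto simp: Int_stable_def)
      then show "x \<inter> y \<in> ?E" using * by (auto simp: Times_Int_Times)
    qed
    show "?E \<subseteq> Pow ?\<Omega>"
      using sets.sets_into_space[of _ F] prod_algebra_sets_into_space[of J "\<lambda>_. borel :: real measure"]
      by (fastforce simp: space_PiM)
    have eq: "sets (F \<Otimes>\<^sub>M ?PB) = sigma_sets ?\<Omega> ?E"
    proof -
      have u: "(\<Pi>\<^sub>E i\<in>J. UNIV) \<in> prod_algebra J (\<lambda>_. borel :: real measure)" unfolding pa by auto
      have "sets (F \<Otimes>\<^sub>M ?PB) = sets (sigma (space F \<times> space ?PB) ?E)"
        by (rule sets_pair_eq[where Ca="{space F}" and Cb="{\<Pi>\<^sub>E i\<in>J. UNIV}"])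
          (use u in \<open>auto simp: sets.sigma_sets_eq sets_PiM space_PiM
            dest: sets.sets_into_space[THEN subsetD] prod_algebra_sets_into_space[THEN subsetD]\<close>)
      also have "\<dots> = sigma_sets ?\<Omega> ?E"
        using \<open>?E \<subseteq> Pow ?\<Omega>\<close> by (rule sets_measure_of)
      finally show ?thesis .
    qed
    show "sets N1 = sigma_sets ?\<Omega> ?E" "sets N2 = sigma_sets ?\<Omega> ?E"
      unfolding eq[symmetric] by (simp_all add: N1_def N2_def)
    show "range (\<lambda>_::nat. ?\<Omega>) \<subseteq> ?E"
      unfolding pa using sets.top[of F]
      by (auto simp: space_PiM intro!: exI[of _ "space F"] exI[of _ "\<Pi>\<^sub>E i\<in>J. UNIV"] exI[of _ "\<lambda>_. UNIV"])
    show "(\<Union>i::nat. ?\<Omega>) = ?\<Omega>" by simp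
    show "emeasure N1 ?\<Omega> \<noteq> \<infinity>"
    proof -
      have "finite_measure N1" unfolding N1_def by (rule finite_measure_distr[OF pairm])
      then show ?thesis by (simp add: finite_measure.emeasure_finite)
    qed
    fix X assume "X \<in> ?E"
    then obtain D A where X: "X = D \<times> (\<Pi>\<^sub>E j\<in>J. A j)" and D: "D \<in> sets F"
      and A: "\<And>j. j \<in> J \<Longrightarrow> A j \<in> sets borel" unfolding pa by auto
    have Xs [measurable]: "X \<in> sets (F \<Otimes>\<^sub>M ?PB)"
      unfolding X using D A J(1) by (intro pair_measureI sets_PiM_I_finite) auto
    have Xs2 [measurable]: "X \<in> sets (M \<Otimes>\<^sub>M ?PJ)"
      unfolding X using D A J(1) setsF by (intro pair_measureI sets_PiM_I_finite) auto
    have "emeasure N1 X = emeasure M (D \<inter> {\<omega>\<in>space M. \<forall>j\<in>J. Y j \<omega> \<in> A j})"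
      unfolding N1_def using sets.sets_into_space[OF D] spF
      by (subst emeasure_distr[OF pairm Xs]) (auto intro!: arg_cong[where f="emeasure M"] simp: X Ym'_def)
    also have "\<dots> = (\<integral>\<^sup>+\<omega>\<in>D. (\<Prod>j\<in>J. emeasure (laplace (s j \<omega>)) (A j)) \<partial>M)"
      by (rule cond_indep_laplace_rectangle[OF sub Y J s D A])
    also have "\<dots> = (\<integral>\<^sup>+\<omega>. \<integral>\<^sup>+y. w (\<omega>, y) * indicator X (\<omega>, y) \<partial>?PJ \<partial>M)"
    proof (rule nn_integral_cong)
      fix \<omega>
      have "(\<integral>\<^sup>+y. w (\<omega>, y) * indicator X (\<omega>, y) \<partial>?PJ)
        = (\<integral>\<^sup>+y. indicator D \<omega> * (\<Prod>j\<in>J. lapd (s j \<omega>) (y j) * indicator (A j) (y j)) \<partial>?PJ)"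
      proof (rule nn_integral_cong)
        fix y assume y: "y \<in> space ?PJ"
        then have "indicator X (\<omega>, y) = indicator D \<omega> * (\<Prod>j\<in>J. indicator (A j) (y j) :: ennreal)"
          using J(1) by (auto simp: X indicator_def space_PiM PiE_iff prod_zero_iff)
        then show "w (\<omega>, y) * indicator X (\<omega>, y) = indicator D \<omega> * (\<Prod>j\<in>J. lapd (s j \<omega>) (y j) * indicator (A j) (y j))"
          by (simp add: w_def prod.distrib ac_simps)
      qed
      also have "\<dots> = indicator D \<omega> * (\<integral>\<^sup>+y. (\<Prod>j\<in>J. lapd (s j \<omega>) (y j) * indicator (A j) (y j)) \<partial>?PJ)"
      proof (intro nn_integral_cmult borel_measurable_prod_ennreal)
        fix j assume j: "j \<in> J"
        have "(\<lambda>v. lapd (s j \<omega>) v * indicator (A j) v) \<in> borel_measurable lborel"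
          using A[OF j] by measurable
        then show "(\<lambda>y. lapd (s j \<omega>) (y j) * indicator (A j) (y j)) \<in> borel_measurable ?PJ"
          by (rule measurable_compose[OF measurable_component_singleton[OF j]])
      qed
      also have "\<dots> = indicator D \<omega> * (\<Prod>j\<in>J. emeasure (laplace (s j \<omega>)) (A j))"
        using A J(1) by (subst P.product_nn_integral_prod) (auto simp: emeasure_laplace)
      finally show "(\<Prod>j\<in>J. emeasure (laplace (s j \<omega>)) (A j)) * indicator D \<omega>
        = (\<integral>\<^sup>+y. w (\<omega>, y) * indicator X (\<omega>, y) \<partial>?PJ)" by (simp add: ac_simps)
    qed
    also have "\<dots> = (\<integral>\<^sup>+p. w p * indicator X p \<partial>(M \<Otimes>\<^sub>M ?PJ))"
      by (rule PJ.nn_integral_fst) measurable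
    also have "\<dots> = emeasure (density (M \<Otimes>\<^sub>M ?PJ) w) X"
      by (rule emeasure_density[symmetric]) measurable
    also have "\<dots> = emeasure N2 X"
      unfolding N2_def using sets.sets_into_space[OF Xs2]
      by (subst emeasure_distr) (auto intro!: arg_cong2[where f=emeasure])
    finally show "emeasure N1 X = emeasure N2 X" .
  qed
  have "(\<integral>\<^sup>+\<omega>. G (\<omega>, \<lambda>j\<in>J. Y j \<omega>) \<partial>M) = (\<integral>\<^sup>+p. G p \<partial>N1)"
    unfolding N1_def using G by (subst nn_integral_distr[OF pairm]) (simp_all add: Ym'_def)
  also have "\<dots> = (\<integral>\<^sup>+p. G p \<partial>density (M \<Otimes>\<^sub>M ?PJ) w)"
    unfolding N12 N2_def using G by (subst nn_integral_distr) simp_all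
  also have "\<dots> = (\<integral>\<^sup>+p. w p * G p \<partial>(M \<Otimes>\<^sub>M ?PJ))"
    by (rule nn_integral_density[OF wm measurable_compose[OF idm G]])
  also have "\<dots> = (\<integral>\<^sup>+\<omega>. \<integral>\<^sup>+y. w (\<omega>, y) * G (\<omega>, y) \<partial>?PJ \<partial>M)"
    by (intro PJ.nn_integral_fst[symmetric] borel_measurable_times_ennreal wm measurable_compose[OF idm G])
  finally show ?thesis by (simp add: w_def ac_simps)
qed

section \<open>Jumps of the Poisson process\<close>

lemma LBINT_two_div:
  fixes s t :: real assumes "0 < s" "s \<le> t"
  shows "(LBINT v:{s..t}. 2 / v) = 2 * ln (t / s)"
proof -
  have "(LBINT v. 2 / v * indicator {s..t} v) = 2 * ln t - 2 * ln s"
    using assms by (intro integral_FTC_Icc_nonneg)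
      (auto intro!: derivative_eq_intros continuous_intros)
  then show ?thesis
    using assms by (simp add: set_lebesgue_integral_def mult.commute ln_div)
qed

text \<open>Powers against an exponential. The parameter is the mean number of jumps between \<eta>
  and \<eta> exp (k + 1) for the intensity 2 / t.\<close>

lemma poisson_pmf_lessThan_tendsto_0:
  "(\<lambda>k. measure_pmf.prob (poisson_pmf (2 * real (Suc k))) {..<n}) \<longlonglongrightarrow> 0"
proof -
  have eq: "measure_pmf.prob (poisson_pmf (2 * real (Suc k))) {..<n} =
    (\<Sum>i<n. ((2 * real (Suc k)) ^ i / exp (2 * real (Suc k))) / fact i)" for k
    by (subst measure_measure_pmf_finite) (auto simp: field_simps simp flip: exp_add intro!: sum.cong)
  have "((\<lambda>k. (2 * real k) ^ i / exp (2 * real k)) \<longlonglongrightarrow> 0)" for i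
    by (rule filterlim_compose[OF tendsto_power_div_exp_0])
       (auto intro!: filterlim_tendsto_pos_mult_at_top[where c=2] filterlim_real_sequentially)
  then have "(\<lambda>k. \<Sum>i<n. ((2 * real (Suc k)) ^ i / exp (2 * real (Suc k))) / fact i) \<longlonglongrightarrow> (\<Sum>i<n. 0 / fact i)"
    by (intro tendsto_sum tendsto_divide tendsto_const LIMSEQ_Suc) auto
  then show ?thesis unfolding eq by simp
qed

text \<open>The Poisson process and the summands that \<open>laplace_process\<close> hides behind an
  existential quantifier, fixed here so that they can be referred to.\<close>

locale compound_laplace = prob_space M for M :: "'w measure" +
  fixes \<eta> :: real and P :: "real \<Rightarrow> 'w \<Rightarrow> nat" and Y :: "nat \<Rightarrow> 'w \<Rightarrow> real"
  assumes eta_pos: "0 < \<eta>"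
    and poisson: "poisson_process M \<eta> (\<lambda>t. 2 / t) P"
    and cond_indep: "cond_indep_laplace M
        (vimage_algebra (space M) (\<lambda>\<omega> n. jump_time \<eta> P n \<omega>) (PiM UNIV (\<lambda>_. borel)))
        UNIV (jump_time \<eta> P) Y"
begin

abbreviation "T \<equiv> jump_time \<eta> P"
abbreviation "jumpF \<equiv> vimage_algebra (space M) (\<lambda>\<omega> n. T n \<omega>) (PiM UNIV (\<lambda>_. borel))"

lemma P_measurable [measurable]: "\<eta> \<le> t \<Longrightarrow> P t \<in> measurable M (count_space UNIV)"
  using poisson by (auto simp: poisson_process_def)

lemma P_eta [simp]: "\<omega> \<in> space M \<Longrightarrow> P \<eta> \<omega> = 0"
  using poisson by (auto simp: poisson_process_def)

lemma P_mono: "\<omega> \<in> space M \<Longrightarrow> \<eta> \<le> s \<Longrightarrow> s \<le> t \<Longrightarrow> P s \<omega> \<le> P t \<omega>"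
proof -
  assume *: "\<omega> \<in> space M" "\<eta> \<le> s" "s \<le> t"
  then have "mono_on {\<eta>..} (\<lambda>t. P t \<omega>)" using poisson by (simp add: poisson_process_def)
  from mono_onD[OF this, of s t] * show "P s \<omega> \<le> P t \<omega>" by simp
qed

lemma P_right: "\<omega> \<in> space M \<Longrightarrow> \<eta> \<le> t \<Longrightarrow> eventually (\<lambda>s. P s \<omega> = P t \<omega>) (at_right t)"
  using poisson by (auto simp: poisson_process_def)

lemma P_increment:
  assumes "\<eta> \<le> s" "s < t"
  shows "distr M (count_space UNIV) (\<lambda>\<omega>. P t \<omega> - P s \<omega>) = measure_pmf (poisson_pmf (2 * ln (t / s)))"
proof -
  have "(LBINT v:{s..t}. 2 / v) = 2 * ln (t / s)"
    using assms eta_pos by (intro LBINT_two_div) auto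
  then show ?thesis
    using poisson assms unfolding poisson_process_def by metis
qed

lemma prob_P_increment:
  assumes "\<eta> \<le> s" "s < t"
  shows "prob {\<omega>\<in>space M. P t \<omega> - P s \<omega> \<in> A} = measure_pmf.prob (poisson_pmf (2 * ln (t / s))) A"
proof -
  have "\<eta> \<le> t" using assms by simp
  note [measurable] = P_measurable[OF this] P_measurable[OF assms(1)]
  have [measurable]: "(\<lambda>\<omega>. P t \<omega> - P s \<omega>) \<in> measurable M (count_space UNIV)"
    by measurable
  have "measure_pmf.prob (poisson_pmf (2 * ln (t / s))) A = measure (distr M (count_space UNIV) (\<lambda>\<omega>. P t \<omega> - P s \<omega>)) A"
    by (simp only: P_increment[OF assms])
  then show ?thesis
    by (subst (asm) measure_distr) (auto simp: vimage_def Int_def conj_commute)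
qed

text \<open>Along the times \<eta> exp k the probability of fewer than n jumps tends to 0. It
  ensures that almost surely every \<open>jump_time\<close> is the infimum of a nonempty
  set.\<close>

lemma AE_P_unbounded: "AE \<omega> in M. \<forall>n. \<exists>t\<ge>\<eta>. n \<le> P t \<omega>"
proof (subst AE_all_countable, rule allI)
  fix n
  define t where "t k = \<eta> * exp (real k)" for k :: nat
  have t: "\<eta> \<le> t k" for k using eta_pos by (simp add: t_def)
  define R where "R = {\<omega>\<in>space M. \<forall>k. \<not> n \<le> P (t k) \<omega>}"
  have R: "R \<in> sets M" unfolding R_def using t by measurable
  have le: "prob R \<le> measure_pmf.prob (poisson_pmf (2 * real (Suc k))) {..<n}" for k
  proof -
    have lt: "\<eta> < t (Suc k)" using eta_pos by (simp add: t_def)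
    have "prob R \<le> prob {\<omega>\<in>space M. P (t (Suc k)) \<omega> - P \<eta> \<omega> \<in> {..<n}}"
      using t by (intro finite_measure_mono) (auto simp: R_def not_le)
    also have "\<dots> = measure_pmf.prob (poisson_pmf (2 * real (Suc k))) {..<n}"
      using eta_pos by (subst prob_P_increment[OF order_refl lt]) (simp add: t_def)
    finally show ?thesis .
  qed
  have "prob R \<le> 0"
    using poisson_pmf_lessThan_tendsto_0[of n] le
    by (intro LIMSEQ_le_const) auto
  then have "emeasure M R = 0" by (simp add: emeasure_eq_measure measure_le_0_iff)
  then have "AE \<omega> in M. \<omega> \<notin> R" using R by (intro AE_not_in) auto
  then show "AE \<omega> in M. \<exists>t\<ge>\<eta>. n \<le> P t \<omega>"
    by (rule AE_mp, intro AE_I2) (use t in \<open>auto simp: R_def\<close>)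
qed

text \<open>Right continuity of the paths makes the infimum in \<open>jump_time\<close> attained.
  The equivalence translates statements about counts into statements about jump times, which are
  measurable for \<open>jumpF\<close>.\<close>

lemma jump_time_le_iff:
  assumes "\<omega> \<in> space M" "\<exists>t\<ge>\<eta>. n \<le> P t \<omega>" "\<eta> \<le> t"
  shows "T n \<omega> \<le> t \<longleftrightarrow> n \<le> P t \<omega>"
proof (cases "n = 0")
  case True then show ?thesis using assms by (simp add: jump_time_def)
next
  case False
  define S where "S = {t. \<eta> \<le> t \<and> n \<le> P t \<omega>}"
  have ne: "S \<noteq> {}" and bd: "bdd_below S" using assms by (auto simp: S_def intro!: bdd_belowI[of _ \<eta>])
  have Inf_ge: "\<eta> \<le> Inf S" using ne by (intro cInf_greatest) (auto simp: S_def)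
  have "n \<le> P (Inf S) \<omega>"
  proof -
    obtain b where b: "Inf S < b" "\<And>s. Inf S < s \<Longrightarrow> s < b \<Longrightarrow> P s \<omega> = P (Inf S) \<omega>"
      using P_right[OF assms(1) Inf_ge] by (auto simp: eventually_at_right_field)
    obtain s where s: "s \<in> S" "s < b" using b(1) cInf_lessD[OF ne] by blast
    have "Inf S \<le> s" using s(1) bd by (rule cInf_lower)
    then show ?thesis using b(2)[of s] s by (cases "Inf S = s") (auto simp: S_def)
  qed
  then have "n \<le> P t \<omega>" if "Inf S \<le> t" using P_mono[OF assms(1) Inf_ge that] by simp
  moreover have "Inf S \<le> t" if "n \<le> P t \<omega>" using that assms(3) bd by (intro cInf_lower) (auto simp: S_def)
  ultimately show ?thesis using False by (auto simp: jump_time_def S_def[symmetric])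
qed

lemma jump_time_ge:
  assumes "\<omega> \<in> space M" "\<exists>t\<ge>\<eta>. n \<le> P t \<omega>"
  shows "\<eta> \<le> T n \<omega>"
  using assms by (auto simp: jump_time_def intro!: cInf_greatest)

lemma jump_time_measurable [measurable]: "T n \<in> borel_measurable M"
proof (cases "n = 0")
  case True
  then have "T n = (\<lambda>_. \<eta>)" by (simp add: jump_time_def fun_eq_iff)
  then show ?thesis by simp
next
  case False
  show ?thesis
  proof (rule borel_measurableI_le)
    fix t
    \<comment> \<open>By monotonicity of the path, the times \<eta> + k suffice to detect whether
      level n is ever reached, which makes the condition countable.\<close>
    define R where "R = {\<omega>\<in>space M. \<exists>k::nat. n \<le> P (\<eta> + real k) \<omega>}"
    have R [measurable]: "R \<in> sets M" unfolding R_def by measurable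
    have R_iff: "\<omega> \<in> R \<longleftrightarrow> \<omega> \<in> space M \<and> (\<exists>t\<ge>\<eta>. n \<le> P t \<omega>)" for \<omega>
    proof safe
      fix t assume *: "\<omega> \<in> space M" "\<eta> \<le> t" "n \<le> P t \<omega>"
      obtain k :: nat where "t - \<eta> \<le> real k" using real_arch_simple by blast
      then have "P t \<omega> \<le> P (\<eta> + real k) \<omega>" using * by (intro P_mono) auto
      then show "\<omega> \<in> R" using * by (auto simp: R_def intro!: exI[of _ k])
    qed (auto simp: R_def intro: exI[of _ "\<eta> + real _"])
    \<comment> \<open>off \<open>R\<close> there is no \<open>n\<close>-th jump, and the jump time is the junk value \<open>Inf {}\<close>\<close>
    have out: "T n \<omega> = Inf {}" if "\<omega> \<in> space M - R" for \<omega>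
      using that False unfolding jump_time_def by (auto simp: R_iff intro!: arg_cong[where f=Inf])
    have "{\<omega>\<in>space M. T n \<omega> \<le> t} =
      (if \<eta> \<le> t then {\<omega>\<in>space M. n \<le> P t \<omega>} \<inter> R else {}) \<union> (if (Inf {} :: real) \<le> t then space M - R else {})"
      using out jump_time_le_iff[of _ n t] jump_time_ge[of _ n] R_iff
      by (auto split: if_splits; force)
    then show "{\<omega>\<in>space M. T n \<omega> \<le> t} \<in> sets M"
      by (auto intro!: sets.Un sets.Int)
  qed
qed

lemma jump_algebra_measurable:
  "T n \<in> borel_measurable jumpF"
proof -
  have "(\<lambda>\<omega> n. T n \<omega>) \<in> measurable jumpF (PiM UNIV (\<lambda>_. borel :: real measure))"
    by (intro measurable_vimage_algebra1) (auto simp: space_PiM)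
  from measurable_compose[OF this measurable_component_singleton[of n]] show ?thesis by simp
qed

lemma jump_subalgebra: "subalgebra M jumpF"
  unfolding subalgebra_def
proof
  have "(\<lambda>\<omega> n. T n \<omega>) \<in> measurable M (PiM UNIV (\<lambda>_. borel))"
    by (intro measurable_PiM_single') (auto simp: space_PiM)
  then show "sets jumpF \<subseteq> sets M"
    by (intro sets_image_in_sets) auto
qed simp

lemma Y_measurable [measurable]: "Y n \<in> borel_measurable M"
  using cond_indep by (auto simp: cond_indep_laplace_def)

end

section \<open>Markov chains on a geometric grid\<close>

text \<open>Consecutive points have the fixed ratio exp h. Hence the intensity 2 / t has integral 2
  h over every step, and the weight (s / s')^2 of \<open>lapd_decompose\<close> is exp (- 2 h) in
  every step.\<close>

definition grid :: "real \<Rightarrow> real \<Rightarrow> nat \<Rightarrow> real" where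
  "grid \<eta> h j = \<eta> * exp (h * real j)"

text \<open>\<open>chain a k G i m z\<close> is the expected product of the test functions \<open>G\<^sub>i, \<dots>, G\<^sub>i\<^sub>+\<^sub>m\<close> along the chain
  that starts in \<open>z\<close> at time \<open>i\<close> and in step \<open>j\<close> stays with weight \<open>a\<close> or moves by \<open>y\<close> with density
  \<open>k\<^sub>j y\<close>. The total weight may be less than \<open>1\<close>.\<close>

fun chain :: "ennreal \<Rightarrow> (nat \<Rightarrow> real \<Rightarrow> ennreal) \<Rightarrow> (nat \<Rightarrow> real \<Rightarrow> ennreal) \<Rightarrow> nat \<Rightarrow> nat \<Rightarrow> real \<Rightarrow> ennreal" where
  "chain a k G i 0 z = G i z"
| "chain a k G i (Suc m) z =
    G i z * (a * chain a k G (Suc i) m z + (\<integral>\<^sup>+y. chain a k G (Suc i) m (z + y) * k i y \<partial>lborel))"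

lemma chain_measurable [measurable]:
  assumes [measurable]: "\<And>i. G i \<in> borel_measurable borel" "\<And>i. k i \<in> borel_measurable borel"
  shows "chain a k G i m \<in> borel_measurable borel"
proof (induction m arbitrary: i)
  case 0 then show ?case by (simp add: chain.simps[abs_def])
next
  case (Suc m)
  note [measurable] = Suc[of "Suc i"]
  show ?case by (simp add: chain.simps[abs_def])
qed

lemma chain_mono_kernel:
  assumes "\<And>i y. k i y \<le> k' i y"
  shows "chain a k G i m z \<le> chain a k' G i m z"
proof (induction m arbitrary: i z)
  case (Suc m)
  then show ?case using assms by (auto intro!: mult_left_mono add_mono nn_integral_mono mult_mono)
qed simp

text \<open>The kernels depend on the increment only, so a translation of the starting point is
  carried unchanged through all later steps and meets only test functions from \<open>i0\<close>
  on.\<close>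

lemma chain_mono_shift:
  assumes "\<And>i z. i \<ge> i0 \<Longrightarrow> G i z \<le> G' i (z + c)" "i \<ge> i0"
  shows "chain a k G i m z \<le> chain a k G' i m (z + c)"
  using assms(2)
proof (induction m arbitrary: i z)
  case (Suc m)
  have "chain a k G (Suc i) m (z + y) \<le> chain a k G' (Suc i) m (z + c + y)" for y
    using Suc.IH[of "Suc i" "z + y"] Suc.prems by (simp add: ac_simps)
  then show ?case using Suc assms(1)[OF Suc.prems]
    by (auto intro!: mult_mono mult_left_mono add_mono nn_integral_mono mult_right_mono)
qed (use assms in simp)

lemma chain_le_1:
  assumes G: "\<And>i z. G i z \<le> 1" and k: "\<And>i. k i \<in> borel_measurable borel" "\<And>i. a + (\<integral>\<^sup>+y. k i y \<partial>lborel) \<le> 1"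
  shows "chain a k G i m z \<le> 1"
proof (induction m arbitrary: i z)
  case (Suc m)
  have "chain a k G i (Suc m) z \<le> 1 * (a * 1 + (\<integral>\<^sup>+y. 1 * k i y \<partial>lborel))"
    unfolding chain.simps by (intro mult_mono add_mono nn_integral_mono Suc G) auto
  also have "\<dots> \<le> 1" using k(2)[of i] by simp
  finally show ?case .
qed (use G in simp)

text \<open>Here \<open>r\<close> is the mass that is cut off from the kernel. The reduced chain
  keeps mass \<kappa>^m over m steps, and what passes through \<open>r\<close> at least once
  contributes at most its mass 1 - \<kappa>^m because the test functions are bounded by 1.\<close>

lemma chain_le_add:
  assumes G: "\<And>i z. G i z \<le> 1" "\<And>i. G i \<in> borel_measurable borel"
    and k: "\<And>i. k i \<in> borel_measurable borel" "\<And>i. r i \<in> borel_measurable borel"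
    and mass: "\<And>i. a + (\<integral>\<^sup>+y. k i y \<partial>lborel) = ennreal \<kappa>" "\<And>i. (\<integral>\<^sup>+y. r i y \<partial>lborel) = ennreal (1 - \<kappa>)"
    and \<kappa>: "0 \<le> \<kappa>" "\<kappa> \<le> 1"
  shows "chain a (\<lambda>i y. k i y + r i y) G i m z \<le> chain a k G i m z + ennreal (1 - \<kappa> ^ m)"
proof (induction m arbitrary: i z)
  case (Suc m)
  let ?k' = "\<lambda>i y. k i y + r i y"
  let ?C' = "chain a ?k' G (Suc i) m" and ?C = "chain a k G (Suc i) m" and ?e = "ennreal (1 - \<kappa> ^ m)"
  note [measurable] = G(2) k
  have [measurable]: "?C' \<in> borel_measurable borel" "?C \<in> borel_measurable borel" by measurable
  have pw: "0 \<le> 1 - \<kappa> ^ m" using \<kappa> by (simp add: power_le_one)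
  have le1: "?C' x \<le> 1" for x
  proof (rule chain_le_1)
    fix i
    have "a + (\<integral>\<^sup>+y. k i y + r i y \<partial>lborel) = a + (\<integral>\<^sup>+y. k i y \<partial>lborel) + (\<integral>\<^sup>+y. r i y \<partial>lborel)"
      by (subst nn_integral_add) (auto simp: add.assoc)
    also have "\<dots> = 1" using \<kappa> unfolding mass by (subst ennreal_plus[symmetric]) auto
    finally show "a + (\<integral>\<^sup>+y. k i y + r i y \<partial>lborel) \<le> 1" by simp
  qed (use G in auto)
  have "(\<integral>\<^sup>+y. ?C' (z + y) * ?k' i y \<partial>lborel) \<le> (\<integral>\<^sup>+y. (?C (z + y) + ?e) * k i y + 1 * r i y \<partial>lborel)"
    unfolding distrib_left using Suc le1 by (intro nn_integral_mono add_mono mult_right_mono) auto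
  also have "\<dots> = (\<integral>\<^sup>+y. ?C (z + y) * k i y + ?e * k i y \<partial>lborel) + ennreal (1 - \<kappa>)"
    unfolding mass(2)[of i, symmetric] by (subst nn_integral_add) (auto simp: distrib_right)
  also have "(\<integral>\<^sup>+y. ?C (z + y) * k i y + ?e * k i y \<partial>lborel)
      = (\<integral>\<^sup>+y. ?C (z + y) * k i y \<partial>lborel) + ?e * (\<integral>\<^sup>+y. k i y \<partial>lborel)"
    by (subst nn_integral_add) (auto simp: nn_integral_cmult)
  finally have 1: "(\<integral>\<^sup>+y. ?C' (z + y) * ?k' i y \<partial>lborel)
    \<le> (\<integral>\<^sup>+y. ?C (z + y) * k i y \<partial>lborel) + ?e * (\<integral>\<^sup>+y. k i y \<partial>lborel) + ennreal (1 - \<kappa>)" .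
  have "a * ?C' z + (\<integral>\<^sup>+y. ?C' (z + y) * ?k' i y \<partial>lborel)
      \<le> a * (?C z + ?e) + ((\<integral>\<^sup>+y. ?C (z + y) * k i y \<partial>lborel) + ?e * (\<integral>\<^sup>+y. k i y \<partial>lborel) + ennreal (1 - \<kappa>))"
    using Suc 1 by (intro add_mono mult_left_mono) auto
  also have "\<dots> = a * ?C z + (\<integral>\<^sup>+y. ?C (z + y) * k i y \<partial>lborel) + (?e * (a + (\<integral>\<^sup>+y. k i y \<partial>lborel)) + ennreal (1 - \<kappa>))"
    by (simp add: distrib_left ac_simps)
  also have "?e * (a + (\<integral>\<^sup>+y. k i y \<partial>lborel)) + ennreal (1 - \<kappa>) = ennreal (1 - \<kappa> ^ Suc m)"
  proof -
    have "ennreal ((1 - \<kappa> ^ m) * \<kappa>) + ennreal (1 - \<kappa>) = ennreal ((1 - \<kappa> ^ m) * \<kappa> + (1 - \<kappa>))"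
      using \<kappa> pw by (intro ennreal_plus[symmetric]) auto
    also have "(1 - \<kappa> ^ m) * \<kappa> + (1 - \<kappa>) = 1 - \<kappa> ^ Suc m" by (simp add: algebra_simps)
    finally show ?thesis unfolding mass using \<kappa> pw by (simp only: ennreal_mult)
  qed
  finally have 2: "a * ?C' z + (\<integral>\<^sup>+y. ?C' (z + y) * ?k' i y \<partial>lborel)
    \<le> a * ?C z + (\<integral>\<^sup>+y. ?C (z + y) * k i y \<partial>lborel) + ennreal (1 - \<kappa> ^ Suc m)" .
  have "chain a ?k' G i (Suc m) z
    \<le> G i z * (a * ?C z + (\<integral>\<^sup>+y. ?C (z + y) * k i y \<partial>lborel) + ennreal (1 - \<kappa> ^ Suc m))"
    unfolding chain.simps using 2 by (rule mult_left_mono) simp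
  also have "\<dots> \<le> chain a k G i (Suc m) z + 1 * ennreal (1 - \<kappa> ^ Suc m)"
    unfolding chain.simps(2)[of a k] distrib_left[of "G i z" "_ + _"]
    by (intro add_left_mono mult_right_mono G) auto
  finally show ?case by simp
qed simp

text \<open>The jump part of the exact chain: the increment has the scale of the right end point of
  the step, and its mass is the complement of the stay weight, as \<open>lapd_decompose\<close>
  prescribes for consecutive grid points.\<close>

definition laplace_kernel :: "real \<Rightarrow> real \<Rightarrow> nat \<Rightarrow> real \<Rightarrow> ennreal" where
  "laplace_kernel \<eta> h i y = ennreal (1 - exp (- 2 * h)) * lapd (grid \<eta> h (Suc i)) y"

abbreviation laplace_chain where
  "laplace_chain \<eta> h \<equiv> chain (ennreal (exp (- 2 * h))) (laplace_kernel \<eta> h)"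

lemma laplace_kernel_measurable [measurable]: "laplace_kernel \<eta> h i \<in> borel_measurable borel"
  unfolding laplace_kernel_def by measurable

lemma grid_0 [simp]: "grid \<eta> h 0 = \<eta>" by (simp add: grid_def)

lemma grid_pos: "0 < \<eta> \<Longrightarrow> 0 < grid \<eta> h j" by (simp add: grid_def)

lemma grid_Suc: "grid \<eta> h (Suc j) = grid \<eta> h j * exp h"
  by (simp add: grid_def distrib_left exp_add)

lemma grid_mono: "0 < \<eta> \<Longrightarrow> 0 \<le> h \<Longrightarrow> i \<le> j \<Longrightarrow> grid \<eta> h i \<le> grid \<eta> h j"
  by (simp add: grid_def mult_left_mono)

lemma grid_ge: "0 < \<eta> \<Longrightarrow> 0 \<le> h \<Longrightarrow> \<eta> \<le> grid \<eta> h i"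
  using grid_mono[of \<eta> h 0 i] by simp

text \<open>With a trivial test function at time i, one step carries the Laplace law of scale
  \<open>grid \<eta> h i\<close> to that of the next scale: Fubini and a translation turn the two
  branches of the chain into the two terms of \<open>lapd_decompose\<close>.\<close>

lemma laplace_chain_step:
  assumes "0 < \<eta>" "0 < h" and [measurable]: "\<And>i. G i \<in> borel_measurable borel" and G1: "\<And>z. G i z = 1"
  shows "(\<integral>\<^sup>+z. lapd (grid \<eta> h i) z * laplace_chain \<eta> h G i (Suc m) z \<partial>lborel)
    = (\<integral>\<^sup>+z. lapd (grid \<eta> h (Suc i)) z * laplace_chain \<eta> h G (Suc i) m z \<partial>lborel)"
proof -
  define s where "s = grid \<eta> h i"
  define s' where "s' = grid \<eta> h (Suc i)"
  define a where "a = exp (- 2 * h)"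
  define V where "V = laplace_chain \<eta> h G (Suc i) m"
  have [measurable]: "V \<in> borel_measurable borel" unfolding V_def by measurable
  have s: "0 < s" "s < s'" using assms(1,2) by (auto simp: s_def s'_def grid_Suc grid_pos)
  have "s / s' = exp (- h)"
    using s(1) by (simp add: s'_def s_def[symmetric] grid_Suc exp_minus divide_inverse)
  then have a: "(s / s')\<^sup>2 = a" by (simp add: a_def power2_eq_square flip: exp_add)
  have "(\<integral>\<^sup>+z. lapd s z * laplace_chain \<eta> h G i (Suc m) z \<partial>lborel)
    = (\<integral>\<^sup>+z. ennreal a * lapd s z * V z + (\<integral>\<^sup>+y. ennreal (1 - a) * (lapd s z * V (z + y) * lapd s' y) \<partial>lborel) \<partial>lborel)"
  proof (rule nn_integral_cong)
    fix z
    have "lapd s z * laplace_chain \<eta> h G i (Suc m) z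
      = lapd s z * (ennreal a * V z + (\<integral>\<^sup>+y. V (z + y) * (ennreal (1 - a) * lapd s' y) \<partial>lborel))"
      by (simp add: G1 V_def a_def laplace_kernel_def s'_def)
    also have "\<dots> = ennreal a * lapd s z * V z + (\<integral>\<^sup>+y. lapd s z * (V (z + y) * (ennreal (1 - a) * lapd s' y)) \<partial>lborel)"
      by (subst nn_integral_cmult) (auto simp: distrib_left ac_simps)
    finally show "lapd s z * laplace_chain \<eta> h G i (Suc m) z
      = ennreal a * lapd s z * V z + (\<integral>\<^sup>+y. ennreal (1 - a) * (lapd s z * V (z + y) * lapd s' y) \<partial>lborel)"
      by (simp add: ac_simps)
  qed
  also have "\<dots> = (\<integral>\<^sup>+z. ennreal a * lapd s z * V z \<partial>lborel)
      + (\<integral>\<^sup>+z. \<integral>\<^sup>+y. ennreal (1 - a) * (lapd s z * V (z + y) * lapd s' y) \<partial>lborel \<partial>lborel)"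
    by (rule nn_integral_add) measurable
  also have "(\<integral>\<^sup>+z. \<integral>\<^sup>+y. ennreal (1 - a) * (lapd s z * V (z + y) * lapd s' y) \<partial>lborel \<partial>lborel)
      = (\<integral>\<^sup>+y. \<integral>\<^sup>+z. ennreal (1 - a) * (lapd s z * V (z + y) * lapd s' y) \<partial>lborel \<partial>lborel)"
    by (rule lborel_pair.Fubini') measurable
  also have "\<dots> = (\<integral>\<^sup>+y. \<integral>\<^sup>+z. ennreal (1 - a) * (lapd s (z - y) * V z * lapd s' y) \<partial>lborel \<partial>lborel)"
  proof (rule nn_integral_cong)
    fix y
    show "(\<integral>\<^sup>+z. ennreal (1 - a) * (lapd s z * V (z + y) * lapd s' y) \<partial>lborel)
      = (\<integral>\<^sup>+z. ennreal (1 - a) * (lapd s (z - y) * V z * lapd s' y) \<partial>lborel)"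
      by (subst (2) nn_integral_real_affine[where c=1 and t=y]) (auto simp: ac_simps)
  qed
  also have "\<dots> = (\<integral>\<^sup>+z. \<integral>\<^sup>+y. ennreal (1 - a) * (lapd s (z - y) * V z * lapd s' y) \<partial>lborel \<partial>lborel)"
    by (rule lborel_pair.Fubini'[symmetric]) measurable
  also have "\<dots> = (\<integral>\<^sup>+z. ennreal (1 - a) * V z * (\<integral>\<^sup>+y. lapd s (z - y) * lapd s' y \<partial>lborel) \<partial>lborel)"
    by (intro nn_integral_cong, subst nn_integral_cmult[symmetric]) (auto simp: ac_simps)
  also have "(\<integral>\<^sup>+z. ennreal a * lapd s z * V z \<partial>lborel) + \<dots>
      = (\<integral>\<^sup>+z. ennreal a * lapd s z * V z + ennreal (1 - a) * V z * (\<integral>\<^sup>+y. lapd s (z - y) * lapd s' y \<partial>lborel) \<partial>lborel)"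
    by (rule nn_integral_add[symmetric]) measurable
  also have "\<dots> = (\<integral>\<^sup>+z. lapd s' z * V z \<partial>lborel)"
  proof (rule nn_integral_cong)
    fix z
    let ?I = "\<integral>\<^sup>+y. lapd s (z - y) * lapd s' y \<partial>lborel"
    have "ennreal a * lapd s z * V z + ennreal (1 - a) * V z * ?I = (ennreal a * lapd s z + ennreal (1 - a) * ?I) * V z"
      by (simp add: distrib_left ac_simps)
    also have "\<dots> = lapd s' z * V z" using lapd_decompose[OF s, of z] unfolding a by (simp only:)
    finally show "ennreal a * lapd s z * V z + ennreal (1 - a) * V z * ?I = lapd s' z * V z" .
  qed
  finally show ?thesis by (simp add: s_def s'_def V_def)
qed

text \<open>Before time n nothing is observed, so iterating \<open>laplace_chain_step\<close> leaves
  only the law of the state at time n, which is Laplace with scale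
  \<open>grid \<eta> h n\<close>.\<close>

lemma laplace_chain_start:
  assumes "0 < \<eta>" "0 < h" "\<And>i. G i \<in> borel_measurable borel" "\<And>i z. i < n \<Longrightarrow> G i z = 1"
  shows "(\<integral>\<^sup>+z. lapd \<eta> z * laplace_chain \<eta> h G 0 (n + m) z \<partial>lborel)
    = (\<integral>\<^sup>+z. lapd (grid \<eta> h n) z * laplace_chain \<eta> h G n m z \<partial>lborel)"
  using assms(4)
proof (induction n arbitrary: m)
  case (Suc n)
  have "(\<integral>\<^sup>+z. lapd \<eta> z * laplace_chain \<eta> h G 0 (n + Suc m) z \<partial>lborel)
    = (\<integral>\<^sup>+z. lapd (grid \<eta> h n) z * laplace_chain \<eta> h G n (Suc m) z \<partial>lborel)"
    by (rule Suc.IH) (simp add: Suc.prems)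
  also have "\<dots> = (\<integral>\<^sup>+z. lapd (grid \<eta> h (Suc n)) z * laplace_chain \<eta> h G (Suc n) m z \<partial>lborel)"
    using assms Suc.prems by (intro laplace_chain_step) auto
  finally show ?case unfolding add_Suc_shift .
qed simp

text \<open>The translation is made at time n, the first time that is observed, where the state has
  the larger scale \<open>grid \<eta> h n\<close>; a translation at the start would cost exp (|c| /
  \<eta>). The increments after time n stay as they are.\<close>

lemma laplace_chain_shift:
  assumes "0 < \<eta>" "0 < h" and [measurable]: "\<And>i. G i \<in> borel_measurable borel" "\<And>i. G' i \<in> borel_measurable borel"
    and 1: "\<And>i z. i < n \<Longrightarrow> G i z = 1" "\<And>i z. i < n \<Longrightarrow> G' i z = 1"
    and le: "\<And>i z. i \<ge> n \<Longrightarrow> G i z \<le> G' i (z + c)" and "n \<le> m"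
  shows "(\<integral>\<^sup>+z. lapd \<eta> z * laplace_chain \<eta> h G 0 m z \<partial>lborel)
    \<le> ennreal (exp (\<bar>c\<bar> / grid \<eta> h n)) * (\<integral>\<^sup>+z. lapd \<eta> z * laplace_chain \<eta> h G' 0 m z \<partial>lborel)"
proof -
  obtain m' where m: "m = n + m'" using \<open>n \<le> m\<close> le_Suc_ex by blast
  let ?s = "grid \<eta> h n"
  have "(\<integral>\<^sup>+z. lapd \<eta> z * laplace_chain \<eta> h G 0 m z \<partial>lborel) = (\<integral>\<^sup>+z. lapd ?s z * laplace_chain \<eta> h G n m' z \<partial>lborel)"
    unfolding m using assms by (intro laplace_chain_start) auto
  also have "\<dots> \<le> (\<integral>\<^sup>+z. lapd ?s z * laplace_chain \<eta> h G' n m' (z + c) \<partial>lborel)"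
    using le by (intro nn_integral_mono mult_left_mono chain_mono_shift) auto
  also have "\<dots> = (\<integral>\<^sup>+z. lapd ?s (z - c) * laplace_chain \<eta> h G' n m' z \<partial>lborel)"
    by (subst (2) nn_integral_real_affine[where c=1 and t=c]) (auto simp: ac_simps)
  also have "\<dots> \<le> (\<integral>\<^sup>+z. ennreal (exp (\<bar>c\<bar> / ?s)) * lapd ?s z * laplace_chain \<eta> h G' n m' z \<partial>lborel)"
    using assms(1) by (intro nn_integral_mono mult_right_mono lapd_shift grid_pos) auto
  also have "\<dots> = ennreal (exp (\<bar>c\<bar> / ?s)) * (\<integral>\<^sup>+z. lapd ?s z * laplace_chain \<eta> h G' n m' z \<partial>lborel)"
    by (subst nn_integral_cmult[symmetric]) (auto simp: ac_simps)
  also have "(\<integral>\<^sup>+z. lapd ?s z * laplace_chain \<eta> h G' n m' z \<partial>lborel) = (\<integral>\<^sup>+z. lapd \<eta> z * laplace_chain \<eta> h G' 0 m z \<partial>lborel)"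
    unfolding m using assms by (intro laplace_chain_start[symmetric]) auto
  finally show ?thesis .
qed

section \<open>Jump patterns and sums over them\<close>

lemma count_list_take_Suc:
  "j < length bs \<Longrightarrow> count_list (take (Suc j) bs) True = count_list (take j bs) True + of_bool (bs ! j)"
  by (simp add: take_Suc_conv_app_nth)

lemma finite_bool_lists: "finite {bs :: bool list. length bs = m}"
  using finite_lists_length_eq[of "UNIV :: bool set" m] by simp

lemma sum_bool_lists_Suc:
  "(\<Sum>bs | length bs = Suc m. f bs) = (\<Sum>bs | length bs = m. f (True # bs) + f (False # bs))"
proof -
  have *: "{bs :: bool list. length bs = Suc m} = (#) True ` {bs. length bs = m} \<union> (#) False ` {bs. length bs = m}"
    by (auto simp: length_Suc_conv image_iff)
  show ?thesis
    unfolding * by (subst sum.union_disjoint) (auto simp: finite_bool_lists sum.reindex sum.distrib)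
qed

text \<open>A pattern \<open>bs\<close> prescribes for every grid step whether the Poisson process jumps exactly once (\<open>True\<close>)
  or not at all; \<open>l\<close> is the index of the next summand \<open>Y l\<close>, and the density of that summand may
  depend on the step \<open>i\<close> and on \<open>l\<close>.\<close>

fun path_prod :: "(nat \<Rightarrow> real \<Rightarrow> ennreal) \<Rightarrow> nat \<Rightarrow> real \<Rightarrow> nat \<Rightarrow> bool list \<Rightarrow> (nat \<Rightarrow> real) \<Rightarrow> ennreal" where
  "path_prod G i z l [] y = G i z"
| "path_prod G i z l (b # bs) y = G i z *
    (if b then path_prod G (Suc i) (z + y l) (Suc l) bs y else path_prod G (Suc i) z l bs y)"

text \<open>The summands are integrated out in the order in which they enter. The density takes both
  indices since it is used in two ways: as the density with scale \<open>T l \<omega>\<close>, which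
  depends on l, and as a deterministic kernel of the grid step i.\<close>

fun path_int :: "(nat \<Rightarrow> nat \<Rightarrow> real \<Rightarrow> ennreal) \<Rightarrow> (nat \<Rightarrow> real \<Rightarrow> ennreal)
    \<Rightarrow> nat \<Rightarrow> nat \<Rightarrow> real \<Rightarrow> bool list \<Rightarrow> ennreal" where
  "path_int d G i l z [] = G i z"
| "path_int d G i l z (b # bs) = G i z *
    (if b then \<integral>\<^sup>+y. path_int d G (Suc i) (Suc l) (z + y) bs * d i l y \<partial>lborel
     else path_int d G (Suc i) l z bs)"

lemma path_prod_measurable:
  assumes G: "\<And>i. G i \<in> borel_measurable borel" and "f \<in> borel_measurable N"
    and "\<And>j. j \<in> {l..<l + count_list bs True} \<Longrightarrow> (\<lambda>x. g x j) \<in> borel_measurable N"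
  shows "(\<lambda>x. path_prod G i (f x) l bs (g x)) \<in> borel_measurable N"
  using assms(2-)
proof (induction bs arbitrary: i l f)
  case Nil
  then show ?case using measurable_compose[OF Nil(1) G] by simp
next
  case (Cons b bs)
  note [measurable] = Cons.prems(1)
  have [measurable]: "(\<lambda>x. G i (f x)) \<in> borel_measurable N" using measurable_compose[OF Cons.prems(1) G] .
  show ?case
  proof (cases b)
    case True
    have [measurable]: "(\<lambda>x. g x l) \<in> borel_measurable N" using Cons.prems(2)[of l] True by simp
    have [measurable]: "(\<lambda>x. path_prod G (Suc i) (f x + g x l) (Suc l) bs (g x)) \<in> borel_measurable N"
      using Cons.prems(2) True by (intro Cons.IH) auto
    show ?thesis using True by simp
  next
    case False
    have [measurable]: "(\<lambda>x. path_prod G (Suc i) (f x) l bs (g x)) \<in> borel_measurable N"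
      using Cons.prems(2) False by (intro Cons.IH) auto
    show ?thesis using False by simp
  qed
qed

lemma path_prod_cong:
  assumes "\<And>j. j \<in> {l..<l + count_list bs True} \<Longrightarrow> y j = y' j"
  shows "path_prod G i z l bs y = path_prod G i z l bs y'"
  using assms
proof (induction bs arbitrary: i z l)
  case (Cons b bs)
  have "path_prod G (Suc i) (z + y' l) (Suc l) bs y = path_prod G (Suc i) (z + y' l) (Suc l) bs y'" if b
    using Cons.prems that by (intro Cons.IH) auto
  moreover have "path_prod G (Suc i) z l bs y = path_prod G (Suc i) z l bs y'" if "\<not> b"
    using Cons.prems that by (intro Cons.IH) auto
  moreover have "y l = y' l" if b using Cons.prems[of l] that by simp
  ultimately show ?case by simp
qed simp

text \<open>Fubini for the single coordinate \<open>l0\<close>, on which the starting point depends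
  through \<open>g\<close>. It is applied with g v = z + v for a jump in the first step of a pattern
  and with g v = v for the initial summand \<open>Y 0\<close>.\<close>

lemma nn_integral_path_prod_insert:
  assumes G: "\<And>i. G i \<in> borel_measurable borel" and d: "\<And>j. d j \<in> borel_measurable borel"
    and l: "l0 \<notin> {l..<l + count_list bs True}" and g: "g \<in> borel_measurable borel"
    and IH: "\<And>z. (\<integral>\<^sup>+y. path_prod G i z l bs y * (\<Prod>j\<in>{l..<l + count_list bs True}. d j (y j))
        \<partial>PiM {l..<l + count_list bs True} (\<lambda>_. lborel)) = path_int (\<lambda>_. d) G i l z bs"
  shows "(\<integral>\<^sup>+y. path_prod G i (g (y l0)) l bs y * (\<Prod>j\<in>insert l0 {l..<l + count_list bs True}. d j (y j))
        \<partial>PiM (insert l0 {l..<l + count_list bs True}) (\<lambda>_. lborel))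
    = (\<integral>\<^sup>+v. path_int (\<lambda>_. d) G i l (g v) bs * d l0 v \<partial>lborel)"
proof -
  interpret product_sigma_finite "\<lambda>_::nat. lborel :: real measure" by standard
  let ?J = "{l..<l + count_list bs True}"
  let ?N = "lborelP (insert l0 ?J)"
  have comp: "(\<lambda>y. y j) \<in> borel_measurable ?N" if "j \<in> insert l0 ?J" for j
    using measurable_component_singleton[OF that, of "\<lambda>_. lborel :: real measure"] by simp
  have comp': "(\<lambda>y. y j) \<in> borel_measurable (lborelP ?J)" if "j \<in> ?J" for j
    using measurable_component_singleton[OF that, of "\<lambda>_. lborel :: real measure"] by simp
  have m: "(\<lambda>y. path_prod G i (g (y l0)) l bs y * (\<Prod>j\<in>insert l0 ?J. d j (y j))) \<in> borel_measurable ?N"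
    by (intro borel_measurable_times_ennreal borel_measurable_prod_ennreal path_prod_measurable G
        measurable_compose[OF comp d] comp measurable_compose[OF comp g]) auto
  have "(\<integral>\<^sup>+y. path_prod G i (g (y l0)) l bs y * (\<Prod>j\<in>insert l0 ?J. d j (y j)) \<partial>?N)
    = (\<integral>\<^sup>+v. \<integral>\<^sup>+x. path_prod G i (g ((x(l0 := v)) l0)) l bs (x(l0 := v)) * (\<Prod>j\<in>insert l0 ?J. d j ((x(l0 := v)) j))
        \<partial>lborelP ?J \<partial>lborel)"
    using l by (intro product_nn_integral_insert_rev m) auto
  also have "\<dots> = (\<integral>\<^sup>+v. path_int (\<lambda>_. d) G i l (g v) bs * d l0 v \<partial>lborel)"
  proof (rule nn_integral_cong)
    fix v
    have "path_prod G i (g v) l bs (x(l0 := v)) = path_prod G i (g v) l bs x" for x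
      using l by (intro path_prod_cong) auto
    moreover have "(\<Prod>j\<in>insert l0 ?J. d j ((x(l0 := v)) j)) = d l0 v * (\<Prod>j\<in>?J. d j (x j))" for x
      using l by (subst prod.insert) (auto intro!: arg_cong[where f="(*) _"] prod.cong)
    ultimately have "(\<integral>\<^sup>+x. path_prod G i (g ((x(l0 := v)) l0)) l bs (x(l0 := v)) * (\<Prod>j\<in>insert l0 ?J. d j ((x(l0 := v)) j))
        \<partial>lborelP ?J) = (\<integral>\<^sup>+x. d l0 v * (path_prod G i (g v) l bs x * (\<Prod>j\<in>?J. d j (x j))) \<partial>lborelP ?J)"
      by (simp add: ac_simps)
    also have "\<dots> = d l0 v * path_int (\<lambda>_. d) G i l (g v) bs"
      unfolding IH[symmetric]
      by (intro nn_integral_cmult borel_measurable_times_ennreal borel_measurable_prod_ennreal path_prod_measurable G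
          measurable_compose[OF comp' d] comp') auto
    finally show "(\<integral>\<^sup>+x. path_prod G i (g ((x(l0 := v)) l0)) l bs (x(l0 := v)) * (\<Prod>j\<in>insert l0 ?J. d j ((x(l0 := v)) j))
        \<partial>lborelP ?J) = path_int (\<lambda>_. d) G i l (g v) bs * d l0 v" by (simp add: ac_simps)
  qed
  finally show ?thesis .
qed

lemma nn_integral_path_prod:
  assumes G: "\<And>i. G i \<in> borel_measurable borel" and d: "\<And>j. d j \<in> borel_measurable borel"
  shows "(\<integral>\<^sup>+y. path_prod G i z l bs y * (\<Prod>j\<in>{l..<l + count_list bs True}. d j (y j))
        \<partial>PiM {l..<l + count_list bs True} (\<lambda>_. lborel)) = path_int (\<lambda>_. d) G i l z bs"
proof (induction bs arbitrary: i z l)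
  case Nil
  then show ?case by (simp add: PiM_empty)
next
  case (Cons b bs)
  let ?J = "{l..<l + count_list (b # bs) True}"
  have comp: "(\<lambda>y. y j) \<in> borel_measurable (lborelP ?J)" if "j \<in> ?J" for j
    using measurable_component_singleton[OF that, of "\<lambda>_. lborel :: real measure"] by simp
  have compd: "(\<lambda>y. d j (y j)) \<in> borel_measurable (lborelP ?J)" if "j \<in> ?J" for j
    using measurable_compose[OF comp[OF that] d] .
  define R where "R y = (if b then path_prod G (Suc i) (z + y l) (Suc l) bs y else path_prod G (Suc i) z l bs y)" for y
  have "R \<in> borel_measurable (lborelP ?J)"
    unfolding R_def
    by (cases b; simp only: if_True if_False;
        intro path_prod_measurable G comp borel_measurable_add borel_measurable_const) auto
  then have "(\<lambda>y. R y * (\<Prod>j\<in>?J. d j (y j))) \<in> borel_measurable (lborelP ?J)"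
    by (intro borel_measurable_times_ennreal borel_measurable_prod_ennreal compd)
  then have "(\<integral>\<^sup>+y. path_prod G i z l (b # bs) y * (\<Prod>j\<in>?J. d j (y j)) \<partial>lborelP ?J)
    = G i z * (\<integral>\<^sup>+y. R y * (\<Prod>j\<in>?J. d j (y j)) \<partial>lborelP ?J)"
    by (subst nn_integral_cmult[symmetric]) (auto simp: R_def ac_simps)
  also have "(\<integral>\<^sup>+y. R y * (\<Prod>j\<in>?J. d j (y j)) \<partial>lborelP ?J) =
    (if b then \<integral>\<^sup>+y. path_int (\<lambda>_. d) G (Suc i) (Suc l) (z + y) bs * d l y \<partial>lborel else path_int (\<lambda>_. d) G (Suc i) l z bs)"
  proof (cases b)
    case True
    then have J: "?J = insert l {Suc l..<Suc l + count_list bs True}" by auto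
    have "(\<integral>\<^sup>+y. R y * (\<Prod>j\<in>?J. d j (y j)) \<partial>lborelP ?J)
      = (\<integral>\<^sup>+v. path_int (\<lambda>_. d) G (Suc i) (Suc l) (z + v) bs * d l v \<partial>lborel)"
      unfolding J R_def if_P[OF True]
      by (rule nn_integral_path_prod_insert[where g="\<lambda>v. z + v", OF G d _ _ Cons.IH]) auto
    then show ?thesis using True by simp
  next
    case False
    then show ?thesis using Cons.IH by (simp add: R_def)
  qed
  finally show ?case by simp
qed

text \<open>Densities are compared only at the pairs of step and summand index that the pattern
  visits. This restriction is essential for random scales, as a jump time is known to lie in a grid
  step only for such pairs.\<close>

lemma path_int_mono:
  assumes "\<And>j y. j < length bs \<Longrightarrow> bs ! j \<Longrightarrow>
    d (i + j) (l + count_list (take j bs) True) y \<le> d' (i + j) (l + count_list (take j bs) True) y"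
  shows "path_int d G i l z bs \<le> path_int d' G i l z bs"
  using assms
proof (induction bs arbitrary: i z l)
  case (Cons b bs)
  show ?case
  proof (cases b)
    case True
    have "path_int d G (Suc i) (Suc l) x bs \<le> path_int d' G (Suc i) (Suc l) x bs" for x
      using Cons.prems[of "Suc _"] True by (intro Cons.IH) auto
    moreover have "d i l y \<le> d' i l y" for y using Cons.prems[of 0] True by simp
    ultimately show ?thesis using True by (auto intro!: mult_left_mono nn_integral_mono mult_mono)
  next
    case False
    have "path_int d G (Suc i) l x bs \<le> path_int d' G (Suc i) l x bs" for x
      using Cons.prems[of "Suc _"] False by (intro Cons.IH) auto
    then show ?thesis using False by (auto intro!: mult_left_mono)
  qed
qed simp

lemma path_int_measurable:
  assumes [measurable]: "\<And>i. G i \<in> borel_measurable borel" "\<And>i l. d i l \<in> borel_measurable borel"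
  shows "(\<lambda>z. path_int d G i l z bs) \<in> borel_measurable borel"
proof (induction bs arbitrary: i l)
  case (Cons b bs)
  note [measurable] = Cons[of "Suc i"]
  show ?case by (cases b) simp_all
qed simp

text \<open>Distributivity: expanding the choice between staying and jumping in every step of the
  chain gives one term per pattern. The density may depend on the step but not on the summand index,
  since a chain does not count its jumps.\<close>

lemma sum_path_int:
  assumes G: "\<And>i. G i \<in> borel_measurable borel" and k: "\<And>i. k i \<in> borel_measurable borel"
  shows "(\<Sum>bs | length bs = m. (\<Prod>j<m. w (bs ! j)) * path_int (\<lambda>i l. k i) G i l z bs)
    = chain (w False) (\<lambda>i y. w True * k i y) G i m z"
proof (induction m arbitrary: i l z)
  case 0
  have "{bs :: bool list. length bs = 0} = {[]}" by auto
  then show ?case by simp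
next
  case (Suc m)
  let ?I = "path_int (\<lambda>i l. k i) G (Suc i)" and ?W = "\<lambda>bs. \<Prod>j<m. w (bs ! j)"
  note [measurable] = G k path_int_measurable[of G "\<lambda>i l. k i", OF G k]
  have "(\<Sum>bs | length bs = Suc m. (\<Prod>j<Suc m. w (bs ! j)) * path_int (\<lambda>i l. k i) G i l z bs)
    = (\<Sum>bs | length bs = m. G i z * (w True * (?W bs * (\<integral>\<^sup>+y. ?I (Suc l) (z + y) bs * k i y \<partial>lborel)))
        + G i z * (w False * (?W bs * ?I l z bs)))"
    unfolding sum_bool_lists_Suc
    by (intro sum.cong) (auto simp: prod.lessThan_Suc_shift ac_simps simp del: prod.lessThan_Suc)
  also have "\<dots> = G i z * (w True * (\<Sum>bs | length bs = m. ?W bs * (\<integral>\<^sup>+y. ?I (Suc l) (z + y) bs * k i y \<partial>lborel))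
     + w False * (\<Sum>bs | length bs = m. ?W bs * ?I l z bs))"
    by (simp add: sum.distrib sum_distrib_left distrib_left)
  also have "(\<Sum>bs | length bs = m. ?W bs * (\<integral>\<^sup>+y. ?I (Suc l) (z + y) bs * k i y \<partial>lborel))
    = (\<integral>\<^sup>+y. (\<Sum>bs | length bs = m. ?W bs * ?I (Suc l) (z + y) bs) * k i y \<partial>lborel)"
    unfolding sum_distrib_right
    by (subst nn_integral_sum) (auto simp: mult.assoc nn_integral_cmult)
  also have "w True * \<dots>
    = (\<integral>\<^sup>+y. chain (w False) (\<lambda>i y. w True * k i y) G (Suc i) m (z + y) * (w True * k i y) \<partial>lborel)"
    unfolding Suc by (subst nn_integral_cmult[symmetric]) (auto simp: ac_simps)
  finally show ?case unfolding Suc by (simp add: add.commute)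
qed

lemma sum_pattern_weights:
  fixes w :: "bool \<Rightarrow> 'a::comm_semiring_1"
  shows "(\<Sum>bs | length bs = m. \<Prod>j<m. w (bs ! j)) = (w True + w False) ^ m"
proof (induction m)
  case 0
  have "{bs :: bool list. length bs = 0} = {[]}" by auto
  then show ?case by simp
next
  case (Suc m)
  have "(\<Sum>bs | length bs = Suc m. \<Prod>j<Suc m. w (bs ! j)) = (\<Sum>bs | length bs = m. (w True + w False) * (\<Prod>j<m. w (bs ! j)))"
    unfolding sum_bool_lists_Suc
    by (intro sum.cong) (auto simp: prod.lessThan_Suc_shift distrib_right simp del: prod.lessThan_Suc)
  then show ?case using Suc by (simp add: sum_distrib_left[symmetric])
qed

text \<open>That is, \<open>h \<le> sinh h\<close>: the density \<open>2h exp (-2h) exp h Lap\<close>, which bounds a single jump of \<open>Z\<close> from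
  above, stays below the kernel of the exact chain.\<close>

lemma two_mult_le_exp_diff: "0 \<le> h \<Longrightarrow> 2 * h * exp (- h) \<le> 1 - exp (- 2 * h)" for h :: real
proof -
  assume h: "0 \<le> h"
  \<comment> \<open>The quadratic Taylor polynomial of exp h. It satisfies q - 1 / q \<ge> 2 h
    because q^2 - 2 h q - 1 = h^4 / 4, and t - 1 / t is increasing.\<close>
  define q where "q = 1 + h + h\<^sup>2 / 2"
  have q: "q \<le> exp h" unfolding q_def using h by (rule exp_lower_Taylor_quadratic)
  have q1: "1 \<le> q" using h by (simp add: q_def)
  have "q * q - 2 * h * q - 1 = (h * h) * (h * h) / 4" by (simp add: q_def power2_eq_square field_simps)
  then have *: "2 * h * q + 1 \<le> q * q" by (smt (verit) zero_le_square divide_nonneg_nonneg)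
  have "2 * h \<le> q - 1 / q" using * q1 by (simp add: field_simps)
  also have "\<dots> \<le> exp h - 1 / exp h" using q q1 by (intro diff_mono divide_left_mono) auto
  finally have "2 * h * exp (- h) \<le> (exp h - exp (- h)) * exp (- h)"
    by (intro mult_right_mono) (auto simp: exp_minus divide_inverse)
  then show ?thesis by (simp add: left_diff_distrib flip: exp_add)
qed

text \<open>The mass per step of the chain that bounds \<open>Z\<close> from below.\<close>

definition pattern_mass :: "real \<Rightarrow> real" where
  "pattern_mass h = exp (- 2 * h) + 2 * h * exp (- 3 * h)"

lemma two_mult_exp_le: "2 * h * exp (- 2 * h) \<le> 1 - exp (- 2 * h)" for h :: real
proof -
  have "(1 + 2 * h) * exp (- 2 * h) \<le> exp (2 * h) * exp (- 2 * h)"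
    using exp_ge_add_one_self[of "2 * h"] by (intro mult_right_mono) auto
  then show ?thesis by (simp add: distrib_right flip: exp_add)
qed

text \<open>The sum in the second bound is the probability of at most one jump in a step. The
  additional factor exp (- h) in \<open>pattern_mass\<close> is the loss from comparing the scale of
  a jump with the left end point of its step.\<close>

lemma pattern_mass_bounds:
  assumes "0 < h" shows "0 \<le> pattern_mass h" "pattern_mass h \<le> exp (- 2 * h) + 2 * h * exp (- 2 * h)"
    "pattern_mass h \<le> 1"
proof -
  show "0 \<le> pattern_mass h" using assms by (simp add: pattern_mass_def)
  show le: "pattern_mass h \<le> exp (- 2 * h) + 2 * h * exp (- 2 * h)"
    using assms by (simp add: pattern_mass_def)
  show "pattern_mass h \<le> 1" using le two_mult_exp_le[of h] by linarith
qed

text \<open>The exact kernel dominates the lower one, as \<open>lapd_lower\<close> and 2 h exp (- 2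
  h) \<le> 1 - exp (- 2 h) show. The difference of the two is the cut-off part \<open>r\<close> of
  \<open>chain_le_add\<close>, with mass 1 - \<open>pattern_mass h\<close>.\<close>

lemma laplace_chain_le_lower_chain:
  assumes "0 < \<eta>" "0 < h" and G: "\<And>i. G i \<in> borel_measurable borel" "\<And>i z. G i z \<le> 1"
  shows "laplace_chain \<eta> h G i m z
    \<le> chain (ennreal (exp (- 2 * h))) (\<lambda>i y. ennreal (2 * h * exp (- 2 * h)) * (ennreal (exp (- h)) * lapd (grid \<eta> h i) y)) G i m z
      + ennreal (1 - pattern_mass h ^ m)"
proof -
  let ?k = "\<lambda>i y. ennreal (2 * h * exp (- 2 * h)) * (ennreal (exp (- h)) * lapd (grid \<eta> h i) y)"
  define r where "r i y = laplace_kernel \<eta> h i y - ?k i y" for i y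
  have gp: "0 < grid \<eta> h i" for i using assms(1) by (rule grid_pos)
  have k_le: "?k i y \<le> laplace_kernel \<eta> h i y" for i y
  proof -
    have "grid \<eta> h i / grid \<eta> h (Suc i) = exp (- h)"
      using gp[of i] by (simp add: grid_Suc exp_minus divide_inverse)
    then have "ennreal (exp (- h)) * lapd (grid \<eta> h i) y \<le> lapd (grid \<eta> h (Suc i)) y"
      using lapd_lower[OF gp, of i "grid \<eta> h (Suc i)" "grid \<eta> h (Suc i)" y] grid_mono[of \<eta> h i "Suc i"] assms
      by simp
    then show ?thesis
      unfolding laplace_kernel_def using two_mult_exp_le[of h] by (intro mult_mono ennreal_leI) auto
  qed
  have mk: "(\<integral>\<^sup>+y. ?k i y \<partial>lborel) = ennreal (2 * h * exp (- 3 * h))" for i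
  proof -
    have "(\<integral>\<^sup>+y. ?k i y \<partial>lborel) = ennreal (2 * h * exp (- 2 * h)) * ennreal (exp (- h))"
      by (simp add: nn_integral_cmult nn_integral_lapd[OF gp])
    also have "\<dots> = ennreal (2 * h * (exp (- 2 * h) * exp (- h)))"
      using assms by (simp flip: ennreal_mult add: mult.assoc)
    finally show ?thesis by (simp flip: exp_add)
  qed
  have eq: "laplace_kernel \<eta> h = (\<lambda>i y. ?k i y + r i y)"
    unfolding r_def fun_eq_iff add.commute[of "?k _ _"] using diff_add_cancel_ennreal[OF k_le] by simp
  show ?thesis unfolding eq
  proof (rule chain_le_add)
    fix i
    show "ennreal (exp (- 2 * h)) + (\<integral>\<^sup>+y. ?k i y \<partial>lborel) = ennreal (pattern_mass h)"
      unfolding mk pattern_mass_def using assms by (subst ennreal_plus[symmetric]) auto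
    have "(\<integral>\<^sup>+y. r i y \<partial>lborel) = (\<integral>\<^sup>+y. laplace_kernel \<eta> h i y \<partial>lborel) - (\<integral>\<^sup>+y. ?k i y \<partial>lborel)"
      unfolding r_def by (rule nn_integral_diff) (use k_le mk in auto)
    also have "(\<integral>\<^sup>+y. laplace_kernel \<eta> h i y \<partial>lborel) = ennreal (1 - exp (- 2 * h))"
      unfolding laplace_kernel_def by (simp add: nn_integral_cmult nn_integral_lapd[OF gp])
    also have "\<dots> - (\<integral>\<^sup>+y. ?k i y \<partial>lborel) = ennreal (1 - pattern_mass h)"
      unfolding mk using assms by (subst ennreal_minus) (auto simp: pattern_mass_def algebra_simps)
    finally show "(\<integral>\<^sup>+y. r i y \<partial>lborel) = ennreal (1 - pattern_mass h)" .
    show "r i \<in> borel_measurable borel" unfolding r_def by measurable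
  qed (use assms pattern_mass_bounds in auto)
qed

section \<open>The compound process along the grid\<close>

context compound_laplace
begin

abbreviation compound :: "real \<Rightarrow> 'w \<Rightarrow> real" where
  "compound t \<omega> \<equiv> (\<Sum>n=0..P t \<omega>. Y n \<omega>)"

lemma compound_measurable [measurable]:
  assumes "\<eta> \<le> t" shows "compound t \<in> borel_measurable M"
proof -
  note [measurable] = P_measurable[OF assms]
  show ?thesis
    by (rule measurable_compose_countable[where f="\<lambda>n \<omega>. \<Sum>n=0..n. Y n \<omega>" and g="P t"]) measurable
qed

definition pattern :: "real \<Rightarrow> bool list \<Rightarrow> 'w set" where
  "pattern h bs = {\<omega>\<in>space M. \<forall>j\<le>length bs. P (grid \<eta> h j) \<omega> = count_list (take j bs) True}"

lemma pattern_event_measurable [measurable]: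
  assumes "0 < h" shows "pattern h bs \<in> sets M"
proof -
  have [measurable]: "P (grid \<eta> h j) \<in> measurable M (count_space UNIV)" for j
    using grid_ge[OF eta_pos, of h j] assms by (intro P_measurable) auto
  show ?thesis unfolding pattern_def by measurable
qed

text \<open>Prescribing the counts at the grid points amounts to prescribing the increments over the
  steps, which are independent and Poisson with mean 2 h. Increments are differences of naturals, so
  monotonicity of the paths is used to recover the counts from them.\<close>

lemma prob_pattern_event:
  assumes "0 < h"
  shows "prob (pattern h bs) = (\<Prod>j<length bs. if bs ! j then 2 * h * exp (- 2 * h) else exp (- 2 * h))"
proof (cases "bs = []")
  case True
  then have "pattern h bs = space M" by (auto simp: pattern_def)
  then show ?thesis using True by (simp add: prob_space)
next
  case False
  define X where "X j \<omega> = P (grid \<eta> h (Suc j)) \<omega> - P (grid \<eta> h j) \<omega>" for j \<omega>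
  have ge: "\<eta> \<le> grid \<eta> h j" for j using grid_ge[OF eta_pos, of h j] assms by simp
  have lt: "grid \<eta> h j < grid \<eta> h (Suc j)" for j
    using assms grid_pos[OF eta_pos, of h j] by (simp add: grid_Suc)
  have mono: "P (grid \<eta> h j) \<omega> \<le> P (grid \<eta> h (Suc j)) \<omega>" if "\<omega> \<in> space M" for j \<omega>
    using that ge lt by (intro P_mono) (auto simp: less_imp_le)
  have indep: "indep_vars (\<lambda>_. count_space UNIV) X {..<length bs}"
    using poisson ge lt unfolding poisson_process_def X_def by (auto simp: less_imp_le)
  have "pattern h bs = (\<Inter>j\<in>{..<length bs}. X j -` {of_bool (bs ! j)} \<inter> space M)"
  proof (intro set_eqI iffI)
    fix \<omega> assume *: "\<omega> \<in> pattern h bs"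
    show "\<omega> \<in> (\<Inter>j\<in>{..<length bs}. X j -` {of_bool (bs ! j)} \<inter> space M)"
    proof (intro INT_I)
      fix j assume "j \<in> {..<length bs}"
      then show "\<omega> \<in> X j -` {of_bool (bs ! j)} \<inter> space M"
        using * by (auto simp: pattern_def X_def count_list_take_Suc)
    qed
  next
    fix \<omega> assume asm: "\<omega> \<in> (\<Inter>j\<in>{..<length bs}. X j -` {of_bool (bs ! j)} \<inter> space M)"
    have mem: "\<omega> \<in> X j -` {of_bool (bs ! j)} \<inter> space M" if "j < length bs" for j
      using that by (intro INT_D[OF asm]) simp
    have sp: "\<omega> \<in> space M" using mem[of 0] False by simp
    have X: "X j \<omega> = of_bool (bs ! j)" if "j < length bs" for j using mem[OF that] by simp
    have "j \<le> length bs \<Longrightarrow> P (grid \<eta> h j) \<omega> = count_list (take j bs) True" for j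
    proof (induction j)
      case 0 then show ?case using sp by simp
    next
      case (Suc j)
      then show ?case using X[of j] mono[OF sp, of j] by (simp add: X_def count_list_take_Suc)
    qed
    then show "\<omega> \<in> pattern h bs" using sp by (simp add: pattern_def)
  qed
  also have "prob \<dots> = (\<Prod>j<length bs. prob (X j -` {of_bool (bs ! j)} \<inter> space M))"
    using False by (intro indep_varsD[OF indep]) auto
  also have "\<dots> = (\<Prod>j<length bs. if bs ! j then 2 * h * exp (- 2 * h) else exp (- 2 * h))"
  proof (rule prod.cong)
    fix j
    have "prob (X j -` {of_bool (bs ! j)} \<inter> space M) = prob {\<omega>\<in>space M. P (grid \<eta> h (Suc j)) \<omega> - P (grid \<eta> h j) \<omega> \<in> {of_bool (bs ! j)}}"
      by (auto intro!: arg_cong[where f=prob] simp: X_def)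
    also have "\<dots> = measure_pmf.prob (poisson_pmf (2 * h)) {of_bool (bs ! j)}"
      using grid_pos[OF eta_pos, of h j] by (subst prob_P_increment[OF ge lt]) (simp add: grid_Suc)
    also have "\<dots> = (if bs ! j then 2 * h * exp (- 2 * h) else exp (- 2 * h))"
      using assms by (simp add: measure_pmf_single)
    finally show "prob (X j -` {of_bool (bs ! j)} \<inter> space M) = (if bs ! j then 2 * h * exp (- 2 * h) else exp (- 2 * h))" .
  qed simp
  finally show ?thesis .
qed

text \<open>The summand \<open>Y 0\<close> is present from the beginning and has scale T_0 = \<eta>;
  it is the starting point of the path, and the next summand has index 1.\<close>

abbreviation "start_int d G bs \<equiv> \<integral>\<^sup>+z. path_int d G 0 1 z bs * lapd \<eta> z \<partial>lborel"
abbreviation "jump_density \<omega> \<equiv> \<lambda>i l. lapd (T l \<omega>)"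

lemma compound_prod_eq_path_prod:
  assumes "\<And>j. j \<le> length bs \<Longrightarrow> P (grid \<eta> h (i + j)) \<omega> = c + count_list (take j bs) True"
  shows "(\<Prod>j\<le>length bs. G (i + j) (compound (grid \<eta> h (i + j)) \<omega>))
    = path_prod G i (\<Sum>n=0..c. Y n \<omega>) (Suc c) bs (\<lambda>j. Y j \<omega>)"
  using assms
proof (induction bs arbitrary: i c)
  case (Cons b bs)
  have P0: "P (grid \<eta> h i) \<omega> = c" using Cons.prems[of 0] by simp
  have "(\<Prod>j\<le>length (b # bs). G (i + j) (compound (grid \<eta> h (i + j)) \<omega>))
    = G i (\<Sum>n=0..c. Y n \<omega>) * (\<Prod>j\<le>length bs. G (Suc i + j) (compound (grid \<eta> h (Suc i + j)) \<omega>))"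
    using P0 by (simp add: prod.atMost_Suc_shift del: prod.atMost_Suc)
  also have "(\<Prod>j\<le>length bs. G (Suc i + j) (compound (grid \<eta> h (Suc i + j)) \<omega>))
    = path_prod G (Suc i) (\<Sum>n=0..c + of_bool b. Y n \<omega>) (Suc (c + of_bool b)) bs (\<lambda>j. Y j \<omega>)"
    using Cons.prems[of "Suc _"] by (intro Cons.IH) auto
  finally show ?case by simp
qed simp

text \<open>On the pattern event the product is a function of finitely many summands, and the event
  itself is, up to a null set, a condition on the jump times. Conditioning on \<open>jumpF\<close>
  then integrates the summands out with scales frozen at the jump times.\<close>

lemma nn_integral_pattern_event:
  assumes h: "0 < h" and G: "\<And>i. G i \<in> borel_measurable borel"
  shows "(\<integral>\<^sup>+\<omega>\<in>pattern h bs. (\<Prod>j\<le>length bs. G j (compound (grid \<eta> h j) \<omega>)) \<partial>M)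
    = (\<integral>\<^sup>+\<omega>\<in>pattern h bs. start_int (jump_density \<omega>) G bs \<partial>M)"
proof -
  interpret product_sigma_finite "\<lambda>_::nat. lborel :: real measure" by standard
  let ?J = "insert 0 {1..<1 + count_list bs True}"
  define c where "c j = count_list (take j bs) True" for j
  \<comment> \<open>The count at a grid point equals \<open>c j\<close> iff \<open>T (c j)\<close>
    is at most that point and the next jump time is beyond it. In this form the event lies in
    \<open>jumpF\<close>; the agreement is only almost sure because of paths with finitely many
    jumps.\<close>
  define D where "D = {\<omega>\<in>space M. \<forall>j\<in>{..length bs}. T (c j) \<omega> \<le> grid \<eta> h j \<and> \<not> T (Suc (c j)) \<omega> \<le> grid \<eta> h j}"
  have D: "D \<in> sets jumpF"
  proof -
    note [measurable] = jump_algebra_measurable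
    have "{\<omega>\<in>space jumpF. \<forall>j\<in>{..length bs}. T (c j) \<omega> \<le> grid \<eta> h j \<and> \<not> T (Suc (c j)) \<omega> \<le> grid \<eta> h j} \<in> sets jumpF"
      by measurable
    then show ?thesis by (simp add: D_def)
  qed
  have D_iff: "AE \<omega> in M. indicator D \<omega> = (indicator (pattern h bs) \<omega> :: ennreal)"
    using AE_P_unbounded
  proof (eventually_elim)
    case (elim \<omega>)
    show ?case
    proof (cases "\<omega> \<in> space M")
      case True
      have iff: "T n \<omega> \<le> grid \<eta> h j \<longleftrightarrow> n \<le> P (grid \<eta> h j) \<omega>" for n j
        using True elim grid_ge[OF eta_pos, of h j] h by (intro jump_time_le_iff) auto
      have "T (c j) \<omega> \<le> grid \<eta> h j \<and> \<not> T (Suc (c j)) \<omega> \<le> grid \<eta> h j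
          \<longleftrightarrow> P (grid \<eta> h j) \<omega> = c j" for j
        unfolding iff by arith
      then have "\<omega> \<in> D \<longleftrightarrow> \<omega> \<in> pattern h bs"
        using True by (simp add: D_def pattern_def c_def Ball_def)
      then show ?thesis by (simp add: indicator_def)
    qed (auto simp: D_def pattern_def)
  qed
  define H where "H p = indicator D (fst p) * path_prod G 0 (snd p 0) 1 bs (snd p)" for p :: "'w \<times> (nat \<Rightarrow> real)"
  have Hm: "H \<in> borel_measurable (jumpF \<Otimes>\<^sub>M PiM ?J (\<lambda>_. borel))"
    unfolding H_def
  proof (intro borel_measurable_times_ennreal path_prod_measurable G)
    have comp: "(\<lambda>p. snd p j) \<in> borel_measurable (jumpF \<Otimes>\<^sub>M borelP ?J)" if "j \<in> ?J" for j
      using that by (intro measurable_compose[OF measurable_snd measurable_component_singleton])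
    show "(\<lambda>p. snd p 0) \<in> borel_measurable (jumpF \<Otimes>\<^sub>M borelP ?J)" by (rule comp) simp
    show "j \<in> {1..<1 + count_list bs True} \<Longrightarrow> (\<lambda>p. snd p j) \<in> borel_measurable (jumpF \<Otimes>\<^sub>M borelP ?J)" for j
      by (rule comp) simp
    show "(\<lambda>p. indicator D (fst p)) \<in> borel_measurable (jumpF \<Otimes>\<^sub>M borelP ?J)"
      by (rule measurable_compose[OF measurable_fst borel_measurable_indicator[OF D]])
  qed
  have "(\<integral>\<^sup>+\<omega>\<in>pattern h bs. (\<Prod>j\<le>length bs. G j (compound (grid \<eta> h j) \<omega>)) \<partial>M)
    = (\<integral>\<^sup>+\<omega>. H (\<omega>, \<lambda>j\<in>?J. Y j \<omega>) \<partial>M)"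
    using D_iff
  proof (intro nn_integral_cong_AE, eventually_elim)
    case (elim \<omega>)
    show ?case
    proof (cases "\<omega> \<in> pattern h bs")
      case True
      have "(\<Prod>j\<le>length bs. G (0 + j) (compound (grid \<eta> h (0 + j)) \<omega>))
        = path_prod G 0 (\<Sum>n=0..0. Y n \<omega>) (Suc 0) bs (\<lambda>j. Y j \<omega>)"
        using True by (intro compound_prod_eq_path_prod) (auto simp: pattern_def)
      also have "\<dots> = path_prod G 0 (Y 0 \<omega>) 1 bs (\<lambda>j\<in>?J. Y j \<omega>)"
        by (auto intro!: path_prod_cong)
      finally show ?thesis using elim by (simp add: H_def mult.commute)
    next
      case False
      then show ?thesis using elim by (simp add: H_def)
    qed
  qed
  also have "\<dots> = (\<integral>\<^sup>+\<omega>. \<integral>\<^sup>+y. H (\<omega>, y) * (\<Prod>j\<in>?J. lapd (T j \<omega>) (y j)) \<partial>lborelP ?J \<partial>M)"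
    by (intro nn_integral_cond_indep_laplace[OF jump_subalgebra cond_indep _ _ _ Hm]) (auto simp del: insert_iff)
  also have "\<dots> = (\<integral>\<^sup>+\<omega>\<in>pattern h bs. start_int (jump_density \<omega>) G bs \<partial>M)"
    using D_iff
  proof (intro nn_integral_cong_AE, eventually_elim)
    case (elim \<omega>)
    let ?d = "\<lambda>l. lapd (T l \<omega>)"
    have d: "?d l \<in> borel_measurable borel" for l by measurable
    have comp: "(\<lambda>y. y j) \<in> borel_measurable (lborelP ?J)" if "j \<in> ?J" for j
      using measurable_component_singleton[OF that, of "\<lambda>_. lborel :: real measure"] by simp
    have "(\<integral>\<^sup>+y. H (\<omega>, y) * (\<Prod>j\<in>?J. ?d j (y j)) \<partial>lborelP ?J)
      = (\<integral>\<^sup>+y. indicator D \<omega> * (path_prod G 0 (y 0) 1 bs y * (\<Prod>j\<in>?J. ?d j (y j))) \<partial>lborelP ?J)"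
      by (simp add: H_def ac_simps)
    also have "\<dots> = indicator D \<omega> * (\<integral>\<^sup>+y. path_prod G 0 (y 0) 1 bs y * (\<Prod>j\<in>?J. ?d j (y j)) \<partial>lborelP ?J)"
      by (intro nn_integral_cmult borel_measurable_times_ennreal borel_measurable_prod_ennreal path_prod_measurable G
          measurable_compose[OF comp d] comp insertI1) simp_all
    also have "(\<integral>\<^sup>+y. path_prod G 0 (y 0) 1 bs y * (\<Prod>j\<in>?J. ?d j (y j)) \<partial>lborelP ?J)
      = (\<integral>\<^sup>+v. path_int (\<lambda>_. ?d) G 0 1 v bs * ?d 0 v \<partial>lborel)"
      by (rule nn_integral_path_prod_insert[where g="\<lambda>v. v", OF G d _ _ nn_integral_path_prod[OF G d]]) auto
    finally show ?case using elim by (simp add: jump_time_def ac_simps)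
  qed
  finally show ?thesis .
qed

lemma jump_time_in_step:
  assumes "0 < h" "\<omega> \<in> pattern h bs" "\<forall>n. \<exists>t\<ge>\<eta>. n \<le> P t \<omega>" "j < length bs" "bs ! j"
  shows "T (1 + count_list (take j bs) True) \<omega> \<in> {grid \<eta> h j..grid \<eta> h (Suc j)}"
proof -
  have sp: "\<omega> \<in> space M" using assms(2) by (simp add: pattern_def)
  have iff: "T n \<omega> \<le> grid \<eta> h j \<longleftrightarrow> n \<le> P (grid \<eta> h j) \<omega>" for n j
    using sp assms grid_ge[OF eta_pos, of h j] by (intro jump_time_le_iff) auto
  have "P (grid \<eta> h j) \<omega> = count_list (take j bs) True"
    "P (grid \<eta> h (Suc j)) \<omega> = count_list (take j bs) True + 1"
    using assms count_list_take_Suc[OF assms(4)] by (auto simp: pattern_def simp del: take_Suc)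
  then show ?thesis using iff[of "1 + count_list (take j bs) True"] by (auto intro: less_imp_le simp: not_le[symmetric])
qed

end

context compound_laplace
begin

lemma disjoint_pattern_events: "disjoint_family_on (pattern h) {bs. length bs = m}"
proof -
  have "bs = bs'" if *: "\<omega> \<in> pattern h bs" "\<omega> \<in> pattern h bs'" "length bs = m" "length bs' = m" for \<omega> bs bs'
  proof (rule nth_equalityI)
    fix j assume j: "j < length bs"
    have "count_list (take i bs) True = P (grid \<eta> h i) \<omega>" "count_list (take i bs') True = P (grid \<eta> h i) \<omega>"
      if "i \<le> length bs" for i
      using * that by (simp_all add: pattern_def)
    from this[of j] this[of "Suc j"] j show "bs ! j = bs' ! j"
      using count_list_take_Suc[of j bs] count_list_take_Suc[of j bs'] *(3,4)
      by (simp add: of_bool_def split: if_splits)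
  qed (use * in simp)
  then show ?thesis unfolding disjoint_family_on_def by blast
qed

context
  fixes h :: real and G :: "nat \<Rightarrow> real \<Rightarrow> ennreal"
  assumes h: "0 < h" and G [measurable]: "\<And>i. G i \<in> borel_measurable borel"
    and G_le: "\<And>i z. G i z \<le> 1"
begin

lemma sum_pattern_events:
  assumes [measurable]: "X \<in> borel_measurable M"
  shows "(\<integral>\<^sup>+\<omega>. X \<omega> \<partial>M) = (\<Sum>bs | length bs = m. \<integral>\<^sup>+\<omega>\<in>pattern h bs. X \<omega> \<partial>M)
    + (\<integral>\<^sup>+\<omega>\<in>space M - (\<Union>bs\<in>{bs. length bs = m}. pattern h bs). X \<omega> \<partial>M)"
proof -
  note [measurable] = pattern_event_measurable[OF h]
  let ?U = "\<Union>bs\<in>{bs. length bs = m}. pattern h bs"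
  have U [measurable]: "?U \<in> sets M" by (intro sets.finite_UN finite_bool_lists) measurable
  have "(\<integral>\<^sup>+\<omega>. X \<omega> \<partial>M) = (\<integral>\<^sup>+\<omega>. X \<omega> * indicator ?U \<omega> + X \<omega> * indicator (space M - ?U) \<omega> \<partial>M)"
    by (intro nn_integral_cong) (auto split: split_indicator)
  also have "\<dots> = (\<integral>\<^sup>+\<omega>\<in>?U. X \<omega> \<partial>M) + (\<integral>\<^sup>+\<omega>\<in>space M - ?U. X \<omega> \<partial>M)"
    by (rule nn_integral_add) measurable
  also have "(\<integral>\<^sup>+\<omega>\<in>?U. X \<omega> \<partial>M) = (\<integral>\<^sup>+\<omega>. (\<Sum>bs | length bs = m. X \<omega> * indicator (pattern h bs) \<omega>) \<partial>M)"
    unfolding indicator_UN_disjoint[OF finite_bool_lists disjoint_pattern_events] sum_distrib_left ..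
  also have "\<dots> = (\<Sum>bs | length bs = m. \<integral>\<^sup>+\<omega>\<in>pattern h bs. X \<omega> \<partial>M)"
    by (rule nn_integral_sum) measurable
  finally show ?thesis .
qed

text \<open>The complement is the event that some step has at least two jumps. Its probability is
  bounded through the smaller \<open>pattern_mass\<close>, so that the same error term serves for
  both directions of the comparison.\<close>

lemma emeasure_no_pattern:
  "emeasure M (space M - (\<Union>bs\<in>{bs. length bs = m}. pattern h bs)) \<le> ennreal (1 - pattern_mass h ^ m)"
proof -
  note [measurable] = pattern_event_measurable[OF h]
  let ?U = "\<Union>bs\<in>{bs. length bs = m}. pattern h bs"
  have U [measurable]: "?U \<in> sets M" by (intro sets.finite_UN finite_bool_lists) measurable
  have "prob ?U = (\<Sum>bs | length bs = m. prob (pattern h bs))"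
    by (intro finite_measure_finite_Union finite_bool_lists disjoint_pattern_events) auto
  also have "\<dots> = (\<Sum>bs | length bs = m. \<Prod>j<m. if bs ! j then 2 * h * exp (- 2 * h) else exp (- 2 * h))"
    by (intro sum.cong) (auto simp: prob_pattern_event[OF h])
  also have "\<dots> = (2 * h * exp (- 2 * h) + exp (- 2 * h)) ^ m"
    by (subst sum_pattern_weights[where w="\<lambda>b. if b then 2 * h * exp (- 2 * h) else exp (- 2 * h)"]) simp
  also have "\<dots> \<ge> pattern_mass h ^ m"
    using pattern_mass_bounds[OF h] by (intro power_mono) auto
  finally have "prob (space M - ?U) \<le> 1 - pattern_mass h ^ m" by (subst prob_compl) auto
  then show ?thesis unfolding emeasure_eq_measure by (rule ennreal_leI)
qed

lemma compound_grid_measurable [measurable]: "compound (grid \<eta> h j) \<in> borel_measurable M"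
  using grid_ge[OF eta_pos, of h j] h by (intro compound_measurable) auto

text \<open>For a deterministic kernel the path integral is constant on each pattern event, and the
  probability of the event is a product of weights over the steps; \<open>sum_path_int\<close> then
  assembles the chain.\<close>

lemma sum_pattern_chain:
  assumes k: "\<And>i. k i \<in> borel_measurable borel"
  shows "(\<Sum>bs | length bs = m. \<integral>\<^sup>+\<omega>\<in>pattern h bs. start_int (\<lambda>i l. k i) G bs \<partial>M)
    = (\<integral>\<^sup>+z. lapd \<eta> z * chain (ennreal (exp (- 2 * h))) (\<lambda>i y. ennreal (2 * h * exp (- 2 * h)) * k i y) G 0 m z \<partial>lborel)"
proof -
  note [measurable] = path_int_measurable[of G "\<lambda>i l. k i", OF G k]
  define w where "w b = ennreal (if b then 2 * h * exp (- 2 * h) else exp (- 2 * h))" for b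
  let ?I = "\<lambda>z. path_int (\<lambda>i l. k i) G 0 1 z"
  have "(\<integral>\<^sup>+\<omega>\<in>pattern h bs. start_int (\<lambda>i l. k i) G bs \<partial>M)
    = (\<integral>\<^sup>+z. (\<Prod>j<m. w (bs ! j)) * ?I z bs * lapd \<eta> z \<partial>lborel)" if m: "length bs = m" for bs
  proof -
    have "emeasure M (pattern h bs) = (\<Prod>j<m. w (bs ! j))"
      unfolding w_def using h m by (subst prod_ennreal) (auto simp: emeasure_eq_measure prob_pattern_event)
    then show ?thesis
      by (subst nn_integral_cmult_indicator)
        (simp_all add: pattern_event_measurable h nn_integral_cmult mult.assoc, simp add: mult.commute)
  qed
  then have "(\<Sum>bs | length bs = m. \<integral>\<^sup>+\<omega>\<in>pattern h bs. start_int (\<lambda>i l. k i) G bs \<partial>M)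
    = (\<integral>\<^sup>+z. lapd \<eta> z * (\<Sum>bs | length bs = m. (\<Prod>j<m. w (bs ! j)) * ?I z bs) \<partial>lborel)"
    by (simp add: sum_distrib_left ac_simps flip: nn_integral_sum)
  then show ?thesis unfolding sum_path_int[where w=w, OF G k] by (simp add: w_def)
qed

text \<open>A summand that enters in step i has its jump time, hence its scale, inside that step. A
  bound on \<open>lapd t\<close> that is uniform over the scales in the step therefore transfers to
  the path integrals for almost every \<omega>.\<close>

lemma
  fixes m :: nat
  assumes k: "\<And>i. k i \<in> borel_measurable borel"
  defines "C \<equiv> \<integral>\<^sup>+z. lapd \<eta> z * chain (ennreal (exp (- 2 * h))) (\<lambda>i y. ennreal (2 * h * exp (- 2 * h)) * k i y) G 0 m z \<partial>lborel"
    and "R \<equiv> \<Sum>bs | length bs = m. \<integral>\<^sup>+\<omega>\<in>pattern h bs. (\<Prod>j\<le>m. G j (compound (grid \<eta> h j) \<omega>)) \<partial>M"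
  shows patterns_le_chain: "(\<And>i t y. grid \<eta> h i \<le> t \<Longrightarrow> t \<le> grid \<eta> h (Suc i) \<Longrightarrow> lapd t y \<le> k i y) \<Longrightarrow> R \<le> C"
    and chain_le_patterns: "(\<And>i t y. grid \<eta> h i \<le> t \<Longrightarrow> t \<le> grid \<eta> h (Suc i) \<Longrightarrow> k i y \<le> lapd t y) \<Longrightarrow> C \<le> R"
proof -
  have R: "R = (\<Sum>bs | length bs = m. \<integral>\<^sup>+\<omega>\<in>pattern h bs. start_int (jump_density \<omega>) G bs \<partial>M)"
    unfolding R_def
  proof (intro sum.cong refl)
    fix bs :: "bool list" assume "bs \<in> {bs. length bs = m}"
    then show "(\<integral>\<^sup>+\<omega>\<in>pattern h bs. (\<Prod>j\<le>m. G j (compound (grid \<eta> h j) \<omega>)) \<partial>M)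
      = (\<integral>\<^sup>+\<omega>\<in>pattern h bs. start_int (jump_density \<omega>) G bs \<partial>M)"
      using nn_integral_pattern_event[where h=h and G=G and bs=bs, OF h G] by simp
  qed
  have step: "grid \<eta> h j \<le> T (1 + count_list (take j bs) True) \<omega> \<and> T (1 + count_list (take j bs) True) \<omega> \<le> grid \<eta> h (Suc j)"
    if "\<omega> \<in> pattern h bs" "\<forall>n. \<exists>t\<ge>\<eta>. n \<le> P t \<omega>" "j < length bs" "bs ! j" for \<omega> bs j
    using jump_time_in_step[OF h that] by simp
  note C = sum_pattern_chain[where k=k and m=m, OF k, folded C_def]
  show "R \<le> C" if "\<And>i t y. grid \<eta> h i \<le> t \<Longrightarrow> t \<le> grid \<eta> h (Suc i) \<Longrightarrow> lapd t y \<le> k i y"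
    unfolding R C[symmetric]
  proof (intro sum_mono nn_integral_mono_AE, use AE_P_unbounded in eventually_elim)
    case (elim bs \<omega>)
    have "path_int (jump_density \<omega>) G 0 1 z bs \<le> path_int (\<lambda>i l. k i) G 0 1 z bs" if "\<omega> \<in> pattern h bs" for z
      using step[OF that elim(2)] by (intro path_int_mono) (simp add: \<open>\<And>i t y. _ \<Longrightarrow> _ \<Longrightarrow> lapd t y \<le> k i y\<close>)
    then show ?case by (cases "\<omega> \<in> pattern h bs") (auto intro!: mult_right_mono nn_integral_mono)
  qed
  show "C \<le> R" if "\<And>i t y. grid \<eta> h i \<le> t \<Longrightarrow> t \<le> grid \<eta> h (Suc i) \<Longrightarrow> k i y \<le> lapd t y"
    unfolding R C[symmetric]
  proof (intro sum_mono nn_integral_mono_AE, use AE_P_unbounded in eventually_elim)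
    case (elim bs \<omega>)
    have "path_int (\<lambda>i l. k i) G 0 1 z bs \<le> path_int (jump_density \<omega>) G 0 1 z bs" if "\<omega> \<in> pattern h bs" for z
      using step[OF that elim(2)] by (intro path_int_mono) (simp add: \<open>\<And>i t y. _ \<Longrightarrow> _ \<Longrightarrow> k i y \<le> lapd t y\<close>)
    then show ?case by (cases "\<omega> \<in> pattern h bs") (auto intro!: mult_right_mono nn_integral_mono)
  qed
qed

abbreviation "exact_int m \<equiv> \<integral>\<^sup>+z. lapd \<eta> z * laplace_chain \<eta> h G 0 m z \<partial>lborel"

text \<open>Replacing the scale of a jump by the right end point costs exp h per jump, and 2 h exp
  (- 2 h) exp h is still at most the jump weight 1 - exp (- 2 h) of the exact chain. Only the paths
  with two jumps in some step are left for the error term.\<close>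

lemma compound_grid_upper:
  "(\<integral>\<^sup>+\<omega>. (\<Prod>j\<le>m. G j (compound (grid \<eta> h j) \<omega>)) \<partial>M) \<le> exact_int m + ennreal (1 - pattern_mass h ^ m)"
proof -
  let ?X = "\<lambda>\<omega>. \<Prod>j\<le>m. G j (compound (grid \<eta> h j) \<omega>)"
  let ?U = "\<Union>bs\<in>{bs. length bs = m}. pattern h bs"
  define k where "k i y = ennreal (exp h) * lapd (grid \<eta> h (Suc i)) y" for i y
  have km: "k i \<in> borel_measurable borel" for i unfolding k_def by measurable
  have gp: "0 < grid \<eta> h i" for i using eta_pos by (rule grid_pos)
  have "(\<integral>\<^sup>+\<omega>. ?X \<omega> \<partial>M) = (\<Sum>bs | length bs = m. \<integral>\<^sup>+\<omega>\<in>pattern h bs. ?X \<omega> \<partial>M)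
    + (\<integral>\<^sup>+\<omega>\<in>space M - ?U. ?X \<omega> \<partial>M)"
    by (rule sum_pattern_events) measurable
  also have "\<dots> \<le> exact_int m + ennreal (1 - pattern_mass h ^ m)"
  proof (rule add_mono)
    have "(\<Sum>bs | length bs = m. \<integral>\<^sup>+\<omega>\<in>pattern h bs. ?X \<omega> \<partial>M)
      \<le> (\<integral>\<^sup>+z. lapd \<eta> z * chain (ennreal (exp (- 2 * h))) (\<lambda>i y. ennreal (2 * h * exp (- 2 * h)) * k i y) G 0 m z \<partial>lborel)"
    proof (rule patterns_le_chain[OF km])
      fix i t y assume t: "grid \<eta> h i \<le> t" "t \<le> grid \<eta> h (Suc i)"
      have "grid \<eta> h (Suc i) / grid \<eta> h i = exp h" using gp[of i] by (simp add: grid_Suc)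
      then show "lapd t y \<le> k i y" using lapd_upper[OF gp t, of y] by (simp add: k_def)
    qed
    also have "\<dots> \<le> exact_int m"
    proof (intro nn_integral_mono mult_left_mono chain_mono_kernel)
      fix i y
      have "ennreal (2 * h * exp (- 2 * h)) * k i y = ennreal (2 * h * (exp (- 2 * h) * exp h)) * lapd (grid \<eta> h (Suc i)) y"
        unfolding k_def using h by (simp flip: ennreal_mult mult.assoc)
      also have "2 * h * (exp (- 2 * h) * exp h) = 2 * h * exp (- h)" by (simp flip: exp_add)
      finally show "ennreal (2 * h * exp (- 2 * h)) * k i y \<le> laplace_kernel \<eta> h i y"
        unfolding laplace_kernel_def using two_mult_le_exp_diff[of h] h
        by (auto intro!: mult_right_mono ennreal_leI)
    qed simp
    finally show "(\<Sum>bs | length bs = m. \<integral>\<^sup>+\<omega>\<in>pattern h bs. ?X \<omega> \<partial>M) \<le> exact_int m" .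
    have "?X \<omega> \<le> 1" for \<omega> using G_le by (intro prod_le_1) auto
    then have "(\<integral>\<^sup>+\<omega>\<in>space M - ?U. ?X \<omega> \<partial>M) \<le> (\<integral>\<^sup>+\<omega>. indicator (space M - ?U) \<omega> \<partial>M)"
      by (intro nn_integral_mono) (auto split: split_indicator)
    also have "?U \<in> sets M" by (intro sets.finite_UN finite_bool_lists pattern_event_measurable h)
    then have "(\<integral>\<^sup>+\<omega>. indicator (space M - ?U) \<omega> \<partial>M) = emeasure M (space M - ?U)" by (intro nn_integral_indicator) auto
    also note emeasure_no_pattern
    finally show "(\<integral>\<^sup>+\<omega>\<in>space M - ?U. ?X \<omega> \<partial>M) \<le> ennreal (1 - pattern_mass h ^ m)" .
  qed
  finally show ?thesis .
qed

lemma compound_grid_lower: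
  "exact_int m \<le> (\<integral>\<^sup>+\<omega>. (\<Prod>j\<le>m. G j (compound (grid \<eta> h j) \<omega>)) \<partial>M) + ennreal (1 - pattern_mass h ^ m)"
proof -
  let ?X = "\<lambda>\<omega>. \<Prod>j\<le>m. G j (compound (grid \<eta> h j) \<omega>)" and ?e = "ennreal (1 - pattern_mass h ^ m)"
  define k where "k i y = ennreal (exp (- h)) * lapd (grid \<eta> h i) y" for i y
  have km [measurable]: "k i \<in> borel_measurable borel" for i unfolding k_def by measurable
  have gp: "0 < grid \<eta> h i" for i using eta_pos by (rule grid_pos)
  let ?C = "chain (ennreal (exp (- 2 * h))) (\<lambda>i y. ennreal (2 * h * exp (- 2 * h)) * k i y) G 0 m"
  have "exact_int m \<le> (\<integral>\<^sup>+z. lapd \<eta> z * ?C z + lapd \<eta> z * ?e \<partial>lborel)"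
  proof (rule nn_integral_mono)
    fix z
    have "laplace_chain \<eta> h G 0 m z \<le> ?C z + ?e"
      unfolding k_def by (rule laplace_chain_le_lower_chain[OF eta_pos h G G_le])
    then have "lapd \<eta> z * laplace_chain \<eta> h G 0 m z \<le> lapd \<eta> z * (?C z + ?e)"
      by (rule mult_left_mono) simp
    then show "lapd \<eta> z * laplace_chain \<eta> h G 0 m z \<le> lapd \<eta> z * ?C z + lapd \<eta> z * ?e"
      by (simp only: distrib_left)
  qed
  also have "\<dots> = (\<integral>\<^sup>+z. lapd \<eta> z * ?C z \<partial>lborel) + ?e"
    by (subst nn_integral_add) (auto simp: nn_integral_multc nn_integral_lapd[OF eta_pos])
  also have "(\<integral>\<^sup>+z. lapd \<eta> z * ?C z \<partial>lborel) \<le> (\<Sum>bs | length bs = m. \<integral>\<^sup>+\<omega>\<in>pattern h bs. ?X \<omega> \<partial>M)"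
  proof (rule chain_le_patterns[OF km])
    fix i t y assume t: "grid \<eta> h i \<le> t" "t \<le> grid \<eta> h (Suc i)"
    have "grid \<eta> h i / grid \<eta> h (Suc i) = exp (- h)" using gp[of i] by (simp add: grid_Suc exp_minus divide_inverse)
    then show "k i y \<le> lapd t y" using lapd_lower[OF gp t, of y] by (simp add: k_def)
  qed
  also have "\<dots> \<le> (\<integral>\<^sup>+\<omega>. ?X \<omega> \<partial>M)"
    by (subst sum_pattern_events[of _ m]) auto
  finally show ?thesis by (simp add: add_right_mono)
qed

end

end

section \<open>Shifting the Laplace process\<close>

lemma inverse_Suc_tendsto: "(\<lambda>N. 1 / real (Suc N)) \<longlonglongrightarrow> 0"
  using LIMSEQ_inverse_real_of_nat by (simp add: inverse_eq_divide)

text \<open>Bernoulli's inequality with a defect of order h^2 per step. For m of order 1 / h, as on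
  a fixed time interval, the bound tends to 0 with h.\<close>

lemma pattern_mass_power_bound:
  assumes "0 < h" shows "1 - pattern_mass h ^ m \<le> real m * (6 * h\<^sup>2)"
proof -
  have "1 - 2 * h \<le> exp (- 2 * h)" "1 - 3 * h \<le> exp (- 3 * h)"
    using exp_ge_add_one_self[of "- 2 * h"] exp_ge_add_one_self[of "- 3 * h"] by simp_all
  \<comment> \<open>The left side equals 1 - 6 h^2, which is the origin of the constant 6.\<close>
  then have "1 - 2 * h + 2 * h * (1 - 3 * h) \<le> pattern_mass h"
    unfolding pattern_mass_def using assms by (intro add_mono mult_left_mono) auto
  then have "1 - pattern_mass h \<le> 6 * h\<^sup>2" by (simp add: algebra_simps power2_eq_square)
  moreover have "1 + real m * (pattern_mass h - 1) \<le> (1 + (pattern_mass h - 1)) ^ m"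
    using pattern_mass_bounds[OF assms] by (intro Bernoulli_inequality) auto
  ultimately have "1 - pattern_mass h ^ m \<le> real m * (1 - pattern_mass h)" by (simp add: algebra_simps)
  also have "\<dots> \<le> real m * (6 * h\<^sup>2)" using \<open>1 - pattern_mass h \<le> 6 * h\<^sup>2\<close> by (intro mult_left_mono) auto
  finally show ?thesis .
qed

text \<open>The first grid index at or after t, for t \<ge> \<eta>. Rounding upwards fits the right
  continuity of the paths and keeps the times above the lower bound that enters the cost of a
  shift.\<close>

definition grid_index :: "real \<Rightarrow> real \<Rightarrow> real \<Rightarrow> nat" where
  "grid_index \<eta> h t = nat \<lceil>ln (t / \<eta>) / h\<rceil>"

abbreviation "grid_up \<eta> h t \<equiv> grid \<eta> h (grid_index \<eta> h t)"

lemma grid_index_mono: "0 < \<eta> \<Longrightarrow> 0 < h \<Longrightarrow> 0 < s \<Longrightarrow> s \<le> t \<Longrightarrow> grid_index \<eta> h s \<le> grid_index \<eta> h t"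
  unfolding grid_index_def by (intro nat_mono ceiling_mono divide_right_mono) (auto simp: divide_right_mono)

lemma le_grid_index:
  assumes "0 < \<eta>" "0 < h" "0 < t"
  shows "t \<le> grid_up \<eta> h t"
proof -
  have "ln (t / \<eta>) / h \<le> real (grid_index \<eta> h t)" unfolding grid_index_def by (rule real_nat_ceiling_ge)
  then have "ln (t / \<eta>) \<le> h * real (grid_index \<eta> h t)" using assms by (simp add: field_simps)
  then have "exp (ln (t / \<eta>)) \<le> exp (h * real (grid_index \<eta> h t))" by simp
  then show ?thesis using assms by (simp add: grid_def field_simps)
qed

lemma grid_index_le:
  assumes "0 < \<eta>" "0 < h" "\<eta> \<le> t"
  shows "real (grid_index \<eta> h t) \<le> ln (t / \<eta>) / h + 1"
proof -
  have "0 \<le> ln (t / \<eta>) / h" using assms by simp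
  then show ?thesis unfolding grid_index_def by linarith
qed

lemma grid_index_upper:
  assumes "0 < \<eta>" "0 < h" "\<eta> \<le> t"
  shows "grid_up \<eta> h t \<le> t * exp h"
proof -
  have "h * real (grid_index \<eta> h t) \<le> h * (ln (t / \<eta>) / h + 1)"
    using grid_index_le[OF assms] assms by (intro mult_left_mono) auto
  also have "\<dots> = ln (t / \<eta>) + h" using assms by (simp add: field_simps)
  finally have "exp (h * real (grid_index \<eta> h t)) \<le> exp (ln (t / \<eta>)) * exp h" by (simp flip: exp_add)
  then show ?thesis using assms by (simp add: grid_def field_simps)
qed

text \<open>The first process is bounded by the exact chain, the translation takes place in the
  chain, and the chain is bounded by the second process. The error of the last comparison occurs
  inside the factor because it is made after the translation.\<close>

lemma compound_laplace_grid_shift: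
  fixes Y :: "nat \<Rightarrow> 'w \<Rightarrow> real" and Y' :: "nat \<Rightarrow> 'v \<Rightarrow> real" and g g' :: "'i \<Rightarrow> real \<Rightarrow> ennreal"
  assumes "compound_laplace M \<eta> P Y" "compound_laplace M' \<eta> P' Y'"
    and h: "0 < h" and I: "finite I" and k: "\<And>i. i \<in> I \<Longrightarrow> n \<le> k i \<and> k i \<le> m" and nm: "n \<le> m"
    and g: "\<And>i. i \<in> I \<Longrightarrow> g i \<in> borel_measurable borel" "\<And>i. i \<in> I \<Longrightarrow> g' i \<in> borel_measurable borel"
    and le1: "\<And>i z. i \<in> I \<Longrightarrow> g i z \<le> 1" "\<And>i z. i \<in> I \<Longrightarrow> g' i z \<le> 1"
    and le: "\<And>i z. i \<in> I \<Longrightarrow> g i z \<le> g' i (z + c)"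
  shows "(\<integral>\<^sup>+\<omega>. (\<Prod>i\<in>I. g i (\<Sum>n=0..P (grid \<eta> h (k i)) \<omega>. Y n \<omega>)) \<partial>M)
    \<le> ennreal (exp (\<bar>c\<bar> / grid \<eta> h n)) * ((\<integral>\<^sup>+\<omega>. (\<Prod>i\<in>I. g' i (\<Sum>n=0..P' (grid \<eta> h (k i)) \<omega>. Y' n \<omega>)) \<partial>M')
        + ennreal (1 - pattern_mass h ^ m)) + ennreal (1 - pattern_mass h ^ m)"
proof -
  interpret A: compound_laplace M \<eta> P Y by fact
  interpret B: compound_laplace M' \<eta> P' Y' by fact
  \<comment> \<open>Several times may be rounded to the same grid point, where their test functions
    are multiplied. At points that are not hit, in particular before \<open>n\<close>, the empty
    product makes the test function trivial.\<close>
  define G where "G j z = (\<Prod>i\<in>{i\<in>I. k i = j}. g i z)" for j z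
  define G' where "G' j z = (\<Prod>i\<in>{i\<in>I. k i = j}. g' i z)" for j z
  have Gm: "G j \<in> borel_measurable borel" "G' j \<in> borel_measurable borel" for j
    unfolding G_def G'_def using g by (auto intro!: borel_measurable_prod_ennreal)
  have G1: "G j z \<le> 1" "G' j z \<le> 1" for j z
    unfolding G_def G'_def using le1 by (auto intro!: prod_le_1)
  have GG': "G j z \<le> G' j (z + c)" for j z
    unfolding G_def G'_def using le by (intro prod_mono_ennreal) auto
  have triv: "G j z = 1" "G' j z = 1" if "j < n" for j z
  proof -
    have "{i\<in>I. k i = j} = {}" using k that by force
    then show "G j z = 1" "G' j z = 1" by (simp_all only: G_def G'_def prod.empty)
  qed
  have grp: "(\<Prod>i\<in>I. f i (v (k i))) = (\<Prod>j\<le>m. \<Prod>i\<in>{i\<in>I. k i = j}. f i (v j))" for f :: "'i \<Rightarrow> real \<Rightarrow> ennreal" and v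
  proof -
    have "(\<Prod>j\<le>m. \<Prod>i\<in>{i\<in>I. k i = j}. f i (v j)) = (\<Prod>j\<le>m. \<Prod>i\<in>{i\<in>I. k i = j}. f i (v (k i)))"
      by (intro prod.cong) auto
    also have "\<dots> = (\<Prod>i\<in>I. f i (v (k i)))" using I k by (intro prod.group) auto
    finally show ?thesis ..
  qed
  let ?e = "ennreal (1 - pattern_mass h ^ m)" and ?K = "ennreal (exp (\<bar>c\<bar> / grid \<eta> h n))"
  have "(\<integral>\<^sup>+\<omega>. (\<Prod>i\<in>I. g i (\<Sum>n=0..P (grid \<eta> h (k i)) \<omega>. Y n \<omega>)) \<partial>M)
    = (\<integral>\<^sup>+\<omega>. (\<Prod>j\<le>m. G j (A.compound (grid \<eta> h j) \<omega>)) \<partial>M)"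
    unfolding G_def by (subst grp[of g "\<lambda>j. A.compound (grid \<eta> h j) _"]) simp
  also have "\<dots> \<le> (\<integral>\<^sup>+z. lapd \<eta> z * laplace_chain \<eta> h G 0 m z \<partial>lborel) + ?e"
    by (rule A.compound_grid_upper[OF h Gm(1) G1(1)])
  also have "(\<integral>\<^sup>+z. lapd \<eta> z * laplace_chain \<eta> h G 0 m z \<partial>lborel)
    \<le> ?K * (\<integral>\<^sup>+z. lapd \<eta> z * laplace_chain \<eta> h G' 0 m z \<partial>lborel)"
    by (rule laplace_chain_shift[OF A.eta_pos h Gm triv GG' nm])
  also have "\<dots> \<le> ?K * ((\<integral>\<^sup>+\<omega>. (\<Prod>j\<le>m. G' j (B.compound (grid \<eta> h j) \<omega>)) \<partial>M') + ?e)"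
    by (intro mult_left_mono B.compound_grid_lower[OF h Gm(2) G1(2)]) auto
  also have "(\<integral>\<^sup>+\<omega>. (\<Prod>j\<le>m. G' j (B.compound (grid \<eta> h j) \<omega>)) \<partial>M')
    = (\<integral>\<^sup>+\<omega>. (\<Prod>i\<in>I. g' i (\<Sum>n=0..P' (grid \<eta> h (k i)) \<omega>. Y' n \<omega>)) \<partial>M')"
    unfolding G'_def by (subst grp[of g' "\<lambda>j. B.compound (grid \<eta> h j) _"]) simp
  finally show ?thesis by (simp add: add_right_mono)
qed

context compound_laplace
begin

text \<open>The paths are locally constant to the right, so for each \<omega> the values at the
  rounded times eventually coincide with those at the original ones; the bound 1 dominates.\<close>

lemma compound_grid_tendsto:
  fixes g :: "'i \<Rightarrow> real \<Rightarrow> ennreal"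
  assumes I: "finite I" and t: "\<And>i. i \<in> I \<Longrightarrow> \<eta> \<le> t i"
    and g: "\<And>i. i \<in> I \<Longrightarrow> g i \<in> borel_measurable borel" "\<And>i z. i \<in> I \<Longrightarrow> g i z \<le> 1"
  defines "h \<equiv> \<lambda>N. 1 / real (Suc N)"
  shows "(\<lambda>N. \<integral>\<^sup>+\<omega>. (\<Prod>i\<in>I. g i (compound (grid_up \<eta> (h N) (t i)) \<omega>)) \<partial>M)
    \<longlonglongrightarrow> (\<integral>\<^sup>+\<omega>. (\<Prod>i\<in>I. g i (compound (t i) \<omega>)) \<partial>M)"
proof (rule nn_integral_dominated_convergence[where w="\<lambda>_. 1"])
  have h: "0 < h N" for N by (simp add: h_def)
  have m: "compound s \<in> borel_measurable M" if "\<eta> \<le> s" for s using that by (rule compound_measurable)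
  show "(\<lambda>\<omega>. \<Prod>i\<in>I. g i (compound (grid_up \<eta> (h N) (t i)) \<omega>)) \<in> borel_measurable M" for N
    by (intro borel_measurable_prod_ennreal measurable_compose[OF m g(1)] grid_ge eta_pos less_imp_le[OF h]) auto
  show "(\<lambda>\<omega>. \<Prod>i\<in>I. g i (compound (t i) \<omega>)) \<in> borel_measurable M"
    by (intro borel_measurable_prod_ennreal measurable_compose[OF m g(1)] t) auto
  show "AE \<omega> in M. (\<Prod>i\<in>I. g i (compound (grid_up \<eta> (h N) (t i)) \<omega>)) \<le> 1" for N
    using g(2) by (intro AE_I2 prod_le_1) auto
  show "(\<integral>\<^sup>+\<omega>. 1 \<partial>M) < \<infinity>" by (simp add: emeasure_space_1)
  show "AE \<omega> in M. (\<lambda>N. \<Prod>i\<in>I. g i (compound (grid_up \<eta> (h N) (t i)) \<omega>))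
    \<longlonglongrightarrow> (\<Prod>i\<in>I. g i (compound (t i) \<omega>))"
  proof (rule AE_I2)
    fix \<omega> assume \<omega>: "\<omega> \<in> space M"
    have "eventually (\<lambda>N. P (grid_up \<eta> (h N) (t i)) \<omega> = P (t i) \<omega>) sequentially" if i: "i \<in> I" for i
    proof -
      have ti: "\<eta> \<le> t i" "0 < t i" using t[OF i] eta_pos by auto
      obtain b where b: "t i < b" "\<And>s. t i < s \<Longrightarrow> s < b \<Longrightarrow> P s \<omega> = P (t i) \<omega>"
        using P_right[OF \<omega> ti(1)] by (auto simp: eventually_at_right_field)
      have "(\<lambda>N. t i * exp (h N)) \<longlonglongrightarrow> t i * exp 0"
        unfolding h_def by (intro tendsto_intros inverse_Suc_tendsto)
      then have "eventually (\<lambda>N. t i * exp (h N) < b) sequentially"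
        using b(1) by (intro order_tendstoD(2)) auto
      then show ?thesis
      proof eventually_elim
        case (elim N)
        have "t i \<le> grid_up \<eta> (h N) (t i)" by (rule le_grid_index[OF eta_pos h ti(2)])
        moreover have "grid_up \<eta> (h N) (t i) < b"
          using grid_index_upper[OF eta_pos h ti(1), of N] elim by linarith
        ultimately show ?case using b(2) by (cases "t i = grid_up \<eta> (h N) (t i)") auto
      qed
    qed
    then have "eventually (\<lambda>N. \<forall>i\<in>I. P (grid_up \<eta> (h N) (t i)) \<omega> = P (t i) \<omega>) sequentially"
      using I by (intro eventually_ball_finite) auto
    then show "(\<lambda>N. \<Prod>i\<in>I. g i (compound (grid_up \<eta> (h N) (t i)) \<omega>))
      \<longlonglongrightarrow> (\<Prod>i\<in>I. g i (compound (t i) \<omega>))"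
      by (intro tendsto_eventually, eventually_elim) (auto intro!: prod.cong)
  qed
qed simp

end

lemma laplace_processE:
  assumes "prob_space M" "0 < \<eta>" "laplace_process M \<eta> Z"
  obtains P Y where "compound_laplace M \<eta> P Y"
    "\<And>\<omega> t. \<omega> \<in> space M \<Longrightarrow> \<eta> \<le> t \<Longrightarrow> Z t \<omega> = (\<Sum>n=0..P t \<omega>. Y n \<omega>)"
  using assms unfolding laplace_process_def compound_laplace_def compound_laplace_axioms_def by blast

text \<open>The limit h \<rightarrow> 0 of the grid version. Rounding \<open>t0\<close> upwards only
  lowers the cost of the translation, so the factor exp (|c| / t0) is valid for every h. Only the
  separate laws of \<open>Z\<close> and \<open>Z'\<close> enter, not a joint law.\<close>

lemma laplace_process_shift:
  fixes Z :: "real \<Rightarrow> 'w \<Rightarrow> real" and Z' :: "real \<Rightarrow> 'v \<Rightarrow> real" and g g' :: "'i \<Rightarrow> real \<Rightarrow> ennreal"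
  assumes M: "prob_space M" "prob_space M'" and \<eta>: "0 < \<eta>"
    and Z: "laplace_process M \<eta> Z" "laplace_process M' \<eta> Z'"
    and I: "finite I" and t: "\<And>i. i \<in> I \<Longrightarrow> t0 \<le> t i" and t0: "\<eta> \<le> t0"
    and g: "\<And>i. i \<in> I \<Longrightarrow> g i \<in> borel_measurable borel" "\<And>i. i \<in> I \<Longrightarrow> g' i \<in> borel_measurable borel"
    and le1: "\<And>i z. i \<in> I \<Longrightarrow> g i z \<le> 1" "\<And>i z. i \<in> I \<Longrightarrow> g' i z \<le> 1"
    and le: "\<And>i z. i \<in> I \<Longrightarrow> g i z \<le> g' i (z + c)"
  shows "(\<integral>\<^sup>+\<omega>. (\<Prod>i\<in>I. g i (Z (t i) \<omega>)) \<partial>M)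
    \<le> ennreal (exp (\<bar>c\<bar> / t0)) * (\<integral>\<^sup>+\<omega>. (\<Prod>i\<in>I. g' i (Z' (t i) \<omega>)) \<partial>M')"
proof -
  obtain P Y where A: "compound_laplace M \<eta> P Y" and ZA: "\<And>\<omega> t. \<omega> \<in> space M \<Longrightarrow> \<eta> \<le> t \<Longrightarrow> Z t \<omega> = (\<Sum>n=0..P t \<omega>. Y n \<omega>)"
    by (rule laplace_processE[OF M(1) \<eta> Z(1)]) blast
  obtain P' Y' where B: "compound_laplace M' \<eta> P' Y'" and ZB: "\<And>\<omega> t. \<omega> \<in> space M' \<Longrightarrow> \<eta> \<le> t \<Longrightarrow> Z' t \<omega> = (\<Sum>n=0..P' t \<omega>. Y' n \<omega>)"
    by (rule laplace_processE[OF M(2) \<eta> Z(2)]) blast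
  interpret A: compound_laplace M \<eta> P Y by (rule A)
  interpret B: compound_laplace M' \<eta> P' Y' by (rule B)
  define h where "h = (\<lambda>N. 1 / real (Suc N))"
  have h: "0 < h N" for N by (simp add: h_def)
  have t0': "0 < t0" using t0 \<eta> by simp
  have t\<eta>: "\<eta> \<le> t i" if "i \<in> I" for i using t[OF that] t0 by simp
  \<comment> \<open>Inserting \<open>t0\<close> gives a maximum also for empty \<open>I\<close> and
    ensures \<open>t0 \<le> tm\<close>, hence that the first observed grid index is at most the last
    one.\<close>
  define tm where "tm = Max (insert t0 (t ` I))"
  have tm: "t0 \<le> tm" "\<And>i. i \<in> I \<Longrightarrow> t i \<le> tm"
    unfolding tm_def using I by (simp_all only: finite_insert finite_imageI Max_ge insertI1 insertI2 imageI)
  define m where "m N = grid_index \<eta> (h N) tm" for N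
  define e where "e N = ennreal (1 - pattern_mass (h N) ^ m N)" for N
  have alg: "(L / x + 1) * (6 * x\<^sup>2) = 6 * L * x + 6 * x\<^sup>2" if "0 < x" for L x :: real
    using that by (simp add: distrib_right power2_eq_square)
  have e_le: "1 - pattern_mass (h N) ^ m N \<le> 6 * ln (tm / \<eta>) * h N + 6 * (h N)\<^sup>2" for N
  proof -
    have "1 - pattern_mass (h N) ^ m N \<le> real (m N) * (6 * (h N)\<^sup>2)" by (rule pattern_mass_power_bound[OF h])
    also have "\<dots> \<le> (ln (tm / \<eta>) / h N + 1) * (6 * (h N)\<^sup>2)"
      unfolding m_def by (rule mult_right_mono[OF grid_index_le[OF \<eta> h order_trans[OF t0 tm(1)]]]) (rule mult_nonneg_nonneg[OF _ zero_le_power2], simp)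
    also have "\<dots> = 6 * ln (tm / \<eta>) * h N + 6 * (h N)\<^sup>2" by (rule alg[OF h])
    finally show ?thesis .
  qed
  have hlim: "h \<longlonglongrightarrow> 0" unfolding h_def by (rule inverse_Suc_tendsto)
  have lim: "(\<lambda>N. 6 * ln (tm / \<eta>) * h N + 6 * (h N)\<^sup>2) \<longlonglongrightarrow> 6 * ln (tm / \<eta>) * 0 + 6 * 0\<^sup>2"
    by (intro tendsto_intros hlim)
  have lim0: "(\<lambda>N. 1 - pattern_mass (h N) ^ m N) \<longlonglongrightarrow> 0"
  proof (rule tendsto_sandwich[OF _ _ tendsto_const])
    show "\<forall>\<^sub>F N in sequentially. 0 \<le> 1 - pattern_mass (h N) ^ m N"
      using pattern_mass_bounds[OF h] by (intro always_eventually allI) (simp add: power_le_one)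
    show "\<forall>\<^sub>F N in sequentially. 1 - pattern_mass (h N) ^ m N \<le> 6 * ln (tm / \<eta>) * h N + 6 * (h N)\<^sup>2"
      by (intro always_eventually allI e_le)
    show "(\<lambda>N. 6 * ln (tm / \<eta>) * h N + 6 * (h N)\<^sup>2) \<longlonglongrightarrow> 0" using lim by simp
  qed
  have elim: "(\<lambda>N. e N) \<longlonglongrightarrow> 0"
    unfolding e_def using tendsto_ennrealI[OF lim0] by (simp only: ennreal_0)
  define k where "k N i = grid_index \<eta> (h N) (t i)" for N i
  let ?K = "ennreal (exp (\<bar>c\<bar> / t0))"
  define L where "L N = (\<integral>\<^sup>+\<omega>. (\<Prod>i\<in>I. g i (\<Sum>n=0..P (grid \<eta> (h N) (k N i)) \<omega>. Y n \<omega>)) \<partial>M)" for N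
  define R where "R N = (\<integral>\<^sup>+\<omega>. (\<Prod>i\<in>I. g' i (\<Sum>n=0..P' (grid \<eta> (h N) (k N i)) \<omega>. Y' n \<omega>)) \<partial>M')" for N
  have step: "L N \<le> ?K * (R N + e N) + e N" for N
  proof -
    let ?n = "grid_index \<eta> (h N) t0"
    have "L N \<le> ennreal (exp (\<bar>c\<bar> / grid \<eta> (h N) ?n)) * (R N + e N) + e N"
      unfolding L_def R_def e_def
    proof (rule compound_laplace_grid_shift[OF A B h I _ _ g le1 le])
      show "?n \<le> k N i \<and> k N i \<le> m N" if "i \<in> I" for i
        unfolding k_def m_def using t[OF that] tm(2)[OF that] t0' by (auto intro!: grid_index_mono \<eta> h)
      show "?n \<le> m N" unfolding m_def using tm t0' by (auto intro!: grid_index_mono \<eta> h)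
    qed auto
    also have "\<dots> \<le> ?K * (R N + e N) + e N"
      using le_grid_index[OF \<eta> h t0', of N] t0'
      by (intro add_right_mono mult_right_mono ennreal_leI) (auto intro!: divide_left_mono)
    finally show ?thesis .
  qed
  have Llim: "L \<longlonglongrightarrow> (\<integral>\<^sup>+\<omega>. (\<Prod>i\<in>I. g i (A.compound (t i) \<omega>)) \<partial>M)"
    unfolding L_def h_def k_def by (rule A.compound_grid_tendsto[OF I t\<eta> g(1) le1(1)])
  have Rlim: "R \<longlonglongrightarrow> (\<integral>\<^sup>+\<omega>. (\<Prod>i\<in>I. g' i (B.compound (t i) \<omega>)) \<partial>M')"
    unfolding R_def h_def k_def by (rule B.compound_grid_tendsto[OF I t\<eta> g(2) le1(2)])
  have "(\<lambda>N. ?K * (R N + e N) + e N) \<longlonglongrightarrow> ?K * ((\<integral>\<^sup>+\<omega>. (\<Prod>i\<in>I. g' i (B.compound (t i) \<omega>)) \<partial>M') + 0) + 0"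
    by (intro tendsto_add ennreal_tendsto_cmult Rlim elim) simp
  from LIMSEQ_le[OF Llim this] step have "(\<integral>\<^sup>+\<omega>. (\<Prod>i\<in>I. g i (A.compound (t i) \<omega>)) \<partial>M)
    \<le> ?K * ((\<integral>\<^sup>+\<omega>. (\<Prod>i\<in>I. g' i (B.compound (t i) \<omega>)) \<partial>M') + 0) + 0"
    by blast
  also have "(\<integral>\<^sup>+\<omega>. (\<Prod>i\<in>I. g i (A.compound (t i) \<omega>)) \<partial>M) = (\<integral>\<^sup>+\<omega>. (\<Prod>i\<in>I. g i (Z (t i) \<omega>)) \<partial>M)"
    using t\<eta> by (intro nn_integral_cong prod.cong) (auto simp: ZA)
  also have "(\<integral>\<^sup>+\<omega>. (\<Prod>i\<in>I. g' i (B.compound (t i) \<omega>)) \<partial>M') = (\<integral>\<^sup>+\<omega>. (\<Prod>i\<in>I. g' i (Z' (t i) \<omega>)) \<partial>M')"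
    using t\<eta> by (intro nn_integral_cong prod.cong) (auto simp: ZB)
  finally show ?thesis by (simp only: add_0_right)
qed

lemma measurable_from_vimage_algebra_subset:
  assumes "f \<in> space M \<rightarrow> space N" "sets (vimage_algebra (space M) f N) \<subseteq> sets M"
  shows "f \<in> measurable M N"
  using assms by (intro measurableI) (auto dest: in_vimage_algebra[of _ N f "space M"])

section \<open>One run of ReducedAboveThreshold\<close>

text \<open>\<open>True\<close> is for a round that does not halt, where \<open>\<xi>\<close> lies
  strictly below the threshold c, and \<open>False\<close> for the halting round, where
  \<open>\<xi>\<close> reaches it.\<close>

definition ray :: "bool \<Rightarrow> real \<Rightarrow> real set" where
  "ray b c = (if b then {..<c} else {c..})"

definition lap_ray :: "bool \<Rightarrow> real \<Rightarrow> real \<Rightarrow> ennreal" where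
  "lap_ray b s c = (\<integral>\<^sup>+y. indicator (ray b c) y * lapd s y \<partial>lborel)"

lemma ray_sets [measurable]: "ray b c \<in> sets borel"
  by (simp add: ray_def)

lemma ray_indicator_measurable [measurable (raw)]:
  assumes [measurable]: "f \<in> borel_measurable N" "g \<in> borel_measurable N"
  shows "(\<lambda>x. indicator (ray b (f x)) (g x) :: ennreal) \<in> borel_measurable N"
  unfolding ray_def indicator_def by (cases b; simp only: if_True if_False lessThan_iff atLeast_iff; measurable)

lemma lap_ray_measurable [measurable (raw)]:
  assumes [measurable]: "f \<in> borel_measurable N" "g \<in> borel_measurable N"
  shows "(\<lambda>x. lap_ray b (f x) (g x)) \<in> borel_measurable N"
  unfolding lap_ray_def by measurable

lemma lap_ray_le_1: "lap_ray b s c \<le> 1"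
  unfolding lap_ray_def
  by (rule order_trans[OF nn_integral_mono nn_integral_lapd_le[of s]]) (auto split: split_indicator)

lemma lap_ray_mono: "c \<le> c' \<Longrightarrow> lap_ray True s c \<le> lap_ray True s c'"
  unfolding lap_ray_def ray_def by (intro nn_integral_mono mult_right_mono) (auto split: split_indicator)

lemma lap_ray_shift:
  assumes "0 < s" "0 \<le> a" "c' \<le> c + a"
  shows "lap_ray False s c \<le> ennreal (exp (a / s)) * lap_ray False s c'"
proof -
  have "lap_ray False s c = (\<integral>\<^sup>+y. lapd s (y - a) * indicator {c + a..} y \<partial>lborel)"
    unfolding lap_ray_def ray_def by (subst nn_integral_real_affine[where c=1 and t="- a"])
      (auto intro!: nn_integral_cong split: split_indicator)
  also have "\<dots> \<le> (\<integral>\<^sup>+y. ennreal (exp (a / s)) * (indicator (ray False c') y * lapd s y) \<partial>lborel)"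
    using lapd_shift[OF assms(1), of _ a] assms(2,3)
    by (intro nn_integral_mono) (auto simp: ray_def split: split_indicator)
  also have "\<dots> = ennreal (exp (a / s)) * lap_ray False s c'"
    unfolding lap_ray_def by (rule nn_integral_cmult) measurable
  finally show ?thesis .
qed

locale rat_run = prob_space M for M :: "'w measure" +
  fixes \<Delta> \<epsilon>max \<tau> :: real and v :: "real ^ 'd \<Rightarrow> real"
    and E :: "nat \<Rightarrow> (nat \<Rightarrow> real ^ 'd) \<Rightarrow> real"
    and Alg :: "nat \<Rightarrow> 'w \<Rightarrow> real ^ 'd" and Z :: "real \<Rightarrow> 'w \<Rightarrow> real" and \<xi> :: "nat \<Rightarrow> 'w \<Rightarrow> real"
  assumes \<Delta>_pos: "0 < \<Delta>" and \<epsilon>max_pos: "0 < \<epsilon>max"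
    and E: "privacy_functions \<epsilon>max E"
    and v_measurable [measurable]: "v \<in> borel_measurable borel"
    and noise: "rat_noise M \<Delta> \<epsilon>max E Alg Z \<xi>"
begin

abbreviation "\<eta> \<equiv> 2 * \<Delta> / \<epsilon>max"
abbreviation "algs n \<omega> \<equiv> \<lambda>i\<in>{1..n}. Alg i \<omega>"
abbreviation "prefixM n \<equiv> PiM {1..n} (\<lambda>_. borel :: (real ^ 'd) measure)"
abbreviation "eps n \<beta> \<equiv> E n (restrict \<beta> {1..<n})"

definition "algX \<omega> = (\<lambda>i\<in>{1..}. Alg i \<omega>)"
definition "pathX \<omega> = (\<lambda>t\<in>{\<eta>..}. Z t \<omega>)"
abbreviation "algM \<equiv> PiM {1..} (\<lambda>_::nat. borel :: (real ^ 'd) measure)"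
abbreviation "pathM \<equiv> PiM {\<eta>..} (\<lambda>_::real. borel :: real measure)"
definition "FA = vimage_algebra (space M) algX algM"
definition "FZ = vimage_algebra (space M) pathX pathM"
definition "FAZ = vimage_algebra (space M) (\<lambda>\<omega>. (algX \<omega>, pathX \<omega>)) (algM \<Otimes>\<^sub>M pathM)"

lemma noise_facts:
  "laplace_process M \<eta> Z" "indep_set (sets FA) (sets FZ)"
  "cond_indep_laplace M FAZ {1..} (\<lambda>n \<omega>. 4 * \<Delta> / rat_eps E Alg n \<omega>) \<xi>"
  using noise unfolding rat_noise_def Let_def FA_def FZ_def FAZ_def algX_def[abs_def] pathX_def[abs_def] by auto

lemma \<eta>_pos: "0 < \<eta>" using \<Delta>_pos \<epsilon>max_pos by simp

lemma space_F [simp]: "space FA = space M" "space FZ = space M" "space FAZ = space M"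
  by (simp_all add: FA_def FZ_def FAZ_def)

lemma X_funcset: "algX \<in> space M \<rightarrow> space algM" "pathX \<in> space M \<rightarrow> space pathM"
  by (auto simp: algX_def pathX_def space_PiM)

lemma algX_FA: "algX \<in> measurable FA algM" and pathX_FZ: "pathX \<in> measurable FZ pathM"
  unfolding FA_def FZ_def using X_funcset by (auto intro: measurable_vimage_algebra1)

lemma pairX_FAZ: "(\<lambda>\<omega>. (algX \<omega>, pathX \<omega>)) \<in> measurable FAZ (algM \<Otimes>\<^sub>M pathM)"
  unfolding FAZ_def using X_funcset by (intro measurable_vimage_algebra1) (auto simp: space_pair_measure)

text \<open>Independence of two families of sets includes that they consist of events of
  \<open>M\<close>; the measurability of the iterates, and likewise of the paths, is obtained from
  this.\<close>

lemma algX_measurable: "algX \<in> measurable M algM"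
  using indep_setD_ev1[OF noise_facts(2)] X_funcset(1)
  unfolding FA_def by (intro measurable_from_vimage_algebra_subset)

lemma pathX_measurable: "pathX \<in> measurable M pathM"
  using indep_setD_ev2[OF noise_facts(2)] X_funcset(2)
  unfolding FZ_def by (intro measurable_from_vimage_algebra_subset)

lemma subalgebra_FAZ: "subalgebra M FAZ"
proof -
  have "sets FAZ \<subseteq> sets M"
    unfolding FAZ_def
    by (rule sets_image_in_sets[OF refl measurable_Pair[OF algX_measurable pathX_measurable]])
  then show ?thesis by (simp add: subalgebra_def)
qed

lemma measurable_id_subalgebra:
  assumes "space F = space M" "sets F \<subseteq> sets M" shows "(\<lambda>\<omega>. \<omega>) \<in> measurable M F"
  using assms by (auto simp: measurable_def dest: sets.sets_into_space)

lemma id_FA: "(\<lambda>\<omega>. \<omega>) \<in> measurable M FA" and id_FZ: "(\<lambda>\<omega>. \<omega>) \<in> measurable M FZ"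
  by (rule measurable_id_subalgebra; simp add: indep_setD_ev1[OF noise_facts(2)] indep_setD_ev2[OF noise_facts(2)])+

lemma id_FAZ_FA: "(\<lambda>\<omega>. \<omega>) \<in> measurable FAZ FA"
  unfolding FA_def using measurable_compose[OF pairX_FAZ measurable_fst] X_funcset
  by (intro measurable_vimage_algebra2) auto

lemma id_FAZ_FZ: "(\<lambda>\<omega>. \<omega>) \<in> measurable FAZ FZ"
  unfolding FZ_def using measurable_compose[OF pairX_FAZ measurable_snd] X_funcset
  by (intro measurable_vimage_algebra2) auto

lemma Alg_FA: "1 \<le> n \<Longrightarrow> Alg n \<in> borel_measurable FA"
  using measurable_compose[OF algX_FA measurable_component_singleton[of n "{1..}"]] by (simp add: algX_def)

lemma Z_FZ: "\<eta> \<le> t \<Longrightarrow> Z t \<in> borel_measurable FZ"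
  using measurable_compose[OF pathX_FZ measurable_component_singleton[of t "{\<eta>..}"]] by (simp add: pathX_def)

lemma Alg_measurable [measurable]: "1 \<le> n \<Longrightarrow> Alg n \<in> borel_measurable M"
  using measurable_compose[OF id_FA Alg_FA] .

lemma prefix_FA: "algs n \<in> measurable FA (prefixM n)"
  by (intro measurable_restrict Alg_FA) simp

lemma prefix_measurable [measurable]: "algs n \<in> measurable M (prefixM n)"
  by (intro measurable_restrict Alg_measurable) simp

lemma prefix_FAZ: "algs n \<in> measurable FAZ (prefixM n)"
  using measurable_compose[OF id_FAZ_FA prefix_FA] .

lemma restrict_prefix_measurable: "m \<le> Suc n \<Longrightarrow> (\<lambda>\<beta>. restrict \<beta> {1..<m}) \<in> measurable (prefixM n) (hist_space m)"
  by (intro measurable_restrict_subset) auto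

lemma eps_measurable:
  assumes "1 \<le> m" "m \<le> Suc n" shows "eps m \<in> borel_measurable (prefixM n)"
  using E assms by (intro measurable_compose[OF restrict_prefix_measurable]) (auto simp: privacy_functions_def)

lemma hist_in_space: "restrict \<beta> {1..<m} \<in> space (hist_space m :: (nat \<Rightarrow> real ^ 'd) measure)"
  by (simp add: space_PiM)

lemma eps_bounds: "1 \<le> m \<Longrightarrow> 0 < eps m \<beta>" "1 \<le> m \<Longrightarrow> eps m \<beta> \<le> \<epsilon>max"
  using E hist_in_space[of \<beta> m] by (auto simp: privacy_functions_def)

lemma eps_mono_Suc: "1 \<le> m \<Longrightarrow> eps m \<beta> \<le> eps (Suc m) \<beta>"
proof -
  assume m: "1 \<le> m"
  have "E m (restrict (restrict \<beta> {1..<Suc m}) {1..<m}) \<le> E (Suc m) (restrict \<beta> {1..<Suc m})"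
    using E hist_in_space[of \<beta> "Suc m"] m unfolding privacy_functions_def by blast
  then show ?thesis by (simp add: restrict_restrict Int_absorb1 Int_absorb2 atLeastLessThan_subset_iff)
qed

lemma eps_mono:
  assumes "1 \<le> m" "m \<le> n" shows "eps m \<beta> \<le> eps n \<beta>"
  using assms(2)
proof (induction n rule: dec_induct)
  case (step n)
  show ?case by (rule order_trans[OF step.IH eps_mono_Suc]) (use assms(1) step in linarith)
qed (rule order_refl)

lemma rat_eps_prefix: "1 \<le> m \<Longrightarrow> m \<le> Suc n \<Longrightarrow> rat_eps E Alg m \<omega> = eps m (algs n \<omega>)"
  unfolding rat_eps_def by (intro arg_cong[where f="E m"]) (auto simp: restrict_def fun_eq_iff)

lemma time_ge_\<eta>: "1 \<le> m \<Longrightarrow> \<eta> \<le> 2 * \<Delta> / eps m \<beta>"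
  using eps_bounds[of m \<beta>] \<Delta>_pos \<epsilon>max_pos by (intro divide_left_mono) auto

lemma Z_right:
  assumes "\<omega> \<in> space M" "\<eta> \<le> t"
  shows "eventually (\<lambda>s. Z s \<omega> = Z t \<omega>) (at_right t)"
proof -
  obtain P Y where A: "compound_laplace M \<eta> P Y" and ZA: "\<And>\<omega> t. \<omega> \<in> space M \<Longrightarrow> \<eta> \<le> t \<Longrightarrow> Z t \<omega> = (\<Sum>n=0..P t \<omega>. Y n \<omega>)"
    by (rule laplace_processE[OF prob_space_axioms \<eta>_pos noise_facts(1)]) blast
  have "eventually (\<lambda>s. P s \<omega> = P t \<omega> \<and> t < s) (at_right t)"
    using compound_laplace.P_right[OF A assms] eventually_at_right_less[of t] by eventually_elim simp
  then show ?thesis by eventually_elim (use assms in \<open>simp add: ZA\<close>)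
qed

text \<open>Evaluation at a time is not measurable on the product \<open>\<sigma>\<close>-algebra of paths; the random time is
  approximated from above by times with countably many values, using that the paths are right
  continuous.\<close>

lemma Z_random_time:
  assumes W: "W \<in> borel_measurable N" "\<And>p. p \<in> space N \<Longrightarrow> \<eta> \<le> W p"
    and \<phi>: "\<phi> \<in> measurable N FZ"
  shows "(\<lambda>p. Z (W p) (\<phi> p)) \<in> borel_measurable N"
proof -
  \<comment> \<open>The smallest multiple of 1 / (k + 1) strictly above s.\<close>
  define D where "D k s = (of_int \<lfloor>s * real (Suc k)\<rfloor> + 1) / real (Suc k)" for k and s :: real
  have D_gt: "s < D k s" for k s
    unfolding D_def by (subst pos_less_divide_eq) linarith+
  have D_le: "D k s \<le> s + 1 / real (Suc k)" for k s
    unfolding D_def by (simp add: add_divide_distrib divide_le_eq)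
  have D_m: "(\<lambda>p. Z (D k (W p)) (\<phi> p)) \<in> borel_measurable N" for k
  proof -
    \<comment> \<open>The maximum with \<eta> keeps every candidate time in the range where
      \<open>Z\<close> is known to be measurable; it has no effect at the index that is actually
      selected.\<close>
    let ?f = "\<lambda>j p. Z (max \<eta> ((of_int j + 1) / real (Suc k))) (\<phi> p)"
    have m1: "(\<lambda>p. ?f \<lfloor>W p * real (Suc k)\<rfloor> p) \<in> borel_measurable N"
    proof (rule measurable_compose_countable[where f="?f" and g="\<lambda>p. \<lfloor>W p * real (Suc k)\<rfloor>"])
      show "?f j \<in> borel_measurable N" for j by (rule measurable_compose[OF \<phi> Z_FZ]) simp
      show "(\<lambda>p. \<lfloor>W p * real (Suc k)\<rfloor>) \<in> measurable N (count_space UNIV)"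
        using W(1) by measurable
    qed
    have eq1: "?f \<lfloor>W p * real (Suc k)\<rfloor> p = Z (D k (W p)) (\<phi> p)" if "p \<in> space N" for p
    proof -
      have "\<eta> \<le> D k (W p)" using W(2)[OF that] D_gt[of "W p" k] by simp
      then show ?thesis by (simp add: D_def max_absorb2)
    qed
    show ?thesis by (rule iffD1[OF measurable_cong[OF eq1] m1])
  qed
  have D_lim: "(\<lambda>k. Z (D k (W p)) (\<phi> p)) \<longlonglongrightarrow> Z (W p) (\<phi> p)" if p: "p \<in> space N" for p
  proof (rule tendsto_eventually)
    have "\<phi> p \<in> space M" using measurable_space[OF \<phi> p] by simp
    then obtain b where b: "W p < b" "\<And>s. W p < s \<Longrightarrow> s < b \<Longrightarrow> Z s (\<phi> p) = Z (W p) (\<phi> p)"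
      using Z_right[OF _ W(2)[OF p]] by (auto simp: eventually_at_right_field)
    have "(\<lambda>k. W p + 1 / real (Suc k)) \<longlonglongrightarrow> W p + 0"
      by (intro tendsto_intros inverse_Suc_tendsto)
    then have "eventually (\<lambda>k. W p + 1 / real (Suc k) < b) sequentially"
      using b(1) by (intro order_tendstoD(2)) auto
    then show "eventually (\<lambda>k. Z (D k (W p)) (\<phi> p) = Z (W p) (\<phi> p)) sequentially"
      by eventually_elim (use b(2) D_gt D_le in \<open>meson order_le_less_trans\<close>)
  qed
  show ?thesis by (rule borel_measurable_LIMSEQ_real[OF D_lim D_m])
qed

section \<open>Halting probabilities for given iterates\<close>

text \<open>The probability over \<open>\<xi>\<close> that round i turns out as halting in round n
  demands, when the iterates are \<beta> and z is the value of the path at the query time of round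
  i.\<close>

definition halt_factor :: "nat \<Rightarrow> (nat \<Rightarrow> real ^ 'd) \<Rightarrow> nat \<Rightarrow> real \<Rightarrow> ennreal" where
  "halt_factor n \<beta> i z = lap_ray (i < n) (4 * \<Delta> / eps i \<beta>) (\<tau> + z - v (\<beta> i))"

text \<open>The conditional probability of halting in round \<open>n\<close> given that the iterates are \<open>\<beta>\<close>.\<close>

definition halt_prob :: "nat \<Rightarrow> (nat \<Rightarrow> real ^ 'd) \<Rightarrow> ennreal" where
  "halt_prob n \<beta> = (\<integral>\<^sup>+\<omega>. (\<Prod>i\<in>{1..n}. halt_factor n \<beta> i (Z (2 * \<Delta> / eps i \<beta>) \<omega>)) \<partial>M)"

lemma component_prefixM: "i \<in> {1..n} \<Longrightarrow> (\<lambda>\<beta>. \<beta> i) \<in> borel_measurable (prefixM n)"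
  by (rule measurable_component_singleton)

lemma halt_factor_le_1: "halt_factor n \<beta> i z \<le> 1"
  unfolding halt_factor_def by (rule lap_ray_le_1)

lemma halt_factor_measurable:
  assumes i: "i \<in> {1..n}" and f: "f \<in> measurable N (prefixM n)" and g [measurable]: "g \<in> borel_measurable N"
  shows "(\<lambda>p. halt_factor n (f p) i (g p)) \<in> borel_measurable N"
proof -
  have [measurable]: "(\<lambda>p. eps i (f p)) \<in> borel_measurable N" "(\<lambda>p. f p i) \<in> borel_measurable N"
    using measurable_compose[OF f eps_measurable[of i n]] measurable_compose[OF f component_prefixM[OF i]] i by auto
  show ?thesis unfolding halt_factor_def by measurable
qed

lemma halt_factor_Z_measurable:
  assumes i: "i \<in> {1..n}" and f: "f \<in> measurable N (prefixM n)" and \<phi>: "\<phi> \<in> measurable N FZ"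
  shows "(\<lambda>p. halt_factor n (f p) i (Z (2 * \<Delta> / eps i (f p)) (\<phi> p))) \<in> borel_measurable N"
proof (intro halt_factor_measurable[OF i f] Z_random_time \<phi>)
  have [measurable]: "(\<lambda>p. eps i (f p)) \<in> borel_measurable N"
    using measurable_compose[OF f eps_measurable[of i n]] i by auto
  show "(\<lambda>p. 2 * \<Delta> / eps i (f p)) \<in> borel_measurable N" by measurable
  show "\<eta> \<le> 2 * \<Delta> / eps i (f p)" for p using i by (intro time_ge_\<eta>) simp
qed

abbreviation "halt \<equiv> rat_halt \<Delta> \<tau> v E Alg Z \<xi>"
abbreviation "is_above \<equiv> rat_above \<Delta> \<tau> v E Alg Z \<xi>"

lemma halt_eq_iff:
  assumes "1 \<le> n"
  shows "halt \<omega> = enat n \<longleftrightarrow> is_above n \<omega> \<and> (\<forall>i\<in>{1..<n}. \<not> is_above i \<omega>)"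
proof -
  define S where "S = {n. 1 \<le> n \<and> is_above n \<omega>}"
  have halt: "halt \<omega> = (INF n\<in>S. enat n)" by (simp only: rat_halt_def S_def)
  have lower: "halt \<omega> \<le> enat i" if "i \<in> S" for i unfolding halt using that by (rule INF_lower)
  show ?thesis
  proof
    assume *: "halt \<omega> = enat n"
    have "S \<noteq> {}"
    proof
      assume "S = {}"
      then have "halt \<omega> = \<infinity>" by (simp only: halt image_empty Inf_enat_def refl if_True)
      then show False using * by simp
    qed
    then obtain i where "i \<in> S" by blast
    \<comment> \<open>In \<open>enat\<close> the infimum of a nonempty set is its least element, so
      the halting round itself belongs to \<open>S\<close>.\<close>
    then have "(LEAST x. x \<in> enat ` S) \<in> enat ` S" by (intro LeastI[of "\<lambda>x. x \<in> enat ` S" "enat i"] imageI)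
    then have "enat n \<in> enat ` S"
      using * \<open>S \<noteq> {}\<close> by (simp only: halt Inf_enat_def image_is_empty if_False)
    then have "n \<in> S" by blast
    moreover have "i \<notin> S" if "i < n" for i
      using lower[of i] * that by auto
    ultimately show "is_above n \<omega> \<and> (\<forall>i\<in>{1..<n}. \<not> is_above i \<omega>)" by (simp add: S_def)
  next
    assume *: "is_above n \<omega> \<and> (\<forall>i\<in>{1..<n}. \<not> is_above i \<omega>)"
    show "halt \<omega> = enat n"
    proof (rule antisym)
      show "halt \<omega> \<le> enat n" using * assms by (intro lower) (simp add: S_def)
      have "n \<le> i" if "i \<in> S" for i
        using * that by (cases "i < n") (auto simp: S_def)
      then show "enat n \<le> halt \<omega>" unfolding halt by (intro INF_greatest) simp
    qed
  qed
qed

lemma above_measurable [measurable]: "1 \<le> n \<Longrightarrow> {\<omega>\<in>space M. is_above n \<omega>} \<in> sets M"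
proof -
  assume n: "1 \<le> n"
  note [measurable] = Alg_measurable[OF n]
  have eq: "rat_eps E Alg n \<omega> = eps n (algs n \<omega>)" for \<omega> using n by (intro rat_eps_prefix) auto
  have [measurable]: "(\<lambda>\<omega>. eps n (algs n \<omega>)) \<in> borel_measurable M"
    using n by (intro measurable_compose[OF prefix_measurable eps_measurable]) auto
  have [measurable]: "(\<lambda>\<omega>. Z (2 * \<Delta> / eps n (algs n \<omega>)) \<omega>) \<in> borel_measurable M"
    by (intro Z_random_time id_FZ time_ge_\<eta> n) measurable
  have [measurable]: "\<xi> n \<in> borel_measurable M"
    using noise_facts(3) n by (auto simp: cond_indep_laplace_def)
  show ?thesis unfolding rat_above_def eq by measurable
qed

lemma halt_eq_measurable [measurable]:
  assumes "1 \<le> n" shows "{\<omega>\<in>space M. halt \<omega> = enat n} \<in> sets M"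
proof -
  have "{\<omega>\<in>space M. \<not> is_above i \<omega>} \<in> sets M" if "1 \<le> i" for i
    using that by (intro sets.sets_Collect_neg above_measurable)
  then show ?thesis
    unfolding halt_eq_iff[OF assms] using assms
    by (intro sets.sets_Collect_conj above_measurable sets.sets_Collect_finite_All) auto
qed

text \<open>The noise \<open>\<xi>\<close> is integrated out conditionally on iterates and path.
  What remains depends on the iterates and the path only, and their independence allows the iterates
  to be frozen at \<beta> while the path is averaged.\<close>

lemma nn_integral_halt:
  assumes n: "1 \<le> n" and f: "f \<in> borel_measurable (prefixM n)"
  shows "(\<integral>\<^sup>+\<omega>. f (algs n \<omega>) * indicator {\<omega>\<in>space M. halt \<omega> = enat n} \<omega> \<partial>M)
    = (\<integral>\<^sup>+\<beta>. f \<beta> * halt_prob n \<beta> \<partial>prefix_law M Alg n)"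
proof -
  interpret product_sigma_finite "\<lambda>_::nat. lborel :: real measure" by standard
  let ?J = "{1..n}"
  \<comment> \<open>The query time is a function of \<beta> and the path a function of \<omega>.
    Keeping the two arguments apart is what allows \<beta> to be frozen after the joint law has been
    split.\<close>
  define \<zeta> where "\<zeta> i \<beta> \<omega> = Z (2 * \<Delta> / eps i \<beta>) \<omega>" for i \<beta> \<omega>
  let ?c = "\<lambda>i \<omega>. \<tau> + \<zeta> i (algs n \<omega>) \<omega> - v (algs n \<omega> i)"
  define G where "G p = f (algs n (fst p)) *
    (\<Prod>i\<in>?J. indicator (ray (i < n) (?c i (fst p))) (snd p i))" for p
  have eps_eq: "rat_eps E Alg i \<omega> = eps i (algs n \<omega>)" if "i \<in> ?J" for i \<omega>
    using that by (intro rat_eps_prefix) auto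
  have eps_m: "(\<lambda>\<omega>. eps i (algs n \<omega>)) \<in> borel_measurable FAZ" if "i \<in> ?J" for i
    using that by (intro measurable_compose[OF prefix_FAZ eps_measurable]) auto
  have \<zeta>_m: "(\<lambda>\<omega>. \<zeta> i (algs n \<omega>) \<omega>) \<in> borel_measurable FAZ" if i: "i \<in> ?J" for i
  proof -
    note [measurable] = eps_m[OF i]
    have "(\<lambda>\<omega>. 2 * \<Delta> / eps i (algs n \<omega>)) \<in> borel_measurable FAZ" by measurable
    then show ?thesis unfolding \<zeta>_def using i
      by (intro Z_random_time id_FAZ_FZ time_ge_\<eta>) simp_all
  qed
  have sub_m: "g \<in> borel_measurable M" if "g \<in> borel_measurable FAZ" for g :: "'w \<Rightarrow> real"
    by (rule measurable_from_subalg[OF subalgebra_FAZ that])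
  have Gm: "G \<in> borel_measurable (FAZ \<Otimes>\<^sub>M borelP ?J)"
    unfolding G_def
  proof (intro borel_measurable_times_ennreal borel_measurable_prod_ennreal)
    show "(\<lambda>p. f (algs n (fst p))) \<in> borel_measurable (FAZ \<Otimes>\<^sub>M borelP ?J)"
      by (rule measurable_compose[OF measurable_compose[OF measurable_fst prefix_FAZ] f])
    fix i assume i: "i \<in> ?J"
    have 1: "(\<lambda>\<omega>. \<tau> + \<zeta> i (algs n \<omega>) \<omega> - v (algs n \<omega> i)) \<in> borel_measurable FAZ"
    proof -
      note [measurable] = \<zeta>_m[OF i]
      have [measurable]: "(\<lambda>\<omega>. algs n \<omega> i) \<in> borel_measurable FAZ"
        by (rule measurable_compose[OF prefix_FAZ component_prefixM[OF i]])
      show ?thesis by measurable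
    qed
    have [measurable]: "(\<lambda>p. \<tau> + \<zeta> i (algs n (fst p)) (fst p) - v (algs n (fst p) i)) \<in> borel_measurable (FAZ \<Otimes>\<^sub>M borelP ?J)"
      by (rule measurable_compose[OF measurable_fst 1])
    have [measurable]: "(\<lambda>p. snd p i) \<in> borel_measurable (FAZ \<Otimes>\<^sub>M borelP ?J)"
      by (rule measurable_compose[OF measurable_snd measurable_component_singleton[OF i]])
    show "(\<lambda>p. indicator (ray (i < n) (?c i (fst p))) (snd p i) :: ennreal)
      \<in> borel_measurable (FAZ \<Otimes>\<^sub>M borelP ?J)"
      by measurable
  qed
  have "(\<integral>\<^sup>+\<omega>. f (algs n \<omega>) * indicator {\<omega>\<in>space M. halt \<omega> = enat n} \<omega> \<partial>M)
    = (\<integral>\<^sup>+\<omega>. G (\<omega>, \<lambda>i\<in>?J. \<xi> i \<omega>) \<partial>M)"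
  proof (rule nn_integral_cong)
    fix \<omega> assume \<omega>: "\<omega> \<in> space M"
    have mem: "\<xi> i \<omega> \<in> ray (i < n) (?c i \<omega>) \<longleftrightarrow> (if i < n then \<not> is_above i \<omega> else is_above i \<omega>)"
      if i: "i \<in> ?J" for i
      using i by (auto simp: ray_def rat_above_def eps_eq[OF i] \<zeta>_def)
    have J: "?J = insert n {1..<n}" using n by auto
    have "(\<forall>i\<in>?J. \<xi> i \<omega> \<in> ray (i < n) (?c i \<omega>))
      \<longleftrightarrow> (\<forall>i\<in>?J. if i < n then \<not> is_above i \<omega> else is_above i \<omega>)"
      by (rule ball_cong[OF refl mem])
    also have "\<dots> \<longleftrightarrow> halt \<omega> = enat n"
      unfolding halt_eq_iff[OF n] J by auto
    finally have all: "(\<forall>i\<in>?J. \<xi> i \<omega> \<in> ray (i < n) (?c i \<omega>))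
      \<longleftrightarrow> halt \<omega> = enat n" .
    have "(\<Prod>i\<in>?J. indicator (ray (i < n) (?c i \<omega>)) (\<xi> i \<omega>) :: ennreal)
      = indicator {\<omega>\<in>space M. halt \<omega> = enat n} \<omega>"
    proof (cases "halt \<omega> = enat n")
      case True
      then show ?thesis using \<omega> all by (auto intro!: prod.neutral)
    next
      case False
      then obtain i where "i \<in> ?J" "\<xi> i \<omega> \<notin> ray (i < n) (?c i \<omega>)"
        using all by blast
      then show ?thesis using False by (subst prod_zero) (auto intro!: bexI[of _ i])
    qed
    moreover have "(\<Prod>i\<in>?J. indicator (ray (i < n) (?c i \<omega>)) ((\<lambda>i\<in>?J. \<xi> i \<omega>) i) :: ennreal)
      = (\<Prod>i\<in>?J. indicator (ray (i < n) (?c i \<omega>)) (\<xi> i \<omega>))"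
      by (intro prod.cong refl) (simp only: restrict_apply if_True)
    ultimately show "f (algs n \<omega>) * indicator {\<omega>\<in>space M. halt \<omega> = enat n} \<omega> = G (\<omega>, \<lambda>i\<in>?J. \<xi> i \<omega>)"
      by (simp only: G_def fst_conv snd_conv)
  qed
  also have "\<dots> = (\<integral>\<^sup>+\<omega>. \<integral>\<^sup>+y. G (\<omega>, y) * (\<Prod>i\<in>?J. lapd (4 * \<Delta> / rat_eps E Alg i \<omega>) (y i)) \<partial>lborelP ?J \<partial>M)"
  proof (rule nn_integral_cond_indep_laplace[OF subalgebra_FAZ noise_facts(3) _ _ _ Gm])
    fix i assume i: "i \<in> ?J"
    note [measurable] = sub_m[OF eps_m[OF i]]
    show "(\<lambda>\<omega>. 4 * \<Delta> / rat_eps E Alg i \<omega>) \<in> borel_measurable M"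
      unfolding eps_eq[OF i] by measurable
  qed auto
  also have "\<dots> = (\<integral>\<^sup>+\<omega>. f (algs n \<omega>) * (\<Prod>i\<in>?J. halt_factor n (algs n \<omega>) i (\<zeta> i (algs n \<omega>) \<omega>)) \<partial>M)"
  proof (rule nn_integral_cong)
    fix \<omega>
    let ?R = "\<lambda>i. ray (i < n) (?c i \<omega>)"
    have "(\<integral>\<^sup>+y. G (\<omega>, y) * (\<Prod>i\<in>?J. lapd (4 * \<Delta> / rat_eps E Alg i \<omega>) (y i)) \<partial>lborelP ?J)
      = (\<integral>\<^sup>+y. f (algs n \<omega>) * (\<Prod>i\<in>?J. indicator (?R i) (y i) * lapd (4 * \<Delta> / eps i (algs n \<omega>)) (y i)) \<partial>lborelP ?J)"
    proof (rule nn_integral_cong)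
      fix y
      have w: "(\<Prod>i\<in>?J. lapd (4 * \<Delta> / rat_eps E Alg i \<omega>) (y i)) = (\<Prod>i\<in>?J. lapd (4 * \<Delta> / eps i (algs n \<omega>)) (y i))"
        by (intro prod.cong refl) (simp only: eps_eq)
      show "G (\<omega>, y) * (\<Prod>i\<in>?J. lapd (4 * \<Delta> / rat_eps E Alg i \<omega>) (y i))
        = f (algs n \<omega>) * (\<Prod>i\<in>?J. indicator (?R i) (y i) * lapd (4 * \<Delta> / eps i (algs n \<omega>)) (y i))"
        by (simp only: G_def fst_conv snd_conv prod.distrib w mult.assoc)
    qed
    also have "\<dots> = f (algs n \<omega>) * (\<integral>\<^sup>+y. (\<Prod>i\<in>?J. indicator (?R i) (y i) * lapd (4 * \<Delta> / eps i (algs n \<omega>)) (y i)) \<partial>lborelP ?J)"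
    proof (intro nn_integral_cmult borel_measurable_prod_ennreal)
      fix i assume i: "i \<in> ?J"
      have "(\<lambda>x. indicator (?R i) x * lapd (4 * \<Delta> / eps i (algs n \<omega>)) x) \<in> borel_measurable lborel" by measurable
      then show "(\<lambda>y. indicator (?R i) (y i) * lapd (4 * \<Delta> / eps i (algs n \<omega>)) (y i)) \<in> borel_measurable (lborelP ?J)"
        by (rule measurable_compose[OF measurable_component_singleton[OF i]])
    qed
    also have "(\<integral>\<^sup>+y. (\<Prod>i\<in>?J. indicator (?R i) (y i) * lapd (4 * \<Delta> / eps i (algs n \<omega>)) (y i)) \<partial>lborelP ?J)
      = (\<Prod>i\<in>?J. \<integral>\<^sup>+y. indicator (?R i) y * lapd (4 * \<Delta> / eps i (algs n \<omega>)) y \<partial>lborel)"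
      by (rule product_nn_integral_prod) auto
    also have "\<dots> = (\<Prod>i\<in>?J. halt_factor n (algs n \<omega>) i (\<zeta> i (algs n \<omega>) \<omega>))"
      by (simp only: halt_factor_def lap_ray_def)
    finally show "(\<integral>\<^sup>+y. G (\<omega>, y) * (\<Prod>i\<in>?J. lapd (4 * \<Delta> / rat_eps E Alg i \<omega>) (y i)) \<partial>lborelP ?J)
      = f (algs n \<omega>) * (\<Prod>i\<in>?J. halt_factor n (algs n \<omega>) i (\<zeta> i (algs n \<omega>) \<omega>))" .
  qed
  also have "\<dots> = (\<integral>\<^sup>+\<beta>. f \<beta> * halt_prob n \<beta> \<partial>prefix_law M Alg n)"
  proof -
    define K where "K p = f (fst p) * (\<Prod>i\<in>?J. halt_factor n (fst p) i (\<zeta> i (fst p) (snd p)))" for p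
    have Km: "K \<in> borel_measurable (prefixM n \<Otimes>\<^sub>M FZ)"
      unfolding K_def \<zeta>_def
      by (intro borel_measurable_times_ennreal borel_measurable_prod_ennreal halt_factor_Z_measurable
          measurable_compose[OF measurable_fst f] measurable_fst measurable_snd)
    let ?PZ = "distr M FZ (\<lambda>\<omega>. \<omega>)"
    interpret PZ: prob_space ?PZ by (rule prob_space_distr[OF id_FZ])
    interpret PA: prob_space "prefix_law M Alg n"
      unfolding prefix_law_def by (rule prob_space_distr[OF prefix_measurable])
    have pm: "(\<lambda>\<omega>. (algs n \<omega>, \<omega>)) \<in> measurable M (prefixM n \<Otimes>\<^sub>M FZ)"
      by (rule measurable_Pair[OF prefix_measurable id_FZ])
    \<comment> \<open>The second coordinate is \<omega> itself, seen through \<open>FZ\<close> only;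
      it stands for the path, and the independence of \<open>FA\<close> and \<open>FZ\<close> gives
      the product form on rectangles.\<close>
    have joint: "prefix_law M Alg n \<Otimes>\<^sub>M ?PZ = distr M (prefixM n \<Otimes>\<^sub>M FZ) (\<lambda>\<omega>. (algs n \<omega>, \<omega>))"
    proof (rule pair_measure_eqI)
      show "sigma_finite_measure (prefix_law M Alg n)" "sigma_finite_measure ?PZ" by unfold_locales
      show "sets (prefix_law M Alg n \<Otimes>\<^sub>M ?PZ) = sets (distr M (prefixM n \<Otimes>\<^sub>M FZ) (\<lambda>\<omega>. (algs n \<omega>, \<omega>)))"
        unfolding sets_distr by (rule sets_pair_measure_cong) (simp_all only: prefix_law_def sets_distr)
      fix A B assume "A \<in> sets (prefix_law M Alg n)" "B \<in> sets ?PZ"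
      then have A: "A \<in> sets (prefixM n)" and B: "B \<in> sets FZ" by (simp_all add: prefix_law_def)
      have a: "algs n -` A \<inter> space M \<in> sets FA"
        using measurable_sets[OF prefix_FA A] by simp
      have "emeasure (distr M (prefixM n \<Otimes>\<^sub>M FZ) (\<lambda>\<omega>. (algs n \<omega>, \<omega>))) (A \<times> B)
        = emeasure M ((algs n -` A \<inter> space M) \<inter> B)"
        using sets.sets_into_space[OF B]
        by (subst emeasure_distr[OF pm pair_measureI[OF A B]]) (auto intro!: arg_cong[where f="emeasure M"])
      also have "\<dots> = emeasure (prefix_law M Alg n) A * emeasure ?PZ B"
        unfolding prefix_law_def emeasure_distr[OF prefix_measurable A] emeasure_distr[OF id_FZ B]
        using indep_setD[OF noise_facts(2) a B] sets.sets_into_space[OF B]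
        by (simp add: emeasure_eq_measure ennreal_mult Int_absorb2)
      finally show "emeasure (prefix_law M Alg n) A * emeasure ?PZ B
        = emeasure (distr M (prefixM n \<Otimes>\<^sub>M FZ) (\<lambda>\<omega>. (algs n \<omega>, \<omega>))) (A \<times> B)" by simp
    qed
    have "(\<integral>\<^sup>+\<omega>. f (algs n \<omega>) * (\<Prod>i\<in>?J. halt_factor n (algs n \<omega>) i (\<zeta> i (algs n \<omega>) \<omega>)) \<partial>M)
      = (\<integral>\<^sup>+p. K p \<partial>distr M (prefixM n \<Otimes>\<^sub>M FZ) (\<lambda>\<omega>. (algs n \<omega>, \<omega>)))"
      using Km by (subst nn_integral_distr[OF pm]) (simp_all only: K_def fst_conv snd_conv measurable_distr_eq1)
    also have "\<dots> = (\<integral>\<^sup>+\<beta>. \<integral>\<^sup>+\<omega>. K (\<beta>, \<omega>) \<partial>?PZ \<partial>prefix_law M Alg n)"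
    proof -
      have "K \<in> borel_measurable (prefix_law M Alg n \<Otimes>\<^sub>M ?PZ)"
        unfolding joint using Km by (simp only: measurable_distr_eq1)
      then show ?thesis unfolding joint[symmetric] by (rule PZ.nn_integral_fst[symmetric])
    qed
    also have "\<dots> = (\<integral>\<^sup>+\<beta>. f \<beta> * halt_prob n \<beta> \<partial>prefix_law M Alg n)"
    proof (rule nn_integral_cong)
      fix \<beta> assume "\<beta> \<in> space (prefix_law M Alg n)"
      then have \<beta>: "\<beta> \<in> space (prefixM n)" by (simp add: prefix_law_def)
      have Kb: "(\<lambda>\<omega>. \<Prod>i\<in>?J. halt_factor n \<beta> i (\<zeta> i \<beta> \<omega>)) \<in> borel_measurable FZ"
        unfolding \<zeta>_def by (intro borel_measurable_prod_ennreal halt_factor_Z_measurable measurable_const \<beta> measurable_ident_sets refl)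
      have "(\<integral>\<^sup>+\<omega>. K (\<beta>, \<omega>) \<partial>?PZ) = f \<beta> * (\<integral>\<^sup>+\<omega>. (\<Prod>i\<in>?J. halt_factor n \<beta> i (\<zeta> i \<beta> \<omega>)) \<partial>?PZ)"
        unfolding K_def fst_conv snd_conv using Kb by (intro nn_integral_cmult) simp
      also have "(\<integral>\<^sup>+\<omega>. (\<Prod>i\<in>?J. halt_factor n \<beta> i (\<zeta> i \<beta> \<omega>)) \<partial>?PZ) = halt_prob n \<beta>"
        unfolding halt_prob_def \<zeta>_def[symmetric] using Kb by (subst nn_integral_distr[OF id_FZ]) simp_all
      finally show "(\<integral>\<^sup>+\<omega>. K (\<beta>, \<omega>) \<partial>?PZ) = f \<beta> * halt_prob n \<beta>" .
    qed
    finally show ?thesis .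
  qed
  finally show ?thesis .
qed

lemma halt_prob_measurable: "halt_prob n \<in> borel_measurable (prefixM n)"
proof -
  have "(\<lambda>p. \<Prod>i\<in>{1..n}. halt_factor n (fst p) i (Z (2 * \<Delta> / eps i (fst p)) (snd p))) \<in> borel_measurable (prefixM n \<Otimes>\<^sub>M M)"
    by (intro borel_measurable_prod_ennreal halt_factor_Z_measurable measurable_fst measurable_compose[OF measurable_snd id_FZ])
  then show ?thesis unfolding halt_prob_def[abs_def]
    by (intro borel_measurable_nn_integral) (simp add: case_prod_beta)
qed

end

section \<open>Privacy loss of the full output\<close>

abbreviation "dens1 \<mu> \<nu> \<equiv> RN_deriv (sum_law \<mu> \<nu>) \<mu>"
abbreviation "dens2 \<mu> \<nu> \<equiv> RN_deriv (sum_law \<mu> \<nu>) \<nu>"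

lemma finite_measure_sum_law:
  assumes "finite_measure \<mu>" "finite_measure \<nu>" "sets \<nu> = sets \<mu>"
  shows "finite_measure (sum_law \<mu> \<nu>)"
proof (rule finite_measureI)
  interpret A: finite_measure \<mu> by fact
  interpret B: finite_measure \<nu> by fact
  have "space (sum_law \<mu> \<nu>) = space \<mu>" by (intro sets_eq_imp_space_eq) simp
  then show "emeasure (sum_law \<mu> \<nu>) (space (sum_law \<mu> \<nu>)) \<noteq> \<infinity>"
    using emeasure_sum_law[OF assms(3) sets.top] by (simp add: ennreal_add_eq_top)
qed

lemma density_RN_deriv_sum_law:
  assumes "finite_measure \<mu>" "finite_measure \<nu>" "sets \<nu> = sets \<mu>"
  shows "density (sum_law \<mu> \<nu>) (dens1 \<mu> \<nu>) = \<mu>"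
    and "density (sum_law \<mu> \<nu>) (dens2 \<mu> \<nu>) = \<nu>"
    and "AE y in sum_law \<mu> \<nu>. dens1 \<mu> \<nu> y \<noteq> \<infinity> \<and> dens2 \<mu> \<nu> y \<noteq> \<infinity>"
proof -
  interpret A: finite_measure \<mu> by fact
  interpret B: finite_measure \<nu> by fact
  interpret S: finite_measure "sum_law \<mu> \<nu>" by (rule finite_measure_sum_law[OF assms])
  have ac: "absolutely_continuous (sum_law \<mu> \<nu>) \<mu>" "absolutely_continuous (sum_law \<mu> \<nu>) \<nu>"
    unfolding absolutely_continuous_def
  proof safe
    fix A assume "A \<in> null_sets (sum_law \<mu> \<nu>)"
    then have A: "A \<in> sets \<mu>" "emeasure (sum_law \<mu> \<nu>) A = 0" by (simp_all add: null_sets_def)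
    then have "emeasure \<mu> A = 0 \<and> emeasure \<nu> A = 0" using emeasure_sum_law[OF assms(3) A(1)] by simp
    then show "A \<in> null_sets \<mu>" "A \<in> null_sets \<nu>" using A(1) assms(3) by (simp_all add: null_sets_def)
  qed
  have s: "sets \<mu> = sets (sum_law \<mu> \<nu>)" "sets \<nu> = sets (sum_law \<mu> \<nu>)" using assms(3) by simp_all
  show "density (sum_law \<mu> \<nu>) (dens1 \<mu> \<nu>) = \<mu>"
    by (rule S.density_RN_deriv[OF ac(1) s(1)])
  show "density (sum_law \<mu> \<nu>) (dens2 \<mu> \<nu>) = \<nu>"
    by (rule S.density_RN_deriv[OF ac(2) s(2)])
  show "AE y in sum_law \<mu> \<nu>. dens1 \<mu> \<nu> y \<noteq> \<infinity> \<and> dens2 \<mu> \<nu> y \<noteq> \<infinity>"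
    using S.RN_deriv_finite[OF A.sigma_finite_measure_axioms ac(1) s(1)]
      S.RN_deriv_finite[OF B.sigma_finite_measure_axioms ac(2) s(2)]
    by (rule AE_conjI)
qed

lemma privacy_loss_measurable: "privacy_loss \<mu> \<nu> \<in> borel_measurable \<mu>"
proof -
  have [measurable]: "dens1 \<mu> \<nu> \<in> borel_measurable \<mu>" "dens2 \<mu> \<nu> \<in> borel_measurable \<mu>"
    using borel_measurable_RN_deriv[of "sum_law \<mu> \<nu>"] by (simp_all cong: measurable_cong_sets)
  show ?thesis unfolding privacy_loss_def[abs_def] Let_def by measurable
qed

text \<open>The values that \<open>privacy_loss\<close> takes where a density vanishes are
  compatible with this equivalence, so a bound on the loss can be treated as an inequality between
  densities without exceptional points other than infinite densities.\<close>

lemma privacy_loss_le_iff: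
  fixes a :: real
  assumes "dens1 \<mu> \<nu> y \<noteq> \<infinity>" "dens2 \<mu> \<nu> y \<noteq> \<infinity>"
  shows "privacy_loss \<mu> \<nu> y \<le> ereal a
    \<longleftrightarrow> dens1 \<mu> \<nu> y \<le> ennreal (exp a) * dens2 \<mu> \<nu> y"
proof -
  obtain p q where p: "dens1 \<mu> \<nu> y = ennreal p" "0 \<le> p"
    and q: "dens2 \<mu> \<nu> y = ennreal q" "0 \<le> q"
    using assms by (cases "dens1 \<mu> \<nu> y"; cases "dens2 \<mu> \<nu> y") auto
  show ?thesis
  proof (cases "p = 0 \<or> q = 0")
    case True
    then show ?thesis using p q by (auto simp: privacy_loss_def Let_def)
  next
    case False
    then have pos: "0 < p" "0 < q" using p q by auto
    have "ln (p / q) \<le> a \<longleftrightarrow> p / q \<le> exp a"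
      using pos exp_le_cancel_iff[of "ln (p / q)" a] by (simp add: exp_ln)
    also have "\<dots> \<longleftrightarrow> p \<le> exp a * q" using pos by (simp add: pos_divide_le_eq)
    finally show ?thesis using p q pos by (simp add: privacy_loss_def Let_def flip: ennreal_mult)
  qed
qed

text \<open>On the set in question the density of \<mu> strictly exceeds exp a times that of \<nu>,
  almost everywhere for the sum of the laws. Domination on this very set gives the opposite
  inequality of the integrals, which is possible only if the set is null.\<close>

lemma privacy_loss_exceeds_null:
  assumes fin: "finite_measure \<mu>" "finite_measure \<nu>" "sets \<nu> = sets \<mu>"
    and a: "a \<in> borel_measurable \<mu>" "\<And>y. a y \<le> C" and G: "G \<in> sets \<mu>"
    and dom: "\<And>S. S \<in> sets \<mu> \<Longrightarrow> S \<subseteq> G \<Longrightarrow> emeasure \<mu> S \<le> (\<integral>\<^sup>+y. ennreal (exp (a y)) * indicator S y \<partial>\<nu>)"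
  shows "emeasure \<mu> {y\<in>G. ereal (a y) < privacy_loss \<mu> \<nu> y} = 0"
proof -
  let ?\<rho> = "sum_law \<mu> \<nu>"
  define p where "p = RN_deriv ?\<rho> \<mu>"
  define q where "q = RN_deriv ?\<rho> \<nu>"
  note D = density_RN_deriv_sum_law[OF fin, folded p_def q_def]
  interpret B: finite_measure \<nu> by fact
  have am [measurable]: "a \<in> borel_measurable ?\<rho>" using a(1) by (simp cong: measurable_cong_sets)
  have pm [measurable]: "p \<in> borel_measurable ?\<rho>" "q \<in> borel_measurable ?\<rho>" unfolding p_def q_def by auto
  define S where "S = {y\<in>G. ereal (a y) < privacy_loss \<mu> \<nu> y}"
  have S: "S \<in> sets \<mu>"
  proof -
    note [measurable] = privacy_loss_measurable[of \<mu> \<nu>] a(1) G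
    have "{y\<in>space \<mu>. y \<in> G \<and> ereal (a y) < privacy_loss \<mu> \<nu> y} \<in> sets \<mu>" by measurable
    also have "{y\<in>space \<mu>. y \<in> G \<and> ereal (a y) < privacy_loss \<mu> \<nu> y} = S"
      unfolding S_def using sets.sets_into_space[OF G] by auto
    finally show ?thesis .
  qed
  have S\<rho> [measurable]: "S \<in> sets ?\<rho>" using S by simp
  define l where "l y = ennreal (exp (a y)) * q y * indicator S y" for y
  define r where "r y = p y * indicator S y" for y
  have lr_m: "l \<in> borel_measurable ?\<rho>" "r \<in> borel_measurable ?\<rho>" unfolding l_def r_def by measurable
  have ae: "AE y in ?\<rho>. y \<in> S \<longrightarrow> l y < r y"
    using D(3)
  proof eventually_elim
    case (elim y)
    show ?case
    proof
      assume y: "y \<in> S"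
      then have "\<not> privacy_loss \<mu> \<nu> y \<le> ereal (a y)" by (simp add: S_def not_le)
      then have "\<not> p y \<le> ennreal (exp (a y)) * q y"
        using privacy_loss_le_iff[of \<mu> \<nu> y "a y"] elim by (simp add: p_def q_def)
      then show "l y < r y" using y by (simp add: l_def r_def not_le)
    qed
  qed
  have eq_r: "(\<integral>\<^sup>+y. r y \<partial>?\<rho>) = emeasure \<mu> S"
    unfolding r_def using pm(1) S\<rho> by (subst emeasure_density[symmetric]) (simp_all add: D(1))
  have eq_l: "(\<integral>\<^sup>+y. l y \<partial>?\<rho>) = (\<integral>\<^sup>+y. ennreal (exp (a y)) * indicator S y \<partial>\<nu>)"
  proof -
    have "(\<integral>\<^sup>+y. ennreal (exp (a y)) * indicator S y \<partial>density ?\<rho> q) = (\<integral>\<^sup>+y. q y * (ennreal (exp (a y)) * indicator S y) \<partial>?\<rho>)"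
      by (rule nn_integral_density) measurable
    then show ?thesis unfolding D(2) l_def by (simp add: ac_simps)
  qed
  have le: "(\<integral>\<^sup>+y. r y \<partial>?\<rho>) \<le> (\<integral>\<^sup>+y. l y \<partial>?\<rho>)"
    unfolding eq_r eq_l using S by (intro dom) (auto simp: S_def)
  \<comment> \<open>The upper bound \<open>C\<close> on a makes the smaller integral finite; with
    infinite integrals a strict pointwise inequality would give no contradiction.\<close>
  have "(\<integral>\<^sup>+y. l y \<partial>?\<rho>) \<le> (\<integral>\<^sup>+y. ennreal (exp C) \<partial>\<nu>)"
    unfolding eq_l using a(2) by (intro nn_integral_mono) (auto split: split_indicator intro!: ennreal_leI)
  also have "\<dots> < \<infinity>" by (simp add: B.emeasure_eq_measure ennreal_mult_less_top)
  finally have fin_l: "(\<integral>\<^sup>+y. l y \<partial>?\<rho>) \<noteq> \<infinity>" by simp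
  have ae_le: "AE y in ?\<rho>. l y \<le> r y"
    using ae by eventually_elim (auto simp: l_def r_def split: split_indicator)
  have "AE y in ?\<rho>. r y \<le> l y"
  proof (rule ccontr)
    assume "\<not> (AE y in ?\<rho>. r y \<le> l y)"
    from nn_integral_less[OF lr_m fin_l ae_le this] le show False by simp
  qed
  then have "AE y in ?\<rho>. y \<notin> S" using ae by eventually_elim auto
  then have "emeasure ?\<rho> S = 0"
    using sets.sets_into_space[OF S\<rho>] by (subst (asm) AE_iff_measurable[OF S\<rho>]) auto
  then show ?thesis using emeasure_sum_law[OF fin(3) S] by (simp add: S_def)
qed

section \<open>The output as a function of halting round and iterates\<close>

abbreviation outM :: "(nat \<Rightarrow> (real ^ 'd) \<times> bool) measure" where
  "outM \<equiv> PiM {1..} (\<lambda>_. borel \<Otimes>\<^sub>M count_space UNIV)"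

text \<open>The value of \<open>rat_output\<close> on a run with iterates \<beta> that halts in
  round n; \<open>iterates n\<close> recovers \<beta> from it, so no information is added or
  lost.\<close>

definition pad :: "nat \<Rightarrow> (nat \<Rightarrow> real ^ 'd) \<Rightarrow> nat \<Rightarrow> (real ^ 'd) \<times> bool" where
  "pad n \<beta> = (\<lambda>i\<in>{1..}. if i \<le> n then (\<beta> i, i = n) else (0, False))"

definition iterates :: "nat \<Rightarrow> (nat \<Rightarrow> (real ^ 'd) \<times> bool) \<Rightarrow> nat \<Rightarrow> real ^ 'd" where
  "iterates n y = (\<lambda>i\<in>{1..n}. fst (y i))"

definition halt_set :: "nat \<Rightarrow> (nat \<Rightarrow> (real ^ 'd) \<times> bool) set" where
  "halt_set n = {y\<in>space outM. \<forall>i\<in>{1..}. snd (y i) \<longleftrightarrow> i = n}"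

lemma pad_measurable: "pad n \<in> measurable (PiM {1..n} (\<lambda>_. borel)) outM"
  unfolding pad_def
proof (rule measurable_restrict)
  fix i :: nat assume i: "i \<in> {1..}"
  show "(\<lambda>\<beta>. if i \<le> n then (\<beta> i, i = n) else (0, False)) \<in> measurable (PiM {1..n} (\<lambda>_. borel)) (borel \<Otimes>\<^sub>M count_space UNIV)"
  proof (cases "i \<le> n")
    case True
    then have "i \<in> {1..n}" using i by simp
    then show ?thesis using True by simp
  qed simp
qed

lemma out_component: "i \<ge> 1 \<Longrightarrow> (\<lambda>y. y i) \<in> measurable outM (borel \<Otimes>\<^sub>M count_space UNIV)"
  by (rule measurable_component_singleton) simp

lemma iterates_measurable: "iterates n \<in> measurable outM (PiM {1..n} (\<lambda>_. borel))"
  unfolding iterates_def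
  by (intro measurable_restrict measurable_compose[OF out_component measurable_fst]) simp

lemma halt_set_measurable: "halt_set n \<in> sets (outM :: (nat \<Rightarrow> (real ^ 'd) \<times> bool) measure)"
proof -
  have "{y\<in>space outM. 1 \<le> i \<longrightarrow> (snd (y i) \<longleftrightarrow> i = n)} \<in> sets (outM :: (nat \<Rightarrow> (real ^ 'd) \<times> bool) measure)" for i
  proof (cases "1 \<le> i")
    case True
    have [measurable]: "(\<lambda>y. snd (y i)) \<in> measurable (outM :: (nat \<Rightarrow> (real ^ 'd) \<times> bool) measure) (count_space UNIV)"
      by (rule measurable_compose[OF out_component[OF True] measurable_snd])
    show ?thesis by measurable
  qed simp
  then have "{y\<in>space outM. \<forall>i. 1 \<le> i \<longrightarrow> (snd (y i) \<longleftrightarrow> i = n)} \<in> sets (outM :: (nat \<Rightarrow> (real ^ 'd) \<times> bool) measure)"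
    by (rule sets.sets_Collect_countable_All)
  then show ?thesis by (simp only: halt_set_def Ball_def atLeast_iff)
qed

lemma iterates_pad: "\<beta> \<in> space (PiM {1..n} (\<lambda>_. borel)) \<Longrightarrow> iterates n (pad n \<beta>) = \<beta>"
  unfolding space_PiM by (rule PiE_ext[of _ "{1..n}" "\<lambda>_. UNIV"]) (simp_all add: iterates_def pad_def)

context rat_run
begin

abbreviation "output \<equiv> rat_output \<Delta> \<tau> v E Alg Z \<xi>"
abbreviation "law \<equiv> rat_law M \<Delta> \<tau> v E Alg Z \<xi>"

lemma snd_output: "1 \<le> i \<Longrightarrow> snd (output \<omega> i) \<longleftrightarrow> halt \<omega> = enat i"
  by (cases "halt \<omega> = enat i") (auto simp: rat_output_def)

lemma output_eq_pad: "halt \<omega> = enat n \<Longrightarrow> output \<omega> = pad n (algs n \<omega>)"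
  unfolding rat_output_def pad_def by (rule restrict_ext) simp

lemma halt_ge_measurable: "{\<omega>\<in>space M. enat n \<le> halt \<omega>} \<in> sets M"
proof -
  have "enat n \<le> halt \<omega> \<longleftrightarrow> (\<forall>i\<in>{1..<n}. \<not> is_above i \<omega>)" for \<omega>
  proof
    assume *: "enat n \<le> halt \<omega>"
    show "\<forall>i\<in>{1..<n}. \<not> is_above i \<omega>"
    proof (intro ballI notI)
      fix i assume i: "i \<in> {1..<n}" "is_above i \<omega>"
      then have "halt \<omega> \<le> enat i" unfolding rat_halt_def by (intro INF_lower) simp
      then show False using * i by (meson atLeastLessThan_iff enat_ord_simps(1) leD order_trans)
    qed
  next
    assume "\<forall>i\<in>{1..<n}. \<not> is_above i \<omega>"
    then have "n \<le> i" if "i \<in> {n. 1 \<le> n \<and> is_above n \<omega>}" for i using that by (cases "i < n") auto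
    then show "enat n \<le> halt \<omega>" unfolding rat_halt_def by (intro INF_greatest) simp
  qed
  moreover have "{\<omega>\<in>space M. \<forall>i\<in>{1..<n}. \<not> is_above i \<omega>} \<in> sets M"
    by (intro sets.sets_Collect_finite_All sets.sets_Collect_neg above_measurable) auto
  ultimately show ?thesis by simp
qed

lemma output_measurable: "output \<in> measurable M outM"
proof -
  have "(\<lambda>\<omega>. \<lambda>n\<in>{1..}. if enat n \<le> halt \<omega> then (Alg n \<omega>, enat n = halt \<omega>) else (0, False)) \<in> measurable M outM"
  proof (rule measurable_restrict)
    fix n :: nat assume "n \<in> {1..}"
    then have n: "1 \<le> n" by simp
    have ge: "Measurable.pred M (\<lambda>\<omega>. enat n \<le> halt \<omega>)"
      using halt_ge_measurable[of n] by (simp only: pred_def)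
    have eq: "Measurable.pred M (\<lambda>\<omega>. enat n = halt \<omega>)"
      using halt_eq_measurable[OF n] by (simp only: pred_def eq_commute[of "enat n"])
    show "(\<lambda>\<omega>. if enat n \<le> halt \<omega> then (Alg n \<omega>, enat n = halt \<omega>) else (0, False)) \<in> measurable M (borel \<Otimes>\<^sub>M count_space UNIV)"
      by (rule measurable_If[OF measurable_Pair[OF Alg_measurable[OF n] eq] _ ge[unfolded pred_def]])
        (simp add: space_pair_measure)
  qed
  then show ?thesis by (simp only: rat_output_def[abs_def])
qed

lemma output_in_halt_set:
  assumes \<omega>: "\<omega> \<in> space M" and n: "1 \<le> n"
  shows "output \<omega> \<in> halt_set n \<longleftrightarrow> halt \<omega> = enat n"
proof -
  have "output \<omega> \<in> halt_set n \<longleftrightarrow> (\<forall>i\<in>{1..}. snd (output \<omega> i) \<longleftrightarrow> i = n)"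
    using measurable_space[OF output_measurable \<omega>] by (simp only: halt_set_def mem_Collect_eq simp_thms)
  also have "\<dots> \<longleftrightarrow> (\<forall>i\<in>{1..}. halt \<omega> = enat i \<longleftrightarrow> i = n)"
    by (intro ball_cong refl) (simp add: snd_output)
  also have "\<dots> \<longleftrightarrow> halt \<omega> = enat n"
  proof
    assume "\<forall>i\<in>{1..}. halt \<omega> = enat i \<longleftrightarrow> i = n"
    from bspec[OF this, of n] n show "halt \<omega> = enat n" by simp
  qed auto
  finally show ?thesis .
qed

text \<open>On a run that halts in round n the output is \<open>pad n\<close> of the first n
  iterates. The law of the output on \<open>halt_set n\<close> is thus the image of the prefix law,
  weighted with the halting probability.\<close>

lemma nn_integral_law:
  assumes n: "1 \<le> n" and f: "f \<in> borel_measurable outM"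
  shows "(\<integral>\<^sup>+y. f y * indicator (halt_set n) y \<partial>law) = (\<integral>\<^sup>+\<beta>. f (pad n \<beta>) * halt_prob n \<beta> \<partial>prefix_law M Alg n)"
proof -
  have "(\<integral>\<^sup>+y. f y * indicator (halt_set n) y \<partial>law) = (\<integral>\<^sup>+\<omega>. f (output \<omega>) * indicator (halt_set n) (output \<omega>) \<partial>M)"
    unfolding rat_law_def
    by (rule nn_integral_distr[OF output_measurable])
      (simp only: measurable_distr_eq1, intro borel_measurable_times_ennreal f borel_measurable_indicator halt_set_measurable)
  also have "\<dots> = (\<integral>\<^sup>+\<omega>. f (pad n (algs n \<omega>)) * indicator {\<omega>\<in>space M. halt \<omega> = enat n} \<omega> \<partial>M)"
  proof (rule nn_integral_cong)
    fix \<omega> assume \<omega>: "\<omega> \<in> space M"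
    show "f (output \<omega>) * indicator (halt_set n) (output \<omega>)
      = f (pad n (algs n \<omega>)) * indicator {\<omega>\<in>space M. halt \<omega> = enat n} \<omega>"
    proof (cases "halt \<omega> = enat n")
      case True
      then have "output \<omega> \<in> halt_set n" using output_in_halt_set[OF \<omega> n] by simp
      then have "indicator (halt_set n) (output \<omega>) = (1 :: ennreal)"
        "indicator {\<omega>\<in>space M. halt \<omega> = enat n} \<omega> = (1 :: ennreal)"
        using True \<omega> by (simp_all add: indicator_def)
      then show ?thesis by (simp only: output_eq_pad[OF True])
    next
      case False
      then have "output \<omega> \<notin> halt_set n" using output_in_halt_set[OF \<omega> n] by simp
      then show ?thesis using False by (simp add: indicator_def)
    qed
  qed
  also have "\<dots> = (\<integral>\<^sup>+\<beta>. f (pad n \<beta>) * halt_prob n \<beta> \<partial>prefix_law M Alg n)"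
    by (rule nn_integral_halt[OF n measurable_compose[OF pad_measurable f]])
  finally show ?thesis .
qed

end

section \<open>Comparison of two neighbouring runs\<close>

text \<open>Both runs live on the same probability space, but no relation between their iterates or
  noises is assumed; they share the privacy functions, and the utilities differ by at most \<Delta>
  at every point.\<close>

locale rat_pair = A: rat_run M \<Delta> \<epsilon>max \<tau> v E Alg Z \<xi> + B: rat_run M \<Delta> \<epsilon>max \<tau> v' E Alg' Z' \<xi>'
  for M :: "'w measure" and \<Delta> \<epsilon>max \<tau> :: real and v v' :: "real ^ 'd \<Rightarrow> real"
    and E :: "nat \<Rightarrow> (nat \<Rightarrow> real ^ 'd) \<Rightarrow> real" and Alg Alg' :: "nat \<Rightarrow> 'w \<Rightarrow> real ^ 'd"
    and Z Z' :: "real \<Rightarrow> 'w \<Rightarrow> real" and \<xi> \<xi>' :: "nat \<Rightarrow> 'w \<Rightarrow> real" +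
  assumes v_close: "\<bar>v b - v' b\<bar> \<le> \<Delta>"
begin

text \<open>When the path value is raised by \<Delta>, the threshold for \<open>\<xi>\<close> in the
  second run is at least the old one, which favours not halting, and exceeds it by at most 2
  \<Delta>, which in round n costs exp (2 \<Delta> / (4 \<Delta> / eps_n)) = exp (eps_n /
  2).\<close>

lemma halt_factor_shift:
  assumes "i \<in> {1..n}"
  shows "(if i = n then ennreal (exp (- (A.eps n \<beta> / 2))) else 1) * A.halt_factor n \<beta> i z \<le> B.halt_factor n \<beta> i (z + \<Delta>)"
proof (cases "i = n")
  case True
  define e where "e = A.eps n \<beta>"
  have e: "0 < e" using A.eps_bounds(1)[of n \<beta>] assms by (simp add: e_def)
  have "lap_ray False (4 * \<Delta> / e) (\<tau> + z - v (\<beta> n))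
    \<le> ennreal (exp (2 * \<Delta> / (4 * \<Delta> / e))) * lap_ray False (4 * \<Delta> / e) (\<tau> + (z + \<Delta>) - v' (\<beta> n))"
    using e A.\<Delta>_pos v_close[of "\<beta> n"] by (intro lap_ray_shift) (auto simp: abs_le_iff)
  also have "2 * \<Delta> / (4 * \<Delta> / e) = e / 2" using A.\<Delta>_pos by (simp add: field_simps)
  finally have "ennreal (exp (- (e / 2))) * lap_ray False (4 * \<Delta> / e) (\<tau> + z - v (\<beta> n))
    \<le> ennreal (exp (- (e / 2))) * (ennreal (exp (e / 2)) * lap_ray False (4 * \<Delta> / e) (\<tau> + (z + \<Delta>) - v' (\<beta> n)))"
    by (intro mult_left_mono) auto
  also have "\<dots> = lap_ray False (4 * \<Delta> / e) (\<tau> + (z + \<Delta>) - v' (\<beta> n))"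
    by (simp add: mult.assoc[symmetric] ennreal_mult[symmetric] exp_minus)
  finally show ?thesis using True by (simp add: A.halt_factor_def B.halt_factor_def e_def)
next
  case False
  then have "i < n" using assms by simp
  moreover have "\<tau> + z - v (\<beta> i) \<le> \<tau> + (z + \<Delta>) - v' (\<beta> i)" using v_close[of "\<beta> i"] by (simp add: abs_le_iff)
  ultimately show ?thesis using False
    by (simp add: A.halt_factor_def B.halt_factor_def lap_ray_mono)
qed

text \<open>For fixed \<beta> the query times are constants, so \<open>laplace_process_shift\<close>
  applies to them with the smallest one, 2 \<Delta> / eps_n, as lower bound. Its factor exp (eps_n /
  2) combines with that of \<open>halt_factor_shift\<close>.\<close>

lemma halt_prob_le:
  assumes n: "1 \<le> n"
  shows "A.halt_prob n \<beta> \<le> ennreal (exp (A.eps n \<beta>)) * B.halt_prob n \<beta>"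
proof -
  define e where "e = A.eps n \<beta>"
  have e: "0 < e" using A.eps_bounds(1)[of n \<beta>] n by (simp add: e_def)
  define K where "K = ennreal (exp (- (e / 2)))"
  let ?t = "\<lambda>i. 2 * \<Delta> / A.eps i \<beta>"
  \<comment> \<open>The cost of moving \<open>\<xi>\<close> is put as a factor at most 1 on the
    left, because \<open>laplace_process_shift\<close> needs test functions bounded by 1.\<close>
  define g where "g i z = (if i = n then K else 1) * A.halt_factor n \<beta> i z" for i z
  have K1: "K \<le> 1" unfolding K_def using e by simp
  have Am: "A.halt_factor n \<beta> i \<in> borel_measurable borel" for i
    unfolding A.halt_factor_def[abs_def] by measurable
  have Bm: "B.halt_factor n \<beta> i \<in> borel_measurable borel" for i
    unfolding B.halt_factor_def[abs_def] by measurable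
  have prob: "prob_space M" by (rule A.prob_space_axioms)
  have "(\<integral>\<^sup>+\<omega>. (\<Prod>i\<in>{1..n}. g i (Z (?t i) \<omega>)) \<partial>M)
    \<le> ennreal (exp (\<bar>\<Delta>\<bar> / (2 * \<Delta> / e))) * (\<integral>\<^sup>+\<omega>. (\<Prod>i\<in>{1..n}. B.halt_factor n \<beta> i (Z' (?t i) \<omega>)) \<partial>M)"
  proof (rule laplace_process_shift[OF prob prob A.\<eta>_pos A.noise_facts(1) B.noise_facts(1)])
    show "2 * \<Delta> / e \<le> ?t i" if "i \<in> {1..n}" for i
      unfolding e_def using that A.eps_mono[of i n \<beta>] A.eps_bounds(1)[of i \<beta>] A.\<Delta>_pos
      by (intro divide_left_mono) auto
    show "2 * \<Delta> / \<epsilon>max \<le> 2 * \<Delta> / e" unfolding e_def by (rule A.time_ge_\<eta>[OF n])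
    show "g i \<in> borel_measurable borel" for i unfolding g_def[abs_def]
      by (intro borel_measurable_times_ennreal Am) simp
    show "B.halt_factor n \<beta> i \<in> borel_measurable borel" for i by (rule Bm)
    show "g i z \<le> 1" for i z
      unfolding g_def using mult_mono[OF K1 A.halt_factor_le_1, of n \<beta> i z] A.halt_factor_le_1[of n \<beta> i z]
      by (cases "i = n") simp_all
    show "B.halt_factor n \<beta> i z \<le> 1" for i z by (rule B.halt_factor_le_1)
    show "g i z \<le> B.halt_factor n \<beta> i (z + \<Delta>)" if "i \<in> {1..n}" for i z
      unfolding g_def K_def e_def by (rule halt_factor_shift[OF that])
  qed simp
  also have "\<bar>\<Delta>\<bar> / (2 * \<Delta> / e) = e / 2" using A.\<Delta>_pos by simp
  also have "(\<integral>\<^sup>+\<omega>. (\<Prod>i\<in>{1..n}. B.halt_factor n \<beta> i (Z' (?t i) \<omega>)) \<partial>M) = B.halt_prob n \<beta>"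
    by (simp only: B.halt_prob_def)
  also have "(\<integral>\<^sup>+\<omega>. (\<Prod>i\<in>{1..n}. g i (Z (?t i) \<omega>)) \<partial>M) = K * A.halt_prob n \<beta>"
  proof -
    have "(\<Prod>i\<in>{1..n}. if i = n then K else 1) = K" using n by (simp add: prod.delta)
    then have "(\<Prod>i\<in>{1..n}. g i (Z (?t i) \<omega>)) = K * (\<Prod>i\<in>{1..n}. A.halt_factor n \<beta> i (Z (?t i) \<omega>))" for \<omega>
      by (simp only: g_def prod.distrib)
    moreover have "(\<lambda>\<omega>. \<Prod>i\<in>{1..n}. A.halt_factor n \<beta> i (Z (?t i) \<omega>)) \<in> borel_measurable M"
    proof (intro borel_measurable_prod_ennreal measurable_compose[OF _ Am])
      fix i assume "i \<in> {1..n}"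
      then show "Z (?t i) \<in> borel_measurable M"
        by (intro measurable_compose[OF A.id_FZ A.Z_FZ] A.time_ge_\<eta>) simp
    qed
    ultimately show ?thesis by (simp only: A.halt_prob_def nn_integral_cmult)
  qed
  finally have "ennreal (exp (e / 2)) * (K * A.halt_prob n \<beta>) \<le> ennreal (exp (e / 2)) * (ennreal (exp (e / 2)) * B.halt_prob n \<beta>)"
    by (intro mult_left_mono) auto
  then have "A.halt_prob n \<beta> \<le> ennreal (exp e) * B.halt_prob n \<beta>"
    by (simp add: mult.assoc[symmetric] ennreal_mult[symmetric] K_def exp_minus flip: exp_add)
  then show ?thesis by (simp only: e_def)
qed

abbreviation "prefix_loss n \<equiv> privacy_loss (prefix_law M Alg n) (prefix_law M Alg' n)"

text \<open>The complement of the event of the privacy boundary for the fixed round n; as that event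
  is formed with a weak inequality, the inequality here is strict.\<close>

definition good_prefix :: "nat \<Rightarrow> (nat \<Rightarrow> real ^ 'd) set" where
  "good_prefix n = {\<beta>\<in>space (A.prefixM n). prefix_loss n \<beta> < ereal (A.eps n \<beta>)}"

definition good_out :: "nat \<Rightarrow> (nat \<Rightarrow> (real ^ 'd) \<times> bool) set" where
  "good_out n = {y\<in>halt_set n. iterates n y \<in> good_prefix n}"

lemma sets_law [simp]: "sets A.law = sets (outM :: (nat \<Rightarrow> (real ^ 'd) \<times> bool) measure)"
    "sets B.law = sets (outM :: (nat \<Rightarrow> (real ^ 'd) \<times> bool) measure)"
  by (simp_all add: rat_law_def)

lemma sets_prefix_law: "sets (prefix_law M Alg n) = sets (A.prefixM n)" "sets (prefix_law M Alg' n) = sets (A.prefixM n)"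
  by (simp_all add: prefix_law_def)

lemma good_prefix_measurable: assumes n: "1 \<le> n" shows "good_prefix n \<in> sets (A.prefixM n)"
proof -
  have [measurable]: "prefix_loss n \<in> borel_measurable (A.prefixM n)"
    using privacy_loss_measurable[of "prefix_law M Alg n" "prefix_law M Alg' n"]
    by (simp only: measurable_cong_sets[OF sets_prefix_law(1) refl])
  have [measurable]: "A.eps n \<in> borel_measurable (A.prefixM n)" using n by (intro A.eps_measurable) auto
  show ?thesis unfolding good_prefix_def by measurable
qed

lemma good_out_measurable: assumes n: "1 \<le> n" shows "good_out n \<in> sets outM"
proof -
  have "good_out n = halt_set n \<inter> (iterates n -` good_prefix n \<inter> space outM)"
    by (auto simp: good_out_def halt_set_def)
  then show ?thesis
    by (simp only: sets.Int halt_set_measurable measurable_sets[OF iterates_measurable good_prefix_measurable[OF n]])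
qed

text \<open>One factor exp eps_n comes from the loss of the iterates, which is bounded on
  \<open>good_prefix n\<close>, the other from \<open>halt_prob_le\<close>. Both prefix laws are
  written as densities for their sum, since neither need be absolutely continuous for the
  other.\<close>

lemma law_good_le:
  assumes n: "1 \<le> n" and S: "S \<in> sets outM" "S \<subseteq> good_out n"
  shows "emeasure A.law S \<le> (\<integral>\<^sup>+y. ennreal (exp (2 * A.eps n (iterates n y))) * indicator S y \<partial>B.law)"
proof -
  let ?P = "prefix_law M Alg n" and ?Q = "prefix_law M Alg' n"
  let ?\<rho> = "sum_law ?P ?Q"
  have "prob_space ?P" "prob_space ?Q"
    unfolding prefix_law_def by (auto intro: A.prob_space_distr A.prefix_measurable B.prefix_measurable)
  then have fin: "finite_measure ?P" "finite_measure ?Q" by (simp_all add: prob_space.finite_measure)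
  have sets_PQ: "sets ?Q = sets ?P" by (simp only: sets_prefix_law)
  define p where "p = RN_deriv ?\<rho> ?P"
  define q where "q = RN_deriv ?\<rho> ?Q"
  note D = density_RN_deriv_sum_law[OF fin sets_PQ, folded p_def q_def]
  have sets_\<rho>: "sets ?\<rho> = sets (A.prefixM n)" by (simp add: sets_prefix_law)
  have m\<rho>: "g \<in> borel_measurable ?\<rho>" if "g \<in> borel_measurable (A.prefixM n)" for g :: "(nat \<Rightarrow> real ^ 'd) \<Rightarrow> ennreal"
    using that by (simp only: measurable_cong_sets[OF sets_\<rho> refl])
  have pm: "p \<in> borel_measurable ?\<rho>" "q \<in> borel_measurable ?\<rho>" unfolding p_def q_def by auto
  have eps_m: "A.eps n \<in> borel_measurable (A.prefixM n)" using n by (intro A.eps_measurable) auto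
  have ind: "(\<lambda>\<beta>. indicator S (pad n \<beta>) :: ennreal) \<in> borel_measurable (A.prefixM n)"
    by (rule measurable_compose[OF pad_measurable borel_measurable_indicator[OF S(1)]])
  have expm: "(\<lambda>\<beta>. ennreal (exp (c * A.eps n \<beta>))) \<in> borel_measurable (A.prefixM n)" for c
  proof -
    note [measurable] = eps_m
    show ?thesis by measurable
  qed
  have S_halt: "indicator S y = (indicator S y * indicator (halt_set n) y :: ennreal)" for y
    using S(2) by (auto simp: good_out_def split: split_indicator)
  have "emeasure A.law S = (\<integral>\<^sup>+y. indicator S y * indicator (halt_set n) y \<partial>A.law)"
    unfolding S_halt[symmetric] using S(1) by (intro nn_integral_indicator[symmetric]) simp
  also have "\<dots> = (\<integral>\<^sup>+\<beta>. indicator S (pad n \<beta>) * A.halt_prob n \<beta> \<partial>density ?\<rho> p)"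
    unfolding D(1) using S(1) by (intro A.nn_integral_law n borel_measurable_indicator)
  also have "\<dots> = (\<integral>\<^sup>+\<beta>. p \<beta> * (indicator S (pad n \<beta>) * A.halt_prob n \<beta>) \<partial>?\<rho>)"
    by (intro nn_integral_density pm borel_measurable_times_ennreal m\<rho> ind A.halt_prob_measurable)
  also have "\<dots> \<le> (\<integral>\<^sup>+\<beta>. q \<beta> * (ennreal (exp (2 * A.eps n \<beta>)) * indicator S (pad n \<beta>) * B.halt_prob n \<beta>) \<partial>?\<rho>)"
  proof (rule nn_integral_mono_AE)
    have "AE \<beta> in ?\<rho>. \<beta> \<in> space ?\<rho>" by (rule AE_space)
    then show "AE \<beta> in ?\<rho>. p \<beta> * (indicator S (pad n \<beta>) * A.halt_prob n \<beta>)
      \<le> q \<beta> * (ennreal (exp (2 * A.eps n \<beta>)) * indicator S (pad n \<beta>) * B.halt_prob n \<beta>)"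
      using D(3)
    proof eventually_elim
      case (elim \<beta>)
      show ?case
      proof (cases "pad n \<beta> \<in> S")
        case True
        have "\<beta> \<in> space (A.prefixM n)" using elim(1) sets_eq_imp_space_eq[OF sets_\<rho>] by simp
        then have "\<beta> \<in> good_prefix n" using True S(2) iterates_pad[of \<beta> n] by (auto simp: good_out_def)
        then have "prefix_loss n \<beta> \<le> ereal (A.eps n \<beta>)"
          unfolding good_prefix_def by (intro less_imp_le) (simp only: mem_Collect_eq)
        then have "p \<beta> \<le> ennreal (exp (A.eps n \<beta>)) * q \<beta>"
          using elim(2) unfolding p_def q_def by (blast intro: iffD1[OF privacy_loss_le_iff])
        then have "p \<beta> * A.halt_prob n \<beta> \<le> (ennreal (exp (A.eps n \<beta>)) * q \<beta>) * (ennreal (exp (A.eps n \<beta>)) * B.halt_prob n \<beta>)"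
          by (intro mult_mono halt_prob_le n) auto
        also have "\<dots> = q \<beta> * ((ennreal (exp (A.eps n \<beta>)) * ennreal (exp (A.eps n \<beta>))) * B.halt_prob n \<beta>)"
          by (simp only: ac_simps)
        also have "ennreal (exp (A.eps n \<beta>)) * ennreal (exp (A.eps n \<beta>)) = ennreal (exp (2 * A.eps n \<beta>))"
          by (simp flip: ennreal_mult exp_add)
        finally show ?thesis using True by simp
      qed simp
    qed
  qed
  also have "\<dots> = (\<integral>\<^sup>+\<beta>. ennreal (exp (2 * A.eps n \<beta>)) * indicator S (pad n \<beta>) * B.halt_prob n \<beta> \<partial>density ?\<rho> q)"
    by (intro nn_integral_density[symmetric] pm borel_measurable_times_ennreal m\<rho> ind expm B.halt_prob_measurable)
  also have "\<dots> = (\<integral>\<^sup>+\<beta>. ennreal (exp (2 * A.eps n (iterates n (pad n \<beta>)))) * indicator S (pad n \<beta>) * B.halt_prob n \<beta> \<partial>?Q)"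
    unfolding D(2)
  proof (rule nn_integral_cong)
    fix \<beta> assume "\<beta> \<in> space ?Q"
    then have "\<beta> \<in> space (A.prefixM n)" by (simp add: prefix_law_def)
    then show "ennreal (exp (2 * A.eps n \<beta>)) * indicator S (pad n \<beta>) * B.halt_prob n \<beta>
      = ennreal (exp (2 * A.eps n (iterates n (pad n \<beta>)))) * indicator S (pad n \<beta>) * B.halt_prob n \<beta>"
      by (simp only: iterates_pad)
  qed
  also have "\<dots> = (\<integral>\<^sup>+y. ennreal (exp (2 * A.eps n (iterates n y))) * indicator S y * indicator (halt_set n) y \<partial>B.law)"
    by (intro B.nn_integral_law[symmetric] n borel_measurable_times_ennreal borel_measurable_indicator S
        measurable_compose[OF iterates_measurable expm])
  also have "\<dots> = (\<integral>\<^sup>+y. ennreal (exp (2 * A.eps n (iterates n y))) * indicator S y \<partial>B.law)"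
    by (simp only: mult.assoc S_halt[symmetric])
  finally show ?thesis .
qed

lemma law_loss_exceeds_null:
  assumes n: "1 \<le> n"
  shows "emeasure A.law {y\<in>good_out n. ereal (2 * A.eps n (iterates n y)) < privacy_loss A.law B.law y} = 0"
proof (rule privacy_loss_exceeds_null)
  show "finite_measure A.law" "finite_measure B.law"
    unfolding rat_law_def by (rule A.finite_measure_distr[OF A.output_measurable], rule A.finite_measure_distr[OF B.output_measurable])
  have "A.eps n \<in> borel_measurable (A.prefixM n)" using n by (intro A.eps_measurable) auto
  from measurable_compose[OF iterates_measurable this]
  have [measurable]: "(\<lambda>y. A.eps n (iterates n y)) \<in> borel_measurable A.law"
    by (simp only: measurable_cong_sets[OF sets_law(1) refl])
  show "(\<lambda>y. 2 * A.eps n (iterates n y)) \<in> borel_measurable A.law" by measurable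
  show "2 * A.eps n (iterates n y) \<le> 2 * \<epsilon>max" for y using A.eps_bounds(2)[OF n] by simp
  show "good_out n \<in> sets A.law" using good_out_measurable[OF n] by simp
  show "emeasure A.law S \<le> (\<integral>\<^sup>+y. ennreal (exp (2 * A.eps n (iterates n y))) * indicator S y \<partial>B.law)"
    if "S \<in> sets A.law" "S \<subseteq> good_out n" for S
    using that by (intro law_good_le n) simp_all
qed simp

text \<open>Outside the event of the privacy boundary, a run that halts in round n has its output in
  \<open>good_out n\<close>, where an excessive loss has probability 0. Splitting by the halting
  round replaces the random round by fixed ones, and countably many null sets are discarded.\<close>

lemma rat_ex_post_private:
  defines "bad \<equiv> {\<omega>\<in>space M. A.halt \<omega> < \<infinity> \<and>
    ereal (2 * rat_eps E Alg (the_enat (A.halt \<omega>)) \<omega>) < privacy_loss A.law B.law (A.output \<omega>)}"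
  assumes Ev: "{\<omega>\<in>space M. \<exists>n\<ge>1. ereal (A.eps n (A.algs n \<omega>)) \<le> prefix_loss n (A.algs n \<omega>)} \<in> sets M" (is "?Ev \<in> _")
  shows "bad \<in> sets M" "measure M bad \<le> measure M ?Ev"
proof -
  define bad' where "bad' n = {\<omega>\<in>space M. A.halt \<omega> = enat n \<and>
    ereal (2 * A.eps n (A.algs n \<omega>)) < privacy_loss A.law B.law (A.output \<omega>)}" for n
  have bad'_m: "bad' n \<in> sets M" if n: "1 \<le> n" for n
  proof -
    have "privacy_loss A.law B.law \<in> borel_measurable outM"
      using privacy_loss_measurable[of A.law B.law] by (simp only: measurable_cong_sets[OF sets_law(1) refl])
    from measurable_compose[OF A.output_measurable this]
    have [measurable]: "(\<lambda>\<omega>. privacy_loss A.law B.law (A.output \<omega>)) \<in> borel_measurable M" .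
    have [measurable]: "(\<lambda>\<omega>. A.eps n (A.algs n \<omega>)) \<in> borel_measurable M"
      using n by (intro measurable_compose[OF A.prefix_measurable A.eps_measurable]) auto
    have "{\<omega>\<in>space M. ereal (2 * A.eps n (A.algs n \<omega>)) < privacy_loss A.law B.law (A.output \<omega>)} \<in> sets M"
      by measurable
    then show ?thesis unfolding bad'_def by (intro sets.sets_Collect_conj A.halt_eq_measurable n)
  qed
  \<comment> \<open>The infimum in \<open>rat_halt\<close> ranges over rounds from 1 on, so a finite
    halting round is never 0 and the lemmas for fixed n \<ge> 1 cover all cases.\<close>
  have halt_pos: "1 \<le> n" if "A.halt \<omega> = enat n" for n \<omega>
  proof -
    have "enat 1 \<le> A.halt \<omega>" unfolding rat_halt_def by (intro INF_greatest) simp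
    then show ?thesis using that by simp
  qed
  have bad_eq: "bad = (\<Union>n\<in>{1..}. bad' n)"
  proof (intro set_eqI iffI)
    fix \<omega> assume \<omega>: "\<omega> \<in> bad"
    then obtain n where n: "A.halt \<omega> = enat n" by (auto simp: bad_def)
    have "\<omega> \<in> bad' n"
      using \<omega> n A.rat_eps_prefix[of n n \<omega>] halt_pos[OF n] by (simp add: bad_def bad'_def)
    then show "\<omega> \<in> (\<Union>n\<in>{1..}. bad' n)" using halt_pos[OF n] by blast
  next
    fix \<omega> assume "\<omega> \<in> (\<Union>n\<in>{1..}. bad' n)"
    then obtain n where "1 \<le> n" "\<omega> \<in> bad' n" by auto
    then show "\<omega> \<in> bad" using A.rat_eps_prefix[of n n \<omega>] by (simp add: bad_def bad'_def)
  qed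
  show "bad \<in> sets M" unfolding bad_eq using bad'_m by (intro sets.countable_UN') auto
  have "AE \<omega> in M. \<forall>n. 1 \<le> n \<longrightarrow>
    A.output \<omega> \<notin> {y\<in>good_out n. ereal (2 * A.eps n (iterates n y)) < privacy_loss A.law B.law y}"
  proof (subst AE_all_countable, rule allI)
    fix n
    let ?B = "{y\<in>good_out n. ereal (2 * A.eps n (iterates n y)) < privacy_loss A.law B.law y}"
    show "AE \<omega> in M. 1 \<le> n \<longrightarrow> A.output \<omega> \<notin> ?B"
    proof (cases "1 \<le> n")
      case True
      have B: "?B \<in> sets outM"
      proof -
        have [measurable]: "privacy_loss A.law B.law \<in> borel_measurable outM"
          using privacy_loss_measurable[of A.law B.law] by (simp only: measurable_cong_sets[OF sets_law(1) refl])
        have [measurable]: "(\<lambda>y. A.eps n (iterates n y)) \<in> borel_measurable outM"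
          using True by (intro measurable_compose[OF iterates_measurable A.eps_measurable]) auto
        have "{y\<in>space outM. ereal (2 * A.eps n (iterates n y)) < privacy_loss A.law B.law y} \<in> sets outM"
          by measurable
        then have "good_out n \<inter> {y\<in>space outM. ereal (2 * A.eps n (iterates n y)) < privacy_loss A.law B.law y} \<in> sets outM"
          by (intro sets.Int good_out_measurable True)
        also have "good_out n \<inter> {y\<in>space outM. ereal (2 * A.eps n (iterates n y)) < privacy_loss A.law B.law y} = ?B"
          by (auto simp: good_out_def halt_set_def)
        finally show ?thesis .
      qed
      have "AE y in A.law. y \<notin> ?B"
        using B law_loss_exceeds_null[OF True] by (intro AE_not_in null_setsI) simp_all
      then have "AE \<omega> in M. A.output \<omega> \<notin> ?B"
        unfolding rat_law_def by (rule AE_distrD[OF A.output_measurable])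
      then show ?thesis by eventually_elim simp
    qed simp
  qed
  then have "AE \<omega> in M. \<omega> \<in> bad \<longrightarrow> \<omega> \<in> ?Ev"
  proof eventually_elim
    case (elim \<omega>)
    show ?case
    proof
      assume "\<omega> \<in> bad"
      then obtain n where n: "1 \<le> n" and \<omega>: "\<omega> \<in> bad' n" unfolding bad_eq by auto
      have sp: "\<omega> \<in> space M" and h: "A.halt \<omega> = enat n" using \<omega> by (simp_all add: bad'_def)
      have pr: "A.algs n \<omega> \<in> space (A.prefixM n)" by (rule measurable_space[OF A.prefix_measurable sp])
      have it: "iterates n (A.output \<omega>) = A.algs n \<omega>"
        unfolding A.output_eq_pad[OF h] by (rule iterates_pad[OF pr])
      have "ereal (2 * A.eps n (iterates n (A.output \<omega>))) < privacy_loss A.law B.law (A.output \<omega>)"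
        using \<omega> unfolding it by (simp only: bad'_def mem_Collect_eq)
      then have "A.output \<omega> \<notin> good_out n" using elim n by blast
      then have "A.algs n \<omega> \<notin> good_prefix n"
        using A.output_in_halt_set[OF sp n] h it by (simp add: good_out_def)
      then have "ereal (A.eps n (A.algs n \<omega>)) \<le> prefix_loss n (A.algs n \<omega>)"
        using pr unfolding good_prefix_def by (simp only: mem_Collect_eq not_less simp_thms)
      then show "\<omega> \<in> ?Ev" using sp n by blast
    qed
  qed
  then show "measure M bad \<le> measure M ?Ev" by (rule A.finite_measure_mono_AE[OF _ Ev])
qed

end

theorem corollary5p2:
  fixes M :: "'w measure"
    and nb :: "'x \<Rightarrow> 'x \<Rightarrow> bool"
    and f :: "'x \<Rightarrow> real ^ 'd"
    and T :: "nat \<Rightarrow> (nat \<Rightarrow> real ^ 'd) \<Rightarrow> real"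
    and B :: "real \<Rightarrow> 'w \<Rightarrow> real ^ 'd"
    and \<psi> :: "real \<Rightarrow> real"
    and u :: "real ^ 'd \<Rightarrow> 'x \<Rightarrow> real"
    and Z :: "'x \<Rightarrow> real \<Rightarrow> 'w \<Rightarrow> real"
    and \<xi> :: "'x \<Rightarrow> nat \<Rightarrow> 'w \<Rightarrow> real"
    and \<delta> \<Delta> \<tau> \<epsilon>max :: real
  defines "BM \<equiv> brownian_mech f T B"
    and "E \<equiv> \<lambda>n \<beta>. \<psi> (T n \<beta>)"
  defines "N \<equiv> \<lambda>x. rat_halt \<Delta> \<tau> (\<lambda>\<beta>. u \<beta> x) E (BM x) (Z x) (\<xi> x)"
    and "output \<equiv> \<lambda>x. rat_output \<Delta> \<tau> (\<lambda>\<beta>. u \<beta> x) E (BM x) (Z x) (\<xi> x)"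
    and "law \<equiv> \<lambda>x. rat_law M \<Delta> \<tau> (\<lambda>\<beta>. u \<beta> x) E (BM x) (Z x) (\<xi> x)"
  assumes "0 < \<delta>" and "\<delta> < 1" and "0 < \<Delta>" and "0 < \<epsilon>max"
    and "brownian_motion M B"
    and "time_functions T"
    and "privacy_boundary M nb f T B \<delta> \<psi>"
    and "privacy_functions \<epsilon>max E"
    and "\<And>x. (\<lambda>\<beta>. u \<beta> x) \<in> borel_measurable borel"
    and "\<And>\<beta>. sensitive nb \<Delta> (u \<beta>)"
    and "\<And>x. rat_noise M \<Delta> \<epsilon>max E (BM x) (Z x) (\<xi> x)"
  shows "\<forall>x x'. nb x x' \<longrightarrow>
    (let bad = {\<omega> \<in> space M. N x \<omega> < \<infinity> \<and>
                  privacy_loss (law x) (law x') (output x \<omega>)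
                    > ereal (2 * \<psi> (brownian_mech_time f T B x (the_enat (N x \<omega>)) \<omega>))}
     in bad \<in> sets M \<and> measure M bad \<le> \<delta>)"
proof (intro allI impI)
  fix x x' assume nb: "nb x x'"
  have M: "prob_space M" using assms(10) by (simp add: brownian_motion_def)
  have axioms: "rat_run M \<Delta> \<epsilon>max (\<lambda>\<beta>. u \<beta> x) E (BM x) (Z x) (\<xi> x)" for x
    unfolding rat_run_def rat_run_axioms_def using M assms(8,9,13,14,16) by simp
  interpret rat_pair M \<Delta> \<epsilon>max \<tau> "\<lambda>\<beta>. u \<beta> x" "\<lambda>\<beta>. u \<beta> x'" E "BM x" "BM x'" "Z x" "Z x'" "\<xi> x" "\<xi> x'"
    unfolding rat_pair_def rat_pair_axioms_def
    using axioms assms(15) nb by (simp add: sensitive_def)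
  let ?Ev = "{\<omega>\<in>space M. \<exists>n\<ge>1. ereal (A.eps n (A.algs n \<omega>)) \<le> prefix_loss n (A.algs n \<omega>)}"
  \<comment> \<open>Both sides evaluate \<psi> at the time function of the first n - 1 iterates;
    this identifies the privacy level of round n with the boundary value \<psi> (T_n).\<close>
  have E_eq: "\<psi> (brownian_mech_time f T B x n \<omega>) = rat_eps E (BM x) n \<omega>" for n \<omega>
    by (simp add: brownian_mech_time_def rat_eps_def E_def BM_def)
  have Ev_eq: "?Ev = {\<omega>\<in>space M. \<exists>n\<ge>1. brownian_loss M f T B n x x' \<omega>
      \<ge> ereal (\<psi> (brownian_mech_time f T B x n \<omega>))}"
  proof (intro Collect_cong conj_cong refl ex_cong1)
    fix \<omega> and n :: nat assume n: "1 \<le> n"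
    show "ereal (A.eps n (A.algs n \<omega>)) \<le> prefix_loss n (A.algs n \<omega>)
      \<longleftrightarrow> brownian_loss M f T B n x x' \<omega> \<ge> ereal (\<psi> (brownian_mech_time f T B x n \<omega>))"
      unfolding E_eq unfolding A.rat_eps_prefix[OF n le_SucI[OF order_refl]] brownian_loss_def
      unfolding BM_def ..
  qed
  have Ev: "?Ev \<in> sets M" "measure M ?Ev \<le> \<delta>"
    using assms(12) nb unfolding Ev_eq privacy_boundary_def Let_def by blast+
  show "let bad = {\<omega> \<in> space M. N x \<omega> < \<infinity> \<and>
                  privacy_loss (law x) (law x') (output x \<omega>)
                    > ereal (2 * \<psi> (brownian_mech_time f T B x (the_enat (N x \<omega>)) \<omega>))}
     in bad \<in> sets M \<and> measure M bad \<le> \<delta>"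
    unfolding Let_def E_eq N_def output_def law_def
    using rat_ex_post_private[OF Ev(1)] Ev(2) by auto
qed

end
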